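(* The following assignment is a $2$-functor $i\colon\mathsf{Mix}\to\mathsf{Dist}$: - a $0$-cell $(\mathcal A,\theta,\mathbb B,\mathbb C)$ of $\mathsf{Mix}$ is sent to $(\mathcal A^{\mathbb B},\tilde\theta,\tilde{\mathbb B},\tilde{\mathbb C})$; - a $1$-cell $(\Sigma,\sigma,\gamma)\colon(\mathcal A,\theta,\mathbb B,\mathbb C)\to(\mathcal D,\psi,\mathbb A,\mathbb D)$ is sent to $(\tilde\Sigma,\tilde\sigma,\tilde\gamma)\colon(\mathcal A^{\mathbb B},\tilde\theta,\tilde{\mathbb B},\tilde{\mathbb C})\to(\mathcal D^{\mathbb A},\tilde\psi,\tilde{\mathbb A},\tilde{\mathbb D})$; - a $2$-cell $\alpha\colon(\Sigma,\sigma,\gamma)\Rightarrow(\Sigma',\sigma',\gamma')$ is sent to its lift $\tilde\alpha\colon(\tilde\Sigma,\tilde\sigma,\tilde\gamma)\Rightarrow(\tilde\Sigma',\tilde\sigma',\tilde\gamma')$.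
   Context: Juxtaposition denotes composition of functors and whiskering. A comonad distributive law $\chi\colon\mathbb T\mathbb S\to\mathbb S\mathbb T$ is a natural transformation $\chi\colon TS\to ST$ compatible with counits and comultiplications of both comonads: $S\epsilon^T\circ\chi=\epsilon^TS$, $S\Delta^T\circ\chi=\chi T\circ T\chi\circ\Delta^TS$, $\epsilon^ST\circ\chi=T\epsilon^S$, $\Delta^ST\circ\chi=S\chi\circ\chi S\circ T\Delta^S$. A mixed distributive law $\theta\colon\mathbb B\mathbb C\to\mathbb C\mathbb B$ between a monad $\mathbb B=(B,\mu,\eta)$ and a comonad $\mathbb C=(C,\Delta^C,\epsilon^C)$ is a natural transformation $\theta\colon BC\to CB$ with $\theta\circ\eta C=C\eta$, $\theta\circ\mu C=C\mu\circ\theta B\circ B\theta$, $\epsilon^CB\circ\theta=B\epsilon^C$, $\Delta^CB\circ\theta=C\theta\circ\theta C\circ B\Delta^C$. $\mathsf{Dist}$ is the $2$-category with: $0$-cells $(\mathcal B,\chi,\mathbb T,\mathbb S)$, where $\chi\colon\mathbb T\mathbb S\to\mathbb S\mathbb T$ is a comonad distributive law on the category $\mathcal B$; $1$-cells $(\mathcal B,\chi,\mathbb T,\mathbb S)\to(\mathcal D,\tau,\mathbb G,\mathbb C)$ are triples $(\Sigma,\sigma,\gamma)$ with $\Sigma\colon\mathcal B\to\mathcal D$ a functor, $\sigma\colon G\Sigma\to\Sigma T$ a lax morphism of comonads (i.e. $\Sigma\epsilon^T\circ\sigma=\epsilon^G\Sigma$, $\Sigma\Delta^T\circ\sigma=\sigma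 T\circ G\sigma\circ\Delta^G\Sigma$), and $\gamma\colon\Sigma S\to C\Sigma$ a colax morphism of comonads (i.e. $\epsilon^C\Sigma\circ\gamma=\Sigma\epsilon^S$, $\Delta^C\Sigma\circ\gamma=C\gamma\circ\gamma S\circ\Sigma\Delta^S$), satisfying the Yang-Baxter equation $\gamma T\circ\Sigma\chi\circ\sigma S=C\sigma\circ\tau\Sigma\circ G\gamma\colon G\Sigma S\to C\Sigma T$; $2$-cells $(\Sigma,\sigma,\gamma)\Rightarrow(\Sigma',\sigma',\gamma')$ are natural transformations $\alpha\colon\Sigma\to\Sigma'$ with $\sigma'\circ G\alpha=\alpha T\circ\sigma$ and $\gamma'\circ\alpha S=C\alpha\circ\gamma$. Composition of $1$-cells is $(\Sigma',\sigma',\gamma')\circ(\Sigma,\sigma,\gamma)=(\Sigma'\Sigma,\Sigma'\sigma\circ\sigma'\Sigma,\gamma'\Sigma\circ\Sigma'\gamma)$; $2$-cells compose as natural transformations. $\mathsf{Mix}$ is defined in the same way with mixed distributive laws: $0$-cells $(\mathcal A,\theta,\mathbb B,\mathbb C)$ with $\theta\colon\mathbb B\mathbb C\to\mathbb C\mathbb B$ a mixed distributive law between a monad $\mathbb B$ and a comonad $\mathbb C$ on $\mathcal A$; $1$-cells $(\mathcal A,\theta,\mathbb B,\mathbb C)\to(\mathcal D,\psi,\mathbb A,\mathbb D)$ are triples $(\Sigma,\sigma,\gamma)$ with $\Sigma\colon\mathcal A\to\mathcal D$ a functor, $\sigma\colon A\Sigma\to\Sigma B$ a lax morphism of monads (i.e.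 $\sigma\circ\eta^A\Sigma=\Sigma\eta^B$, $\sigma\circ\mu^A\Sigma=\Sigma\mu^B\circ\sigma B\circ A\sigma$), $\gamma\colon\Sigma C\to D\Sigma$ a colax morphism of comonads, and $\gamma B\circ\Sigma\theta\circ\sigma C=D\sigma\circ\psi\Sigma\circ A\gamma$; $2$-cells are natural transformations $\alpha\colon\Sigma\to\Sigma'$ with $\sigma'\circ A\alpha=\alpha B\circ\sigma$ and $\gamma'\circ\alpha C=D\alpha\circ\gamma$. Given a $0$-cell $(\mathcal A,\theta,\mathbb B,\mathbb C)$ of $\mathsf{Mix}$, let $\mathcal A^{\mathbb B}$ be the Eilenberg-Moore category of $\mathbb B$-algebras $(X,\alpha)$ with free-forgetful adjunction $F\dashv U$. Then $\tilde{\mathbb B}$ is the comonad $FU$ on $\mathcal A^{\mathbb B}$, so $\tilde B(X,\alpha)=(BX,\mu_X)$; $\tilde{\mathbb C}$ is the lift of $\mathbb C$ with $\tilde C(X,\alpha)=(CX,C\alpha\circ\theta_X)$ and comonad structure that of $\mathbb C$; and $\tilde\theta\colon\tilde{\mathbb B}\tilde{\mathbb C}\to\tilde{\mathbb C}\tilde{\mathbb B}$ is the comonad distributive law with component $\theta_X$ at $(X,\alpha)$. Given a $1$-cell $(\Sigma,\sigma,\gamma)$ as in the claim: $\tilde\Sigma(X,\alpha)=(\Sigma X,\ \Sigma\alpha\circ\sigma_X\colon A\Sigma X\to\Sigma X)$ and $\tilde\Sigma f=\Sigma f$ on morphisms; $\tilde\sigma\colon\tilde A\tilde\Sigma\to\tilde\Sigma\tilde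 B$ has component $\sigma_X$ at $(X,\alpha)$; $\tilde\gamma\colon\tilde\Sigma\tilde C\to\tilde D\tilde\Sigma$ has component $\gamma_X$ at $(X,\alpha)$. For a $2$-cell $\alpha\colon\Sigma\to\Sigma'$, $\tilde\alpha$ has component $\alpha_X$ at an algebra with underlying object $X$. *)

theory Defs
  imports "HOL-Library.FuncSet"
begin

section \<open>Categories, functors, natural transformations\<close>

record ('o, 'a) cat =
  Obj :: "'o set"
  Arr :: "'a set"
  Dom :: "'a \<Rightarrow> 'o"
  Cod :: "'a \<Rightarrow> 'o"
  Id :: "'o \<Rightarrow> 'a"
  Comp :: "'a \<Rightarrow> 'a \<Rightarrow> 'a"  \<comment> \<open>\<open>Comp C g f\<close> is \<open>g\<close> after \<open>f\<close>\<close>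

definition hom :: "('o, 'a) cat \<Rightarrow> 'o \<Rightarrow> 'o \<Rightarrow> 'a set" where
  "hom C X Y = {f \<in> Arr C. Dom C f = X \<and> Cod C f = Y}"

locale category =
  fixes C :: "('o, 'a) cat"
  assumes Dom_in: "f \<in> Arr C \<Longrightarrow> Dom C f \<in> Obj C"
    and Cod_in: "f \<in> Arr C \<Longrightarrow> Cod C f \<in> Obj C"
    and Id_in: "X \<in> Obj C \<Longrightarrow> Id C X \<in> hom C X X"
    and Comp_in: "f \<in> hom C X Y \<Longrightarrow> g \<in> hom C Y Z \<Longrightarrow> Comp C g f \<in> hom C X Z"
    and Comp_Id: "f \<in> hom C X Y \<Longrightarrow> Comp C f (Id C X) = f"
    and Id_Comp: "f \<in> hom C X Y \<Longrightarrow> Comp C (Id C Y) f = f"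
    and Comp_assoc: "f \<in> hom C W X \<Longrightarrow> g \<in> hom C X Y \<Longrightarrow> h \<in> hom C Y Z \<Longrightarrow>
      Comp C h (Comp C g f) = Comp C (Comp C h g) f"

record ('o, 'a, 'p, 'b) fctr =
  FObj :: "'o \<Rightarrow> 'p"
  FArr :: "'a \<Rightarrow> 'b"

text \<open>Functors and natural transformations are \<^const>\<open>undefined\<close> outside their domain, so that
  HOL equality of the data is equality of functors, respectively of natural transformations.\<close>

locale cat_functor = S: category C + T: category D
  for C :: "('o, 'a) cat" and D :: "('p, 'b) cat" +
  fixes F :: "('o, 'a, 'p, 'b) fctr"
  assumes FObj_in: "FObj F \<in> Obj C \<rightarrow>\<^sub>E Obj D"
    and FArr_ext: "FArr F \<in> extensional (Arr C)"
    and FArr_in: "f \<in> hom C X Y \<Longrightarrow> FArr F f \<in> hom D (FObj F X) (FObj F Y)"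
    and FArr_Id: "X \<in> Obj C \<Longrightarrow> FArr F (Id C X) = Id D (FObj F X)"
    and FArr_Comp: "f \<in> hom C X Y \<Longrightarrow> g \<in> hom C Y Z \<Longrightarrow>
      FArr F (Comp C g f) = Comp D (FArr F g) (FArr F f)"

locale nat_trans = F: cat_functor C D F + G: cat_functor C D G
  for C :: "('o, 'a) cat" and D :: "('p, 'b) cat"
    and F :: "('o, 'a, 'p, 'b) fctr" and G :: "('o, 'a, 'p, 'b) fctr" +
  fixes \<tau> :: "'o \<Rightarrow> 'b"
  assumes comp_ext: "\<tau> \<in> extensional (Obj C)"
    and comp_in: "X \<in> Obj C \<Longrightarrow> \<tau> X \<in> hom D (FObj F X) (FObj G X)"
    and naturality: "f \<in> hom C X Y \<Longrightarrow>
      Comp D (\<tau> Y) (FArr F f) = Comp D (FArr G f) (\<tau> X)"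

text \<open>In each operation below the subscript \<open>C\<close> is the category on which the resulting functor
  or transformation is defined; \<open>D\<close>, where it occurs, is the category in which it takes values.\<close>

definition idF :: "('o, 'a) cat \<Rightarrow> ('o, 'a, 'o, 'a) fctr" where
  "idF C = \<lparr>FObj = (\<lambda>X\<in>Obj C. X), FArr = (\<lambda>f\<in>Arr C. f)\<rparr>"

definition compF :: "('p, 'b, 'q, 'c) fctr \<Rightarrow> ('o, 'a) cat \<Rightarrow> ('o, 'a, 'p, 'b) fctr
    \<Rightarrow> ('o, 'a, 'q, 'c) fctr"  (\<open>(_ \<odot>\<^bsub>_\<^esub> _)\<close> [76, 0, 75] 75) where
  "G \<odot>\<^bsub>C\<^esub> F = \<lparr>FObj = (\<lambda>X\<in>Obj C. FObj G (FObj F X)), FArr = (\<lambda>f\<in>Arr C. FArr G (FArr F f))\<rparr>"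

definition idN :: "('o, 'a) cat \<Rightarrow> ('p, 'b) cat \<Rightarrow> ('o, 'a, 'p, 'b) fctr \<Rightarrow> 'o \<Rightarrow> 'b" where
  "idN C D F = (\<lambda>X\<in>Obj C. Id D (FObj F X))"

definition compN :: "('o \<Rightarrow> 'b) \<Rightarrow> ('o, 'a) cat \<Rightarrow> ('p, 'b) cat \<Rightarrow> ('o \<Rightarrow> 'b) \<Rightarrow> 'o \<Rightarrow> 'b"
    (\<open>(_ \<bullet>\<^bsub>_,_\<^esub> _)\<close> [65, 0, 0, 66] 65) where
  "\<tau> \<bullet>\<^bsub>C,D\<^esub> \<sigma> = (\<lambda>X\<in>Obj C. Comp D (\<tau> X) (\<sigma> X))"

definition whiskL :: "('p, 'b, 'q, 'c) fctr \<Rightarrow> ('o, 'a) cat \<Rightarrow> ('o \<Rightarrow> 'b) \<Rightarrow> 'o \<Rightarrow> 'c"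
    (\<open>(_ \<rhd>\<^bsub>_\<^esub> _)\<close> [71, 0, 70] 70) where
  "H \<rhd>\<^bsub>C\<^esub> \<tau> = (\<lambda>X\<in>Obj C. FArr H (\<tau> X))"

definition whiskR :: "('p \<Rightarrow> 'c) \<Rightarrow> ('o, 'a) cat \<Rightarrow> ('o, 'a, 'p, 'b) fctr \<Rightarrow> 'o \<Rightarrow> 'c"
    (\<open>(_ \<lhd>\<^bsub>_\<^esub> _)\<close> [71, 0, 71] 70) where
  "\<tau> \<lhd>\<^bsub>C\<^esub> F = (\<lambda>X\<in>Obj C. \<tau> (FObj F X))"


section \<open>Strict 2-categories and 2-functors\<close>

text \<open>A 2-category is given by its 0-, 1- and 2-cells, where each 1-cell and each 2-cell knows its
  source and target. Every 2-cell is an arrow of two categories: vertically between 1-cells and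
  horizontally between 0-cells. \<open>comp1\<close>, \<open>vcomp\<close> and \<open>hcomp\<close> take their arguments in the order of
  composition of functions.\<close>

record ('z, 'f, 'c) twocat =
  Cell0 :: "'z set"
  Cell1 :: "'f set"
  Cell2 :: "'c set"
  src1 :: "'f \<Rightarrow> 'z"
  tgt1 :: "'f \<Rightarrow> 'z"
  src2 :: "'c \<Rightarrow> 'f"
  tgt2 :: "'c \<Rightarrow> 'f"
  id1 :: "'z \<Rightarrow> 'f"
  id2 :: "'f \<Rightarrow> 'c"
  comp1 :: "'f \<Rightarrow> 'f \<Rightarrow> 'f"
  vcomp :: "'c \<Rightarrow> 'c \<Rightarrow> 'c"
  hcomp :: "'c \<Rightarrow> 'c \<Rightarrow> 'c"

definition one_cat :: "('z, 'f, 'c) twocat \<Rightarrow> ('z, 'f) cat" where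
  "one_cat K = \<lparr>Obj = Cell0 K, Arr = Cell1 K, Dom = src1 K, Cod = tgt1 K,
    Id = id1 K, Comp = comp1 K\<rparr>"

definition vert_cat :: "('z, 'f, 'c) twocat \<Rightarrow> ('f, 'c) cat" where
  "vert_cat K = \<lparr>Obj = Cell1 K, Arr = Cell2 K, Dom = src2 K, Cod = tgt2 K,
    Id = id2 K, Comp = vcomp K\<rparr>"

definition horiz_cat :: "('z, 'f, 'c) twocat \<Rightarrow> ('z, 'c) cat" where
  "horiz_cat K = \<lparr>Obj = Cell0 K, Arr = Cell2 K,
    Dom = (\<lambda>\<alpha>. src1 K (src2 K \<alpha>)), Cod = (\<lambda>\<alpha>. tgt1 K (src2 K \<alpha>)),
    Id = (\<lambda>X. id2 K (id1 K X)), Comp = hcomp K\<rparr>"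

locale two_category =
  fixes K :: "('z, 'f, 'c) twocat"
  assumes one_category: "category (one_cat K)"
    and vert_category: "category (vert_cat K)"
    and horiz_category: "category (horiz_cat K)"
    and globular: "\<alpha> \<in> Cell2 K \<Longrightarrow> src1 K (src2 K \<alpha>) = src1 K (tgt2 K \<alpha>)"
      "\<alpha> \<in> Cell2 K \<Longrightarrow> tgt1 K (src2 K \<alpha>) = tgt1 K (tgt2 K \<alpha>)"
    and hcomp_boundary: "\<lbrakk>\<alpha> \<in> Cell2 K; \<beta> \<in> Cell2 K; tgt1 K (src2 K \<alpha>) = src1 K (src2 K \<beta>)\<rbrakk>
        \<Longrightarrow> src2 K (hcomp K \<beta> \<alpha>) = comp1 K (src2 K \<beta>) (src2 K \<alpha>)"
      "\<lbrakk>\<alpha> \<in> Cell2 K; \<beta> \<in> Cell2 K; tgt1 K (src2 K \<alpha>) = src1 K (src2 K \<beta>)\<rbrakk>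
        \<Longrightarrow> tgt2 K (hcomp K \<beta> \<alpha>) = comp1 K (tgt2 K \<beta>) (tgt2 K \<alpha>)"
    and hcomp_id2: "\<lbrakk>f \<in> Cell1 K; g \<in> Cell1 K; tgt1 K f = src1 K g\<rbrakk>
        \<Longrightarrow> hcomp K (id2 K g) (id2 K f) = id2 K (comp1 K g f)"
    and interchange: "\<lbrakk>\<alpha> \<in> Cell2 K; \<alpha>' \<in> Cell2 K; \<beta> \<in> Cell2 K; \<beta>' \<in> Cell2 K;
        tgt2 K \<alpha> = src2 K \<alpha>'; tgt2 K \<beta> = src2 K \<beta>'; tgt1 K (src2 K \<alpha>) = src1 K (src2 K \<beta>)\<rbrakk>
        \<Longrightarrow> hcomp K (vcomp K \<beta>' \<beta>) (vcomp K \<alpha>' \<alpha>) = vcomp K (hcomp K \<beta>' \<alpha>') (hcomp K \<beta> \<alpha>)"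

locale two_functor = S: two_category K + T: two_category L
  for K :: "('z, 'f, 'c) twocat" and L :: "('y, 'g, 'd) twocat" +
  fixes i0 :: "'z \<Rightarrow> 'y" and i1 :: "'f \<Rightarrow> 'g" and i2 :: "'c \<Rightarrow> 'd"
  assumes one_functor: "cat_functor (one_cat K) (one_cat L) \<lparr>FObj = i0, FArr = i1\<rparr>"
    and vert_functor: "cat_functor (vert_cat K) (vert_cat L) \<lparr>FObj = i1, FArr = i2\<rparr>"
    and horiz_functor: "cat_functor (horiz_cat K) (horiz_cat L) \<lparr>FObj = i0, FArr = i2\<rparr>"


section \<open>Monads, comonads and distributive laws\<close>

record ('o, 'a) mnd =
  MF :: "('o, 'a, 'o, 'a) fctr"
  unit :: "'o \<Rightarrow> 'a"
  mult :: "'o \<Rightarrow> 'a"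

record ('o, 'a) cmnd =
  CF :: "('o, 'a, 'o, 'a) fctr"
  counit :: "'o \<Rightarrow> 'a"
  comult :: "'o \<Rightarrow> 'a"

definition monad :: "('o, 'a) cat \<Rightarrow> ('o, 'a) mnd \<Rightarrow> bool" where
  "monad A M \<longleftrightarrow> (let B = MF M; \<eta> = unit M; \<mu> = mult M in
    nat_trans A A (idF A) B \<eta> \<and>
    nat_trans A A (B \<odot>\<^bsub>A\<^esub> B) B \<mu> \<and>
    \<mu> \<bullet>\<^bsub>A,A\<^esub> (B \<rhd>\<^bsub>A\<^esub> \<mu>) = \<mu> \<bullet>\<^bsub>A,A\<^esub> (\<mu> \<lhd>\<^bsub>A\<^esub> B) \<and>
    \<mu> \<bullet>\<^bsub>A,A\<^esub> (B \<rhd>\<^bsub>A\<^esub> \<eta>) = idN A A B \<and>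
    \<mu> \<bullet>\<^bsub>A,A\<^esub> (\<eta> \<lhd>\<^bsub>A\<^esub> B) = idN A A B)"

definition comonad :: "('o, 'a) cat \<Rightarrow> ('o, 'a) cmnd \<Rightarrow> bool" where
  "comonad A W \<longleftrightarrow> (let T = CF W; \<epsilon> = counit W; \<Delta> = comult W in
    nat_trans A A T (idF A) \<epsilon> \<and>
    nat_trans A A T (T \<odot>\<^bsub>A\<^esub> T) \<Delta> \<and>
    (T \<rhd>\<^bsub>A\<^esub> \<Delta>) \<bullet>\<^bsub>A,A\<^esub> \<Delta> = (\<Delta> \<lhd>\<^bsub>A\<^esub> T) \<bullet>\<^bsub>A,A\<^esub> \<Delta> \<and>
    (T \<rhd>\<^bsub>A\<^esub> \<epsilon>) \<bullet>\<^bsub>A,A\<^esub> \<Delta> = idN A A T \<and>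
    (\<epsilon> \<lhd>\<^bsub>A\<^esub> T) \<bullet>\<^bsub>A,A\<^esub> \<Delta> = idN A A T)"

definition comonad_dist_law ::
    "('o, 'a) cat \<Rightarrow> ('o, 'a) cmnd \<Rightarrow> ('o, 'a) cmnd \<Rightarrow> ('o \<Rightarrow> 'a) \<Rightarrow> bool" where
  "comonad_dist_law A TT SS \<chi> \<longleftrightarrow> comonad A TT \<and> comonad A SS \<and>
    (let T = CF TT; \<epsilon>T = counit TT; \<Delta>T = comult TT;
         S = CF SS; \<epsilon>S = counit SS; \<Delta>S = comult SS in
      nat_trans A A (T \<odot>\<^bsub>A\<^esub> S) (S \<odot>\<^bsub>A\<^esub> T) \<chi> \<and>
      (S \<rhd>\<^bsub>A\<^esub> \<epsilon>T) \<bullet>\<^bsub>A,A\<^esub> \<chi> = \<epsilon>T \<lhd>\<^bsub>A\<^esub> S \<and>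
      (S \<rhd>\<^bsub>A\<^esub> \<Delta>T) \<bullet>\<^bsub>A,A\<^esub> \<chi> = (\<chi> \<lhd>\<^bsub>A\<^esub> T) \<bullet>\<^bsub>A,A\<^esub> (T \<rhd>\<^bsub>A\<^esub> \<chi>) \<bullet>\<^bsub>A,A\<^esub> (\<Delta>T \<lhd>\<^bsub>A\<^esub> S) \<and>
      (\<epsilon>S \<lhd>\<^bsub>A\<^esub> T) \<bullet>\<^bsub>A,A\<^esub> \<chi> = T \<rhd>\<^bsub>A\<^esub> \<epsilon>S \<and>
      (\<Delta>S \<lhd>\<^bsub>A\<^esub> T) \<bullet>\<^bsub>A,A\<^esub> \<chi> = (S \<rhd>\<^bsub>A\<^esub> \<chi>) \<bullet>\<^bsub>A,A\<^esub> (\<chi> \<lhd>\<^bsub>A\<^esub> S) \<bullet>\<^bsub>A,A\<^esub> (T \<rhd>\<^bsub>A\<^esub> \<Delta>S))"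

definition mixed_dist_law ::
    "('o, 'a) cat \<Rightarrow> ('o, 'a) mnd \<Rightarrow> ('o, 'a) cmnd \<Rightarrow> ('o \<Rightarrow> 'a) \<Rightarrow> bool" where
  "mixed_dist_law A BB CC \<theta> \<longleftrightarrow> monad A BB \<and> comonad A CC \<and>
    (let B = MF BB; \<eta> = unit BB; \<mu> = mult BB;
         C = CF CC; \<epsilon> = counit CC; \<Delta> = comult CC in
      nat_trans A A (B \<odot>\<^bsub>A\<^esub> C) (C \<odot>\<^bsub>A\<^esub> B) \<theta> \<and>
      \<theta> \<bullet>\<^bsub>A,A\<^esub> (\<eta> \<lhd>\<^bsub>A\<^esub> C) = C \<rhd>\<^bsub>A\<^esub> \<eta> \<and>
      \<theta> \<bullet>\<^bsub>A,A\<^esub> (\<mu> \<lhd>\<^bsub>A\<^esub> C) = (C \<rhd>\<^bsub>A\<^esub> \<mu>) \<bullet>\<^bsub>A,A\<^esub> (\<theta> \<lhd>\<^bsub>A\<^esub> B) \<bullet>\<^bsub>A,A\<^esub> (B \<rhd>\<^bsub>A\<^esub> \<theta>) \<and>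
      (\<epsilon> \<lhd>\<^bsub>A\<^esub> B) \<bullet>\<^bsub>A,A\<^esub> \<theta> = B \<rhd>\<^bsub>A\<^esub> \<epsilon> \<and>
      (\<Delta> \<lhd>\<^bsub>A\<^esub> B) \<bullet>\<^bsub>A,A\<^esub> \<theta> = (C \<rhd>\<^bsub>A\<^esub> \<theta>) \<bullet>\<^bsub>A,A\<^esub> (\<theta> \<lhd>\<^bsub>A\<^esub> C) \<bullet>\<^bsub>A,A\<^esub> (B \<rhd>\<^bsub>A\<^esub> \<Delta>))"

text \<open>In each of the next three definitions the first (co)monad lives on the source \<open>A\<close> and the second one
  on the target \<open>D\<close> of the functor \<open>\<Sigma>\<close>.\<close>

definition lax_comonad_mor :: "('o, 'a) cat \<Rightarrow> ('o, 'a) cmnd \<Rightarrow> ('p, 'b) cat \<Rightarrow> ('p, 'b) cmnd \<Rightarrow>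
    ('o, 'a, 'p, 'b) fctr \<Rightarrow> ('o \<Rightarrow> 'b) \<Rightarrow> bool" where
  "lax_comonad_mor A TT D GG \<Sigma> \<sigma> \<longleftrightarrow>
    (let T = CF TT; G = CF GG in
      nat_trans A D (G \<odot>\<^bsub>A\<^esub> \<Sigma>) (\<Sigma> \<odot>\<^bsub>A\<^esub> T) \<sigma> \<and>
      (\<Sigma> \<rhd>\<^bsub>A\<^esub> counit TT) \<bullet>\<^bsub>A,D\<^esub> \<sigma> = counit GG \<lhd>\<^bsub>A\<^esub> \<Sigma> \<and>
      (\<Sigma> \<rhd>\<^bsub>A\<^esub> comult TT) \<bullet>\<^bsub>A,D\<^esub> \<sigma>
        = (\<sigma> \<lhd>\<^bsub>A\<^esub> T) \<bullet>\<^bsub>A,D\<^esub> (G \<rhd>\<^bsub>A\<^esub> \<sigma>) \<bullet>\<^bsub>A,D\<^esub> (comult GG \<lhd>\<^bsub>A\<^esub> \<Sigma>))"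

definition colax_comonad_mor :: "('o, 'a) cat \<Rightarrow> ('o, 'a) cmnd \<Rightarrow> ('p, 'b) cat \<Rightarrow> ('p, 'b) cmnd \<Rightarrow>
    ('o, 'a, 'p, 'b) fctr \<Rightarrow> ('o \<Rightarrow> 'b) \<Rightarrow> bool" where
  "colax_comonad_mor A SS D CC \<Sigma> \<gamma> \<longleftrightarrow>
    (let S = CF SS; C = CF CC in
      nat_trans A D (\<Sigma> \<odot>\<^bsub>A\<^esub> S) (C \<odot>\<^bsub>A\<^esub> \<Sigma>) \<gamma> \<and>
      (counit CC \<lhd>\<^bsub>A\<^esub> \<Sigma>) \<bullet>\<^bsub>A,D\<^esub> \<gamma> = \<Sigma> \<rhd>\<^bsub>A\<^esub> counit SS \<and>
      (comult CC \<lhd>\<^bsub>A\<^esub> \<Sigma>) \<bullet>\<^bsub>A,D\<^esub> \<gamma>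
        = (C \<rhd>\<^bsub>A\<^esub> \<gamma>) \<bullet>\<^bsub>A,D\<^esub> (\<gamma> \<lhd>\<^bsub>A\<^esub> S) \<bullet>\<^bsub>A,D\<^esub> (\<Sigma> \<rhd>\<^bsub>A\<^esub> comult SS))"

definition lax_monad_mor :: "('o, 'a) cat \<Rightarrow> ('o, 'a) mnd \<Rightarrow> ('p, 'b) cat \<Rightarrow> ('p, 'b) mnd \<Rightarrow>
    ('o, 'a, 'p, 'b) fctr \<Rightarrow> ('o \<Rightarrow> 'b) \<Rightarrow> bool" where
  "lax_monad_mor A BB D AA \<Sigma> \<sigma> \<longleftrightarrow>
    (let B = MF BB; M = MF AA in
      nat_trans A D (M \<odot>\<^bsub>A\<^esub> \<Sigma>) (\<Sigma> \<odot>\<^bsub>A\<^esub> B) \<sigma> \<and>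
      \<sigma> \<bullet>\<^bsub>A,D\<^esub> (unit AA \<lhd>\<^bsub>A\<^esub> \<Sigma>) = \<Sigma> \<rhd>\<^bsub>A\<^esub> unit BB \<and>
      \<sigma> \<bullet>\<^bsub>A,D\<^esub> (mult AA \<lhd>\<^bsub>A\<^esub> \<Sigma>)
        = (\<Sigma> \<rhd>\<^bsub>A\<^esub> mult BB) \<bullet>\<^bsub>A,D\<^esub> (\<sigma> \<lhd>\<^bsub>A\<^esub> B) \<bullet>\<^bsub>A,D\<^esub> (M \<rhd>\<^bsub>A\<^esub> \<sigma>))"

text \<open>For endofunctors \<open>P\<close>, \<open>Q\<close> of \<open>A\<close> with \<open>\<chi> : PQ \<rightarrow> QP\<close> and \<open>P'\<close>, \<open>Q'\<close> of \<open>D\<close> with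
  \<open>\<tau> : P'Q' \<rightarrow> Q'P'\<close>, both sides are transformations \<open>P'\<Sigma>Q \<rightarrow> Q'\<Sigma>P\<close>.\<close>

definition yang_baxter :: "('o, 'a) cat \<Rightarrow>
    ('o, 'a, 'o, 'a) fctr \<Rightarrow> ('o, 'a, 'o, 'a) fctr \<Rightarrow> ('o \<Rightarrow> 'a) \<Rightarrow> ('p, 'b) cat \<Rightarrow>
    ('p, 'b, 'p, 'b) fctr \<Rightarrow> ('p, 'b, 'p, 'b) fctr \<Rightarrow> ('p \<Rightarrow> 'b) \<Rightarrow>
    ('o, 'a, 'p, 'b) fctr \<Rightarrow> ('o \<Rightarrow> 'b) \<Rightarrow> ('o \<Rightarrow> 'b) \<Rightarrow> bool" where
  "yang_baxter A P Q \<chi> D P' Q' \<tau> \<Sigma> \<sigma> \<gamma> \<longleftrightarrow>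
    (\<gamma> \<lhd>\<^bsub>A\<^esub> P) \<bullet>\<^bsub>A,D\<^esub> (\<Sigma> \<rhd>\<^bsub>A\<^esub> \<chi>) \<bullet>\<^bsub>A,D\<^esub> (\<sigma> \<lhd>\<^bsub>A\<^esub> Q)
      = (Q' \<rhd>\<^bsub>A\<^esub> \<sigma>) \<bullet>\<^bsub>A,D\<^esub> (\<tau> \<lhd>\<^bsub>A\<^esub> \<Sigma>) \<bullet>\<^bsub>A,D\<^esub> (P' \<rhd>\<^bsub>A\<^esub> \<gamma>)"


section \<open>The 2-categories Mix and Dist\<close>

text \<open>Both 2-categories have 1-cells \<open>(\<Sigma>, \<sigma>, \<gamma>)\<close> and 2-cells of the same shape, composed in the same
  way; the two kinds of 0-cells extend a common record. All 0-cells of one of these 2-categories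
  have their objects and arrows in the same pair of types, which are arbitrary and play the role
  of the universe.\<close>

record ('o, 'a) law0 =
  Cat :: "('o, 'a) cat"
  Law :: "'o \<Rightarrow> 'a"

record ('o, 'a) dist0 = "('o, 'a) law0" +
  ComT :: "('o, 'a) cmnd"
  ComS :: "('o, 'a) cmnd"

record ('o, 'a) mix0 = "('o, 'a) law0" +
  MonB :: "('o, 'a) mnd"
  ComC :: "('o, 'a) cmnd"

record ('z, 'o, 'a) cell1 =
  Src :: 'z
  Tgt :: 'z
  Fun :: "('o, 'a, 'o, 'a) fctr"
  Lax :: "'o \<Rightarrow> 'a"
  Colax :: "'o \<Rightarrow> 'a"

record ('z, 'o, 'a) cell2 =
  Src2 :: "('z, 'o, 'a) cell1"
  Tgt2 :: "('z, 'o, 'a) cell1"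
  Trans :: "'o \<Rightarrow> 'a"

type_synonym ('o, 'a) dist1 = "(('o, 'a) dist0, 'o, 'a) cell1"
type_synonym ('o, 'a) dist2 = "(('o, 'a) dist0, 'o, 'a) cell2"
type_synonym ('o, 'a) mix1 = "(('o, 'a) mix0, 'o, 'a) cell1"
type_synonym ('o, 'a) mix2 = "(('o, 'a) mix0, 'o, 'a) cell2"

definition cell_comp1 :: "(('o, 'a, 'm) law0_scheme, 'o, 'a) cell1 \<Rightarrow>
    (('o, 'a, 'm) law0_scheme, 'o, 'a) cell1 \<Rightarrow> (('o, 'a, 'm) law0_scheme, 'o, 'a) cell1" where
  "cell_comp1 g f = (let A = Cat (Src f); E = Cat (Tgt g) in
    \<lparr>Src = Src f, Tgt = Tgt g, Fun = Fun g \<odot>\<^bsub>A\<^esub> Fun f,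
     Lax = (Fun g \<rhd>\<^bsub>A\<^esub> Lax f) \<bullet>\<^bsub>A,E\<^esub> (Lax g \<lhd>\<^bsub>A\<^esub> Fun f),
     Colax = (Colax g \<lhd>\<^bsub>A\<^esub> Fun f) \<bullet>\<^bsub>A,E\<^esub> (Fun g \<rhd>\<^bsub>A\<^esub> Colax f)\<rparr>)"

definition cell_id2 :: "(('o, 'a, 'm) law0_scheme, 'o, 'a) cell1 \<Rightarrow>
    (('o, 'a, 'm) law0_scheme, 'o, 'a) cell2" where
  "cell_id2 f = \<lparr>Src2 = f, Tgt2 = f, Trans = idN (Cat (Src f)) (Cat (Tgt f)) (Fun f)\<rparr>"

definition cell_vcomp :: "(('o, 'a, 'm) law0_scheme, 'o, 'a) cell2 \<Rightarrow>
    (('o, 'a, 'm) law0_scheme, 'o, 'a) cell2 \<Rightarrow> (('o, 'a, 'm) law0_scheme, 'o, 'a) cell2" where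
  "cell_vcomp \<beta> \<alpha> = (let A = Cat (Src (Src2 \<alpha>)); D = Cat (Tgt (Src2 \<alpha>)) in
    \<lparr>Src2 = Src2 \<alpha>, Tgt2 = Tgt2 \<beta>, Trans = Trans \<beta> \<bullet>\<^bsub>A,D\<^esub> Trans \<alpha>\<rparr>)"

definition cell_hcomp :: "(('o, 'a, 'm) law0_scheme, 'o, 'a) cell2 \<Rightarrow>
    (('o, 'a, 'm) law0_scheme, 'o, 'a) cell2 \<Rightarrow> (('o, 'a, 'm) law0_scheme, 'o, 'a) cell2" where
  "cell_hcomp \<beta> \<alpha> = (let A = Cat (Src (Src2 \<alpha>)); E = Cat (Tgt (Src2 \<beta>)) in
    \<lparr>Src2 = cell_comp1 (Src2 \<beta>) (Src2 \<alpha>), Tgt2 = cell_comp1 (Tgt2 \<beta>) (Tgt2 \<alpha>),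
     Trans = (Trans \<beta> \<lhd>\<^bsub>A\<^esub> Fun (Tgt2 \<alpha>)) \<bullet>\<^bsub>A,E\<^esub> (Fun (Src2 \<beta>) \<rhd>\<^bsub>A\<^esub> Trans \<alpha>)\<rparr>)"

definition dist_cells0 :: "('o, 'a) dist0 set" where
  "dist_cells0 = {X. comonad_dist_law (Cat X) (ComT X) (ComS X) (Law X)}"

definition dist_cells1 :: "('o, 'a) dist1 set" where
  "dist_cells1 = {f. Src f \<in> dist_cells0 \<and> Tgt f \<in> dist_cells0 \<and>
    (let X = Src f; Y = Tgt f; B = Cat X; D = Cat Y in
      cat_functor B D (Fun f) \<and>
      lax_comonad_mor B (ComT X) D (ComT Y) (Fun f) (Lax f) \<and>
      colax_comonad_mor B (ComS X) D (ComS Y) (Fun f) (Colax f) \<and>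
      yang_baxter B (CF (ComT X)) (CF (ComS X)) (Law X) D (CF (ComT Y)) (CF (ComS Y)) (Law Y)
        (Fun f) (Lax f) (Colax f))}"

definition dist_cells2 :: "('o, 'a) dist2 set" where
  "dist_cells2 = {\<alpha>. Src2 \<alpha> \<in> dist_cells1 \<and> Tgt2 \<alpha> \<in> dist_cells1 \<and>
    Src (Src2 \<alpha>) = Src (Tgt2 \<alpha>) \<and> Tgt (Src2 \<alpha>) = Tgt (Tgt2 \<alpha>) \<and>
    (let X = Src (Src2 \<alpha>); Y = Tgt (Src2 \<alpha>); B = Cat X; D = Cat Y; f = Src2 \<alpha>; f' = Tgt2 \<alpha> in
      nat_trans B D (Fun f) (Fun f') (Trans \<alpha>) \<and>
      Lax f' \<bullet>\<^bsub>B,D\<^esub> (CF (ComT Y) \<rhd>\<^bsub>B\<^esub> Trans \<alpha>) = (Trans \<alpha> \<lhd>\<^bsub>B\<^esub> CF (ComT X)) \<bullet>\<^bsub>B,D\<^esub> Lax f \<and>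
      Colax f' \<bullet>\<^bsub>B,D\<^esub> (Trans \<alpha> \<lhd>\<^bsub>B\<^esub> CF (ComS X)) = (CF (ComS Y) \<rhd>\<^bsub>B\<^esub> Trans \<alpha>) \<bullet>\<^bsub>B,D\<^esub> Colax f)}"

definition dist_id1 :: "('o, 'a) dist0 \<Rightarrow> ('o, 'a) dist1" where
  "dist_id1 X = \<lparr>Src = X, Tgt = X, Fun = idF (Cat X),
    Lax = idN (Cat X) (Cat X) (CF (ComT X)), Colax = idN (Cat X) (Cat X) (CF (ComS X))\<rparr>"

definition Dist :: "(('o, 'a) dist0, ('o, 'a) dist1, ('o, 'a) dist2) twocat" where
  "Dist = \<lparr>Cell0 = dist_cells0, Cell1 = dist_cells1, Cell2 = dist_cells2,
    src1 = Src, tgt1 = Tgt, src2 = Src2, tgt2 = Tgt2, id1 = dist_id1, id2 = cell_id2,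
    comp1 = cell_comp1, vcomp = cell_vcomp, hcomp = cell_hcomp\<rparr>"

definition mix_cells0 :: "('o, 'a) mix0 set" where
  "mix_cells0 = {X. mixed_dist_law (Cat X) (MonB X) (ComC X) (Law X)}"

definition mix_cells1 :: "('o, 'a) mix1 set" where
  "mix_cells1 = {f. Src f \<in> mix_cells0 \<and> Tgt f \<in> mix_cells0 \<and>
    (let X = Src f; Y = Tgt f; A = Cat X; D = Cat Y in
      cat_functor A D (Fun f) \<and>
      lax_monad_mor A (MonB X) D (MonB Y) (Fun f) (Lax f) \<and>
      colax_comonad_mor A (ComC X) D (ComC Y) (Fun f) (Colax f) \<and>
      yang_baxter A (MF (MonB X)) (CF (ComC X)) (Law X) D (MF (MonB Y)) (CF (ComC Y)) (Law Y)
        (Fun f) (Lax f) (Colax f))}"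

definition mix_cells2 :: "('o, 'a) mix2 set" where
  "mix_cells2 = {\<alpha>. Src2 \<alpha> \<in> mix_cells1 \<and> Tgt2 \<alpha> \<in> mix_cells1 \<and>
    Src (Src2 \<alpha>) = Src (Tgt2 \<alpha>) \<and> Tgt (Src2 \<alpha>) = Tgt (Tgt2 \<alpha>) \<and>
    (let X = Src (Src2 \<alpha>); Y = Tgt (Src2 \<alpha>); A = Cat X; D = Cat Y; f = Src2 \<alpha>; f' = Tgt2 \<alpha> in
      nat_trans A D (Fun f) (Fun f') (Trans \<alpha>) \<and>
      Lax f' \<bullet>\<^bsub>A,D\<^esub> (MF (MonB Y) \<rhd>\<^bsub>A\<^esub> Trans \<alpha>) = (Trans \<alpha> \<lhd>\<^bsub>A\<^esub> MF (MonB X)) \<bullet>\<^bsub>A,D\<^esub> Lax f \<and>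
      Colax f' \<bullet>\<^bsub>A,D\<^esub> (Trans \<alpha> \<lhd>\<^bsub>A\<^esub> CF (ComC X)) = (CF (ComC Y) \<rhd>\<^bsub>A\<^esub> Trans \<alpha>) \<bullet>\<^bsub>A,D\<^esub> Colax f)}"

definition mix_id1 :: "('o, 'a) mix0 \<Rightarrow> ('o, 'a) mix1" where
  "mix_id1 X = \<lparr>Src = X, Tgt = X, Fun = idF (Cat X),
    Lax = idN (Cat X) (Cat X) (MF (MonB X)), Colax = idN (Cat X) (Cat X) (CF (ComC X))\<rparr>"

definition Mix :: "(('o, 'a) mix0, ('o, 'a) mix1, ('o, 'a) mix2) twocat" where
  "Mix = \<lparr>Cell0 = mix_cells0, Cell1 = mix_cells1, Cell2 = mix_cells2,
    src1 = Src, tgt1 = Tgt, src2 = Src2, tgt2 = Tgt2, id1 = mix_id1, id2 = cell_id2,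
    comp1 = cell_comp1, vcomp = cell_vcomp, hcomp = cell_hcomp\<rparr>"


section \<open>Eilenberg-Moore categories and lifts\<close>

text \<open>An algebra is a pair \<open>(X, \<alpha>)\<close>. An arrow is a triple consisting of its source algebra, its
  underlying arrow and its target algebra.\<close>

type_synonym ('o, 'a) em_obj = "'o \<times> 'a"
type_synonym ('o, 'a) em_arr = "('o, 'a) em_obj \<times> 'a \<times> ('o, 'a) em_obj"

definition algebras :: "('o, 'a) cat \<Rightarrow> ('o, 'a) mnd \<Rightarrow> ('o, 'a) em_obj set" where
  "algebras A M = {(X, \<alpha>). X \<in> Obj A \<and> \<alpha> \<in> hom A (FObj (MF M) X) X \<and>
    Comp A \<alpha> (unit M X) = Id A X \<and>
    Comp A \<alpha> (mult M X) = Comp A \<alpha> (FArr (MF M) \<alpha>)}"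

definition EM :: "('o, 'a) cat \<Rightarrow> ('o, 'a) mnd \<Rightarrow> (('o, 'a) em_obj, ('o, 'a) em_arr) cat" where
  "EM A M = \<lparr>Obj = algebras A M,
    Arr = {((X, \<alpha>), f, (Y, \<beta>)) | X \<alpha> f Y \<beta>. (X, \<alpha>) \<in> algebras A M \<and> (Y, \<beta>) \<in> algebras A M \<and>
      f \<in> hom A X Y \<and> Comp A f \<alpha> = Comp A \<beta> (FArr (MF M) f)},
    Dom = (\<lambda>(P, f, Q). P), Cod = (\<lambda>(P, f, Q). Q),
    Id = (\<lambda>P. (P, Id A (fst P), P)),
    Comp = (\<lambda>(Q', g, R) (P, f, Q). (P, Comp A g f, R))\<rparr>"

definition em_forget :: "('o, 'a) cat \<Rightarrow> ('o, 'a) mnd \<Rightarrow>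
    (('o, 'a) em_obj, ('o, 'a) em_arr, 'o, 'a) fctr" where
  "em_forget A M = \<lparr>FObj = (\<lambda>P\<in>algebras A M. fst P), FArr = (\<lambda>(P, f, Q)\<in>Arr (EM A M). f)\<rparr>"

definition em_free :: "('o, 'a) cat \<Rightarrow> ('o, 'a) mnd \<Rightarrow>
    ('o, 'a, ('o, 'a) em_obj, ('o, 'a) em_arr) fctr" where
  "em_free A M = (let B = MF M; F = (\<lambda>X. (FObj B X, mult M X)) in
    \<lparr>FObj = (\<lambda>X\<in>Obj A. F X), FArr = (\<lambda>f\<in>Arr A. (F (Dom A f), FArr B f, F (Cod A f)))\<rparr>)"

text \<open>The comonad \<open>FU\<close> of the adjunction between the free functor \<open>F\<close> and the forgetful
  functor \<open>U\<close>: its counit is the counit of the adjunction, with component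
  \<open>\<alpha> : (BX, \<mu>\<^sub>X) \<rightarrow> (X, \<alpha>)\<close> at \<open>(X, \<alpha>)\<close>; its comultiplication is \<open>F\<eta>U\<close>, the unit \<open>\<eta>\<close> of
  the adjunction being that of the monad.\<close>

definition em_comonad :: "('o, 'a) cat \<Rightarrow> ('o, 'a) mnd \<Rightarrow>
    (('o, 'a) em_obj, ('o, 'a) em_arr) cmnd" where
  "em_comonad A M = (let E = EM A M; F = em_free A M; U = em_forget A M in
    \<lparr>CF = F \<odot>\<^bsub>E\<^esub> U,
     counit = (\<lambda>(X, \<alpha>)\<in>Obj E. ((FObj (MF M) X, mult M X), \<alpha>, (X, \<alpha>))),
     comult = F \<rhd>\<^bsub>E\<^esub> (unit M \<lhd>\<^bsub>E\<^esub> U)\<rparr>)"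

text \<open>\<open>lift_fun A M D \<Sigma> \<sigma>\<close> is the functor out of \<open>EM A M\<close> that sends an algebra \<open>(X, \<alpha>)\<close> to
  \<open>(\<Sigma>X, \<Sigma>\<alpha> \<circ> \<sigma>\<^sub>X)\<close>, the composite being taken in \<open>D\<close>, and acts as \<open>\<Sigma>\<close> on underlying arrows.\<close>

definition lift_fun :: "('o, 'a) cat \<Rightarrow> ('o, 'a) mnd \<Rightarrow> ('p, 'b) cat \<Rightarrow>
    ('o, 'a, 'p, 'b) fctr \<Rightarrow> ('o \<Rightarrow> 'b) \<Rightarrow>
    (('o, 'a) em_obj, ('o, 'a) em_arr, ('p, 'b) em_obj, ('p, 'b) em_arr) fctr" where
  "lift_fun A M D \<Sigma> \<sigma> = (let L = (\<lambda>(X, \<alpha>). (FObj \<Sigma> X, Comp D (FArr \<Sigma> \<alpha>) (\<sigma> X))) in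
    \<lparr>FObj = (\<lambda>P\<in>Obj (EM A M). L P), FArr = (\<lambda>(P, f, Q)\<in>Arr (EM A M). (L P, FArr \<Sigma> f, L Q))\<rparr>)"

text \<open>\<open>lift_nat A M F G \<tau>\<close> is the transformation \<open>F \<rightarrow> G\<close> of functors out of \<open>EM A M\<close> whose
  component at \<open>(X, \<alpha>)\<close> has underlying arrow \<open>\<tau>\<^sub>X\<close>.\<close>

definition lift_nat :: "('o, 'a) cat \<Rightarrow> ('o, 'a) mnd \<Rightarrow>
    (('o, 'a) em_obj, ('o, 'a) em_arr, ('p, 'b) em_obj, ('p, 'b) em_arr) fctr \<Rightarrow>
    (('o, 'a) em_obj, ('o, 'a) em_arr, ('p, 'b) em_obj, ('p, 'b) em_arr) fctr \<Rightarrow>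
    ('o \<Rightarrow> 'b) \<Rightarrow> ('o, 'a) em_obj \<Rightarrow> ('p, 'b) em_arr" where
  "lift_nat A M F G \<tau> = (\<lambda>P\<in>Obj (EM A M). (FObj F P, \<tau> (fst P), FObj G P))"

definition lift_comonad :: "('o, 'a) cat \<Rightarrow> ('o, 'a) mnd \<Rightarrow> ('o, 'a) cmnd \<Rightarrow> ('o \<Rightarrow> 'a) \<Rightarrow>
    (('o, 'a) em_obj, ('o, 'a) em_arr) cmnd" where
  "lift_comonad A M W \<theta> = (let E = EM A M; C = lift_fun A M A (CF W) \<theta> in
    \<lparr>CF = C, counit = lift_nat A M C (idF E) (counit W),
     comult = lift_nat A M C (C \<odot>\<^bsub>E\<^esub> C) (comult W)\<rparr>)"


section \<open>The assignment on cells\<close>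

definition i_cell0 :: "('o, 'a) mix0 \<Rightarrow> (('o, 'a) em_obj, ('o, 'a) em_arr) dist0" where
  "i_cell0 X = (let A = Cat X; M = MonB X; E = EM A M;
      T = em_comonad A M; S = lift_comonad A M (ComC X) (Law X) in
    \<lparr>Cat = E, Law = lift_nat A M (CF T \<odot>\<^bsub>E\<^esub> CF S) (CF S \<odot>\<^bsub>E\<^esub> CF T) (Law X),
     ComT = T, ComS = S\<rparr>)"

definition i_cell1 :: "('o, 'a) mix1 \<Rightarrow> (('o, 'a) em_obj, ('o, 'a) em_arr) dist1" where
  "i_cell1 f = (let A = Cat (Src f); M = MonB (Src f); D = Cat (Tgt f); E = EM A M;
      X = i_cell0 (Src f); Y = i_cell0 (Tgt f); \<Sigma> = lift_fun A M D (Fun f) (Lax f) in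
    \<lparr>Src = X, Tgt = Y, Fun = \<Sigma>,
     Lax = lift_nat A M (CF (ComT Y) \<odot>\<^bsub>E\<^esub> \<Sigma>) (\<Sigma> \<odot>\<^bsub>E\<^esub> CF (ComT X)) (Lax f),
     Colax = lift_nat A M (\<Sigma> \<odot>\<^bsub>E\<^esub> CF (ComS X)) (CF (ComS Y) \<odot>\<^bsub>E\<^esub> \<Sigma>) (Colax f)\<rparr>)"

definition i_cell2 :: "('o, 'a) mix2 \<Rightarrow> (('o, 'a) em_obj, ('o, 'a) em_arr) dist2" where
  "i_cell2 \<alpha> = (let f = i_cell1 (Src2 \<alpha>); f' = i_cell1 (Tgt2 \<alpha>) in
    \<lparr>Src2 = f, Tgt2 = f',
     Trans = lift_nat (Cat (Src (Src2 \<alpha>))) (MonB (Src (Src2 \<alpha>))) (Fun f) (Fun f') (Trans \<alpha>)\<rparr>)"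

end

(* A functor between Eilenberg-Moore categories that commutes with the forgetful functors is
   determined on arrows by a functor between the base categories, and a transformation between two
   such functors is determined by its underlying arrows.  Lifting of transformations respects
   vertical composition, identities and whiskering, so almost every equation required in Dist is the
   lift of an equation that holds in Mix.  That a component is a morphism of algebras is where the
   compatibility with the multiplication, the counit, the comultiplication and the Yang-Baxter equation
   enter.  Only the counit of FU is not a lift, since its component at (X, alpha) is alpha itself;
   equations involving it are checked by hand.

   Mix and Dist are both instances of one 2-category of triples (Sigma, sigma, gamma), restricted to
   those triples that satisfy a predicate stable under identities and composition. *)

theory Submission
  imports Defs
begin

section \<open>Categories in terms of domains and codomains\<close>

text \<open>The obstacle is strictness. Functors are pairs of extensional functions and an arrow of
  an Eilenberg-Moore category carries its source and target algebra, so two lifts of one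
  transformation are equal only if their boundary functors are equal. This is why associativity of
  functor composition occurs throughout, and why the lift of a composite 1-cell has to be literally
  the composite of the lifts. It is: the structure map \<open>\<Sigma>'(\<Sigma>\<alpha> \<circ>
  \<sigma>) \<circ> \<sigma>'\<close> of the iterated lift is the one prescribed by the composite
  lax part. The unit conditions enter in two places. They give the unit law of a lifted algebra,
  and, since the comultiplication of \<open>FU\<close> is a lift of \<open>B\<eta>\<close>, they
  give the conditions on that comultiplication. The conditions on the counit of \<open>FU\<close>
  hold by construction: they say that \<open>\<Sigma>\<alpha> \<circ> \<sigma>\<close> is the
  structure map of the lifted algebra. Composability is expressed by equations between domains and
  codomains, so that simp can decide it.\<close>

lemma hom_iff [simp]: "f \<in> hom C X Y \<longleftrightarrow> f \<in> Arr C \<and> Dom C f = X \<and> Cod C f = Y"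
  by (simp add: hom_def)

context category
begin

declare Dom_in [simp] Cod_in [simp]

lemma Id_simps [simp]:
  assumes "X \<in> Obj C"
  shows "Id C X \<in> Arr C" "Dom C (Id C X) = X" "Cod C (Id C X) = X"
  using Id_in[OF assms] by simp_all

lemma Comp_simps [simp]:
  assumes "f \<in> Arr C" "g \<in> Arr C" "Cod C f = Dom C g"
  shows "Comp C g f \<in> Arr C" "Dom C (Comp C g f) = Dom C f" "Cod C (Comp C g f) = Cod C g"
  using Comp_in[of f "Dom C f" "Cod C f" g "Cod C g"] assms by simp_all

lemma Comp_Id_right [simp]: "f \<in> Arr C \<Longrightarrow> Dom C f = X \<Longrightarrow> Comp C f (Id C X) = f"
  using Comp_Id by auto

lemma Comp_Id_left [simp]: "f \<in> Arr C \<Longrightarrow> Cod C f = X \<Longrightarrow> Comp C (Id C X) f = f"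
  using Id_Comp by auto

lemma Comp_assoc_right [simp]:
  "\<lbrakk>f \<in> Arr C; g \<in> Arr C; h \<in> Arr C; Cod C f = Dom C g; Cod C g = Dom C h\<rbrakk>
    \<Longrightarrow> Comp C (Comp C h g) f = Comp C h (Comp C g f)"
  using Comp_assoc by simp

text \<open>Composites are kept nested to the right; this turns an equation of composites into one that also
  applies in front of a further factor.\<close>

lemma Comp_eq_reassoc:
  assumes "Comp C g f = Comp C k h"
    and "f \<in> Arr C" "g \<in> Arr C" "h \<in> Arr C" "k \<in> Arr C" "x \<in> Arr C"
    and "Cod C f = Dom C g" "Cod C h = Dom C k" "Cod C x = Dom C f"
  shows "Comp C g (Comp C f x) = Comp C k (Comp C h x)"
proof -
  \<comment> \<open>That \<open>h\<close> can be composed with \<open>x\<close> follows by comparing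
    the domains of the two equal composites.\<close>
  have "Dom C f = Dom C h"
    using Comp_simps(2)[of f g] Comp_simps(2)[of h k] assms by simp
  then have "Comp C (Comp C k h) x = Comp C k (Comp C h x)"
    using assms by simp
  moreover have "Comp C (Comp C g f) x = Comp C g (Comp C f x)"
    using assms(2-) by simp
  ultimately show ?thesis
    using assms(1) by metis
qed

end

lemma categoryI:
  assumes "\<And>f. f \<in> Arr C \<Longrightarrow> Dom C f \<in> Obj C \<and> Cod C f \<in> Obj C"
    and "\<And>X. X \<in> Obj C \<Longrightarrow> Id C X \<in> Arr C \<and> Dom C (Id C X) = X \<and> Cod C (Id C X) = X"
    and "\<And>f g. \<lbrakk>f \<in> Arr C; g \<in> Arr C; Cod C f = Dom C g\<rbrakk> \<Longrightarrow>
      Comp C g f \<in> Arr C \<and> Dom C (Comp C g f) = Dom C f \<and> Cod C (Comp C g f) = Cod C g"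
    and "\<And>f. f \<in> Arr C \<Longrightarrow> Comp C f (Id C (Dom C f)) = f"
    and "\<And>f. f \<in> Arr C \<Longrightarrow> Comp C (Id C (Cod C f)) f = f"
    and "\<And>f g h. \<lbrakk>f \<in> Arr C; g \<in> Arr C; h \<in> Arr C; Cod C f = Dom C g; Cod C g = Dom C h\<rbrakk>
      \<Longrightarrow> Comp C h (Comp C g f) = Comp C (Comp C h g) f"
  shows "category C"
  by unfold_locales (use assms in auto)

context cat_functor
begin

lemma FObj_Obj [simp]: "X \<in> Obj C \<Longrightarrow> FObj F X \<in> Obj D"
  using FObj_in by auto

lemma FArr_simps [simp]:
  assumes "f \<in> Arr C"
  shows "FArr F f \<in> Arr D" "Dom D (FArr F f) = FObj F (Dom C f)" "Cod D (FArr F f) = FObj F (Cod C f)"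
  using FArr_in[of f "Dom C f" "Cod C f"] assms by simp_all

declare FArr_Id [simp]

lemma FArr_Comp_Arr [simp]:
  "\<lbrakk>f \<in> Arr C; g \<in> Arr C; Cod C f = Dom C g\<rbrakk> \<Longrightarrow> FArr F (Comp C g f) = Comp D (FArr F g) (FArr F f)"
  using FArr_Comp by simp

lemma FObj_ext: "FObj F \<in> extensional (Obj C)"
  using FObj_in by (simp add: PiE_def)

text \<open>As a simp rule \<open>FArr_Comp_Arr\<close> splits the image of every composite, so an
  equation of \<open>C\<close> can be used under \<open>F\<close> only after both of its sides have
  been split in the same way.\<close>

lemma FArr_eq_reassoc:
  assumes "Comp C g f = Comp C k h"
    and "f \<in> Arr C" "g \<in> Arr C" "h \<in> Arr C" "k \<in> Arr C"
    and "Cod C f = Dom C g" "Cod C h = Dom C k"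
  shows "Comp D (FArr F g) (FArr F f) = Comp D (FArr F k) (FArr F h)"
  using assms FArr_Comp_Arr[of f g] FArr_Comp_Arr[of h k] by metis

end

lemma cat_functorI:
  assumes "category C" "category D"
    and "FObj F \<in> extensional (Obj C)" "FArr F \<in> extensional (Arr C)"
    and "\<And>X. X \<in> Obj C \<Longrightarrow> FObj F X \<in> Obj D"
    and "\<And>f. f \<in> Arr C \<Longrightarrow> FArr F f \<in> Arr D \<and> Dom D (FArr F f) = FObj F (Dom C f) \<and>
      Cod D (FArr F f) = FObj F (Cod C f)"
    and "\<And>X. X \<in> Obj C \<Longrightarrow> FArr F (Id C X) = Id D (FObj F X)"
    and "\<And>f g. \<lbrakk>f \<in> Arr C; g \<in> Arr C; Cod C f = Dom C g\<rbrakk>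
      \<Longrightarrow> FArr F (Comp C g f) = Comp D (FArr F g) (FArr F f)"
  shows "cat_functor C D F"
proof -
  interpret S: category C by fact
  interpret T: category D by fact
  show ?thesis
    by unfold_locales (use assms in \<open>auto simp: PiE_def\<close>)
qed

context nat_trans
begin

lemma comp_simps [simp]:
  assumes "X \<in> Obj C"
  shows "\<tau> X \<in> Arr D" "Dom D (\<tau> X) = FObj F X" "Cod D (\<tau> X) = FObj G X"
  using comp_in[OF assms] by simp_all

lemma natural: "f \<in> Arr C \<Longrightarrow> Cod C f = Y \<Longrightarrow>
    Comp D (\<tau> Y) (FArr F f) = Comp D (FArr G f) (\<tau> (Dom C f))"
  using naturality by auto

end

lemma nat_transI:
  assumes "cat_functor C D F" "cat_functor C D G" "\<tau> \<in> extensional (Obj C)"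
    and "\<And>X. X \<in> Obj C \<Longrightarrow> \<tau> X \<in> Arr D \<and> Dom D (\<tau> X) = FObj F X \<and> Cod D (\<tau> X) = FObj G X"
    and "\<And>f. f \<in> Arr C \<Longrightarrow>
      Comp D (\<tau> (Cod C f)) (FArr F f) = Comp D (FArr G f) (\<tau> (Dom C f))"
  shows "nat_trans C D F G \<tau>"
proof -
  interpret F: cat_functor C D F by fact
  interpret G: cat_functor C D G by fact
  show ?thesis
    by unfold_locales (use assms in auto)
qed

section \<open>Functors and transformations computed by components\<close>

lemma idF_simps [simp]:
  "X \<in> Obj C \<Longrightarrow> FObj (idF C) X = X" "f \<in> Arr C \<Longrightarrow> FArr (idF C) f = f"
  by (simp_all add: idF_def)

lemma compF_simps [simp]:
  "X \<in> Obj C \<Longrightarrow> FObj (G \<odot>\<^bsub>C\<^esub> F) X = FObj G (FObj F X)"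
  "f \<in> Arr C \<Longrightarrow> FArr (G \<odot>\<^bsub>C\<^esub> F) f = FArr G (FArr F f)"
  by (simp_all add: compF_def)

lemma transformation_simps [simp]:
  assumes "X \<in> Obj C"
  shows "idN C D F X = Id D (FObj F X)"
    "(\<tau> \<bullet>\<^bsub>C,D\<^esub> \<sigma>) X = Comp D (\<tau> X) (\<sigma> X)"
    "(H \<rhd>\<^bsub>C\<^esub> \<tau>) X = FArr H (\<tau> X)"
    "(\<tau>' \<lhd>\<^bsub>C\<^esub> K) X = \<tau>' (FObj K X)"
  using assms by (simp_all add: idN_def compN_def whiskL_def whiskR_def)

lemma transformation_ext [simp]:
  "idN C D F \<in> extensional (Obj C)"
  "\<tau> \<bullet>\<^bsub>C,D\<^esub> \<sigma> \<in> extensional (Obj C)"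
  "H \<rhd>\<^bsub>C\<^esub> \<tau> \<in> extensional (Obj C)"
  "\<tau>' \<lhd>\<^bsub>C\<^esub> K \<in> extensional (Obj C)"
  by (simp_all add: idN_def compN_def whiskL_def whiskR_def)

lemma fctr_ext [simp]:
  "FObj (idF C) \<in> extensional (Obj C)" "FArr (idF C) \<in> extensional (Arr C)"
  "FObj (G \<odot>\<^bsub>C\<^esub> F) \<in> extensional (Obj C)" "FArr (G \<odot>\<^bsub>C\<^esub> F) \<in> extensional (Arr C)"
  by (simp_all add: idF_def compF_def)

text \<open>An equivalence, because it serves both to prove equations between transformations and to
  unpack those contained in the definitions of monads, comonads, laws and cells.\<close>

lemma transformation_eq_iff:
  assumes "\<sigma> \<in> extensional (Obj C)" "\<tau> \<in> extensional (Obj C)"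
  shows "\<sigma> = \<tau> \<longleftrightarrow> (\<forall>X\<in>Obj C. \<sigma> X = \<tau> X)"
  using assms by (auto intro: extensionalityI)

lemma fctr_eqI:
  assumes "FObj F \<in> extensional (Obj C)" "FObj G \<in> extensional (Obj C)"
    and "FArr F \<in> extensional (Arr C)" "FArr G \<in> extensional (Arr C)"
    and "\<And>X. X \<in> Obj C \<Longrightarrow> FObj F X = FObj G X"
    and "\<And>f. f \<in> Arr C \<Longrightarrow> FArr F f = FArr G f"
  shows "F = (G :: ('o, 'a, 'p, 'b) fctr)"
  using assms by (intro fctr.equality extensionalityI[of _ "Obj C"] extensionalityI[of _ "Arr C"]) auto

lemma cat_functor_idF: "category C \<Longrightarrow> cat_functor C C (idF C)"
  by (rule cat_functorI) (auto simp: category.Comp_simps category.Id_simps category.Dom_in category.Cod_in)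

lemma cat_functor_compF:
  assumes "cat_functor A B F" "cat_functor B C G"
  shows "cat_functor A C (G \<odot>\<^bsub>A\<^esub> F)"
proof -
  interpret F: cat_functor A B F by fact
  interpret G: cat_functor B C G by fact
  show ?thesis
    by (rule cat_functorI) (simp_all add: F.S.category_axioms G.T.category_axioms)
qed

context cat_functor
begin

lemma compF_idF [simp]: "F \<odot>\<^bsub>C\<^esub> idF C = F"
  by (rule fctr_eqI[of _ C]) (simp_all add: FObj_ext FArr_ext)

lemma idF_compF [simp]: "idF D \<odot>\<^bsub>C\<^esub> F = F"
  by (rule fctr_eqI[of _ C]) (simp_all add: FObj_ext FArr_ext)

lemma compF_assoc: "(H \<odot>\<^bsub>D\<^esub> G) \<odot>\<^bsub>C\<^esub> F = H \<odot>\<^bsub>C\<^esub> (G \<odot>\<^bsub>C\<^esub> F)"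
  by (rule fctr_eqI[of _ C]) simp_all

end

lemma nat_trans_idN:
  assumes "cat_functor C D F"
  shows "nat_trans C D F F (idN C D F)"
proof -
  interpret cat_functor C D F by fact
  show ?thesis by (rule nat_transI) (simp_all add: cat_functor_axioms)
qed

lemma nat_trans_compN:
  assumes "nat_trans C D F G \<sigma>" "nat_trans C D G H \<tau>"
  shows "nat_trans C D F H (\<tau> \<bullet>\<^bsub>C,D\<^esub> \<sigma>)"
proof -
  interpret s: nat_trans C D F G \<sigma> by fact
  interpret t: nat_trans C D G H \<tau> by fact
  show ?thesis
  proof (rule nat_transI)
    fix f assume f [simp]: "f \<in> Arr C"
    let ?X = "Dom C f" and ?Y = "Cod C f"
    have "Comp D (\<tau> ?Y) (Comp D (\<sigma> ?Y) (FArr F f)) = Comp D (\<tau> ?Y) (Comp D (FArr G f) (\<sigma> ?X))"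
      by (simp add: s.natural)
    also have "\<dots> = Comp D (FArr H f) (Comp D (\<tau> ?X) (\<sigma> ?X))"
      by (intro s.F.T.Comp_eq_reassoc t.natural) simp_all
    finally show "Comp D ((\<tau> \<bullet>\<^bsub>C,D\<^esub> \<sigma>) ?Y) (FArr F f) = Comp D (FArr H f) ((\<tau> \<bullet>\<^bsub>C,D\<^esub> \<sigma>) ?X)"
      by simp
  qed (simp_all add: s.F.cat_functor_axioms t.G.cat_functor_axioms)
qed

lemma nat_trans_whiskL:
  assumes "nat_trans C D F G \<tau>" "cat_functor D E H"
  shows "nat_trans C E (H \<odot>\<^bsub>C\<^esub> F) (H \<odot>\<^bsub>C\<^esub> G) (H \<rhd>\<^bsub>C\<^esub> \<tau>)"
proof -
  interpret nat_trans C D F G \<tau> by fact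
  interpret H: cat_functor D E H by fact
  show ?thesis
    by (rule nat_transI)
      (auto intro!: cat_functor_compF[of C D] H.FArr_eq_reassoc natural
        simp: F.cat_functor_axioms G.cat_functor_axioms H.cat_functor_axioms)
qed

lemma nat_trans_whiskR:
  assumes "nat_trans C D F G \<tau>" "cat_functor B C K"
  shows "nat_trans B D (F \<odot>\<^bsub>B\<^esub> K) (G \<odot>\<^bsub>B\<^esub> K) (\<tau> \<lhd>\<^bsub>B\<^esub> K)"
proof -
  interpret nat_trans C D F G \<tau> by fact
  interpret K: cat_functor B C K by fact
  show ?thesis
    by (rule nat_transI)
      (auto intro!: cat_functor_compF[of B C]
        simp: F.cat_functor_axioms G.cat_functor_axioms K.cat_functor_axioms natural)
qed

section \<open>The 2-category common to Mix and Dist\<close>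

text \<open>What 1-cells of Mix and Dist share: \<open>P\<close> stands for the functor of the monad
  \<open>B\<close> or of the comonad \<open>T\<close>, and \<open>Q\<close> for that of
  \<open>C\<close> or \<open>S\<close>. Identities and composites are natural transformations of the
  right type already at this level; the remaining conditions are added later as a predicate.\<close>

locale law_mor =
  S: cat_functor A D \<Sigma> + P: cat_functor A A P + Q: cat_functor A A Q +
  P': cat_functor D D P' + Q': cat_functor D D Q' +
  lax: nat_trans A D "P' \<odot>\<^bsub>A\<^esub> \<Sigma>" "\<Sigma> \<odot>\<^bsub>A\<^esub> P" \<sigma> +
  colax: nat_trans A D "\<Sigma> \<odot>\<^bsub>A\<^esub> Q" "Q' \<odot>\<^bsub>A\<^esub> \<Sigma>" \<gamma>
  for A :: "('o, 'a) cat" and P Q and D :: "('p, 'b) cat" and P' Q' \<Sigma> \<sigma> \<gamma>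
begin

lemma lax_natural: "f \<in> Arr A \<Longrightarrow> Cod A f = Y \<Longrightarrow>
    Comp D (\<sigma> Y) (FArr P' (FArr \<Sigma> f)) = Comp D (FArr \<Sigma> (FArr P f)) (\<sigma> (Dom A f))"
  using lax.natural[of f Y] by simp

lemma colax_natural: "f \<in> Arr A \<Longrightarrow> Cod A f = Y \<Longrightarrow>
    Comp D (\<gamma> Y) (FArr \<Sigma> (FArr Q f)) = Comp D (FArr Q' (FArr \<Sigma> f)) (\<gamma> (Dom A f))"
  using colax.natural[of f Y] by simp

end

lemma law_mor_id:
  assumes "cat_functor A A P" "cat_functor A A Q"
  shows "law_mor A P Q A P Q (idF A) (idN A A P) (idN A A Q)"
proof -
  interpret P: cat_functor A A P by fact
  interpret Q: cat_functor A A Q by fact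
  show ?thesis
    by (simp add: law_mor_def cat_functor_idF assms P.S.category_axioms nat_trans_idN)
qed

lemma law_mor_comp:
  assumes "law_mor A P Q D P' Q' \<Sigma> \<sigma> \<gamma>" "law_mor D P' Q' E P'' Q'' \<Sigma>' \<sigma>' \<gamma>'"
  shows "law_mor A P Q E P'' Q'' (\<Sigma>' \<odot>\<^bsub>A\<^esub> \<Sigma>)
    ((\<Sigma>' \<rhd>\<^bsub>A\<^esub> \<sigma>) \<bullet>\<^bsub>A,E\<^esub> (\<sigma>' \<lhd>\<^bsub>A\<^esub> \<Sigma>)) ((\<gamma>' \<lhd>\<^bsub>A\<^esub> \<Sigma>) \<bullet>\<^bsub>A,E\<^esub> (\<Sigma>' \<rhd>\<^bsub>A\<^esub> \<gamma>))"
proof -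
  interpret f: law_mor A P Q D P' Q' \<Sigma> \<sigma> \<gamma> by fact
  interpret g: law_mor D P' Q' E P'' Q'' \<Sigma>' \<sigma>' \<gamma>' by fact
  note whisk = nat_trans_whiskR[OF g.lax.nat_trans_axioms f.S.cat_functor_axioms]
    nat_trans_whiskL[OF f.lax.nat_trans_axioms g.S.cat_functor_axioms]
    nat_trans_whiskR[OF g.colax.nat_trans_axioms f.S.cat_functor_axioms]
    nat_trans_whiskL[OF f.colax.nat_trans_axioms g.S.cat_functor_axioms]
  \<comment> \<open>The target of one whiskered transformation and the source of the next agree only
    after reassociation, for instance at \<open>\<Sigma>'P'\<Sigma>\<close>.\<close>
  note whisk' = whisk[unfolded f.S.compF_assoc]
  show ?thesis
    unfolding law_mor_def f.S.compF_assoc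
    using nat_trans_compN[OF whisk'(1,2)] nat_trans_compN[OF whisk'(4,3)]
    by (simp add: cat_functor_compF[of A D] f.S.cat_functor_axioms g.S.cat_functor_axioms
      f.P.cat_functor_axioms f.Q.cat_functor_axioms g.P'.cat_functor_axioms
      g.Q'.cat_functor_axioms f.P.compF_assoc f.Q.compF_assoc)
qed

locale law_cell =
  f: law_mor A P Q D P' Q' \<Sigma> \<sigma> \<gamma> + g: law_mor A P Q D P' Q' \<Sigma>' \<sigma>' \<gamma>' +
  nat_trans A D \<Sigma> \<Sigma>' \<alpha>
  for A :: "('o, 'a) cat" and P Q and D :: "('p, 'b) cat" and P' Q' \<Sigma> \<sigma> \<gamma> \<Sigma>' \<sigma>' \<gamma>' \<alpha> +
  assumes lax_compat: "X \<in> Obj A \<Longrightarrow>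
      Comp D (\<sigma>' X) (FArr P' (\<alpha> X)) = Comp D (\<alpha> (FObj P X)) (\<sigma> X)"
    and colax_compat: "X \<in> Obj A \<Longrightarrow>
      Comp D (\<gamma>' X) (\<alpha> (FObj Q X)) = Comp D (FArr Q' (\<alpha> X)) (\<gamma> X)"

lemma law_cell_id:
  assumes "law_mor A P Q D P' Q' \<Sigma> \<sigma> \<gamma>"
  shows "law_cell A P Q D P' Q' \<Sigma> \<sigma> \<gamma> \<Sigma> \<sigma> \<gamma> (idN A D \<Sigma>)"
proof -
  interpret law_mor A P Q D P' Q' \<Sigma> \<sigma> \<gamma> by fact
  interpret i: nat_trans A D \<Sigma> \<Sigma> "idN A D \<Sigma>"
    by (rule nat_trans_idN) (rule S.cat_functor_axioms)
  show ?thesis by unfold_locales simp_all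
qed

lemma law_cell_vcomp:
  assumes "law_cell A P Q D P' Q' \<Sigma> \<sigma> \<gamma> \<Sigma>' \<sigma>' \<gamma>' \<alpha>"
    and "law_cell A P Q D P' Q' \<Sigma>' \<sigma>' \<gamma>' \<Sigma>'' \<sigma>'' \<gamma>'' \<beta>"
  shows "law_cell A P Q D P' Q' \<Sigma> \<sigma> \<gamma> \<Sigma>'' \<sigma>'' \<gamma>'' (\<beta> \<bullet>\<^bsub>A,D\<^esub> \<alpha>)"
proof -
  interpret a: law_cell A P Q D P' Q' \<Sigma> \<sigma> \<gamma> \<Sigma>' \<sigma>' \<gamma>' \<alpha> by fact
  interpret b: law_cell A P Q D P' Q' \<Sigma>' \<sigma>' \<gamma>' \<Sigma>'' \<sigma>'' \<gamma>'' \<beta> by fact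
  interpret c: nat_trans A D \<Sigma> \<Sigma>'' "\<beta> \<bullet>\<^bsub>A,D\<^esub> \<alpha>"
    by (rule nat_trans_compN) (rule a.nat_trans_axioms b.nat_trans_axioms)+
  show ?thesis
  proof unfold_locales
    fix X assume [simp]: "X \<in> Obj A"
    note e = a.lax_compat[of X] b.lax_compat[of X] a.colax_compat[of X] b.colax_compat[of X]
    \<comment> \<open>\<open>e'\<close> repeats the equations of \<open>e\<close> with one more
      factor on the right, the form in which they occur inside a longer composite.\<close>
    note e' = e[THEN a.f.S.T.Comp_eq_reassoc]
    show "Comp D (\<sigma>'' X) (FArr P' ((\<beta> \<bullet>\<^bsub>A,D\<^esub> \<alpha>) X)) =
        Comp D ((\<beta> \<bullet>\<^bsub>A,D\<^esub> \<alpha>) (FObj P X)) (\<sigma> X)"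
      by (simp add: e e')
    show "Comp D (\<gamma>'' X) ((\<beta> \<bullet>\<^bsub>A,D\<^esub> \<alpha>) (FObj Q X)) =
        Comp D (FArr Q' ((\<beta> \<bullet>\<^bsub>A,D\<^esub> \<alpha>) X)) (\<gamma> X)"
      by (simp add: e e')
  qed
qed

text \<open>In both squares \<open>\<beta>\<close> is moved to the left, past the structure of its
  own 1-cells by compatibility and past that of \<open>\<Sigma>'\<close> by naturality. Then
  \<open>\<alpha>\<close> is moved past \<open>\<tau>\<close> or \<open>\<delta>\<close> by their
  naturality, and past \<open>\<sigma>\<close> or \<open>\<gamma>\<close> by the image under
  \<open>T\<close> of its own compatibility.\<close>

lemma law_cell_hcomp:
  assumes "law_cell A P Q D P' Q' \<Sigma> \<sigma> \<gamma> \<Sigma>' \<sigma>' \<gamma>' \<alpha>"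
    and "law_cell D P' Q' E P'' Q'' T \<tau> \<delta> T' \<tau>' \<delta>' \<beta>"
  shows "law_cell A P Q E P'' Q''
    (T \<odot>\<^bsub>A\<^esub> \<Sigma>) ((T \<rhd>\<^bsub>A\<^esub> \<sigma>) \<bullet>\<^bsub>A,E\<^esub> (\<tau> \<lhd>\<^bsub>A\<^esub> \<Sigma>)) ((\<delta> \<lhd>\<^bsub>A\<^esub> \<Sigma>) \<bullet>\<^bsub>A,E\<^esub> (T \<rhd>\<^bsub>A\<^esub> \<gamma>))
    (T' \<odot>\<^bsub>A\<^esub> \<Sigma>') ((T' \<rhd>\<^bsub>A\<^esub> \<sigma>') \<bullet>\<^bsub>A,E\<^esub> (\<tau>' \<lhd>\<^bsub>A\<^esub> \<Sigma>')) ((\<delta>' \<lhd>\<^bsub>A\<^esub> \<Sigma>') \<bullet>\<^bsub>A,E\<^esub> (T' \<rhd>\<^bsub>A\<^esub> \<gamma>'))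
    ((\<beta> \<lhd>\<^bsub>A\<^esub> \<Sigma>') \<bullet>\<^bsub>A,E\<^esub> (T \<rhd>\<^bsub>A\<^esub> \<alpha>))"
proof -
  interpret a: law_cell A P Q D P' Q' \<Sigma> \<sigma> \<gamma> \<Sigma>' \<sigma>' \<gamma>' \<alpha> by fact
  interpret b: law_cell D P' Q' E P'' Q'' T \<tau> \<delta> T' \<tau>' \<delta>' \<beta> by fact
  interpret c: nat_trans A E "T \<odot>\<^bsub>A\<^esub> \<Sigma>" "T' \<odot>\<^bsub>A\<^esub> \<Sigma>'" "(\<beta> \<lhd>\<^bsub>A\<^esub> \<Sigma>') \<bullet>\<^bsub>A,E\<^esub> (T \<rhd>\<^bsub>A\<^esub> \<alpha>)"
    by (rule nat_trans_compN nat_trans_whiskL nat_trans_whiskR a.nat_trans_axioms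
      b.nat_trans_axioms b.f.S.cat_functor_axioms a.g.S.cat_functor_axioms)+
  show ?thesis
  proof (intro law_cell.intro law_cell_axioms.intro c.nat_trans_axioms
      law_mor_comp[OF a.f.law_mor_axioms b.f.law_mor_axioms]
      law_mor_comp[OF a.g.law_mor_axioms b.g.law_mor_axioms])
    fix X assume [simp]: "X \<in> Obj A"
    note e = b.lax_compat[of "FObj \<Sigma>' X"] b.natural[of "\<sigma>' X" "FObj \<Sigma>' (FObj P X)", symmetric]
      b.f.lax_natural[of "\<alpha> X" "FObj \<Sigma>' X"]
      b.f.S.FArr_eq_reassoc[OF a.lax_compat[of X]]
    note e' = e[THEN b.f.S.T.Comp_eq_reassoc]
    show "Comp E (((T' \<rhd>\<^bsub>A\<^esub> \<sigma>') \<bullet>\<^bsub>A,E\<^esub> (\<tau>' \<lhd>\<^bsub>A\<^esub> \<Sigma>')) X) (FArr P'' (((\<beta> \<lhd>\<^bsub>A\<^esub> \<Sigma>') \<bullet>\<^bsub>A,E\<^esub> (T \<rhd>\<^bsub>A\<^esub> \<alpha>)) X)) =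
        Comp E (((\<beta> \<lhd>\<^bsub>A\<^esub> \<Sigma>') \<bullet>\<^bsub>A,E\<^esub> (T \<rhd>\<^bsub>A\<^esub> \<alpha>)) (FObj P X)) (((T \<rhd>\<^bsub>A\<^esub> \<sigma>) \<bullet>\<^bsub>A,E\<^esub> (\<tau> \<lhd>\<^bsub>A\<^esub> \<Sigma>)) X)"
      \<comment> \<open>Simplified beforehand, the equations have left sides in the form that simp
        gives to the goal: images of composites split, composites nested to the right.\<close>
      by (simp add: e[simplified] e'[simplified])
    note e = b.colax_compat[of "FObj \<Sigma>' X"] b.natural[of "\<gamma>' X" "FObj Q' (FObj \<Sigma>' X)", symmetric]
      b.f.colax_natural[of "\<alpha> X" "FObj \<Sigma>' X"]
      b.f.S.FArr_eq_reassoc[OF a.colax_compat[of X]]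
    note e' = e[THEN b.f.S.T.Comp_eq_reassoc]
    show "Comp E (((\<delta>' \<lhd>\<^bsub>A\<^esub> \<Sigma>') \<bullet>\<^bsub>A,E\<^esub> (T' \<rhd>\<^bsub>A\<^esub> \<gamma>')) X) (((\<beta> \<lhd>\<^bsub>A\<^esub> \<Sigma>') \<bullet>\<^bsub>A,E\<^esub> (T \<rhd>\<^bsub>A\<^esub> \<alpha>)) (FObj Q X)) =
        Comp E (FArr Q'' (((\<beta> \<lhd>\<^bsub>A\<^esub> \<Sigma>') \<bullet>\<^bsub>A,E\<^esub> (T \<rhd>\<^bsub>A\<^esub> \<alpha>)) X)) (((\<delta> \<lhd>\<^bsub>A\<^esub> \<Sigma>) \<bullet>\<^bsub>A,E\<^esub> (T \<rhd>\<^bsub>A\<^esub> \<gamma>)) X)"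
      by (simp add: e[simplified] e'[simplified])
  qed
qed

text \<open>The predicate \<open>R\<close> stands for the lax, colax and Yang-Baxter conditions. The horizontal and vertical
  structure does not depend on them.\<close>

definition law_cells1 :: "('o, 'a, 'm) law0_scheme set \<Rightarrow>
    (('o, 'a, 'm) law0_scheme \<Rightarrow> ('o, 'a, 'o, 'a) fctr) \<Rightarrow>
    (('o, 'a, 'm) law0_scheme \<Rightarrow> ('o, 'a, 'o, 'a) fctr) \<Rightarrow>
    ((('o, 'a, 'm) law0_scheme, 'o, 'a) cell1 \<Rightarrow> bool) \<Rightarrow>
    (('o, 'a, 'm) law0_scheme, 'o, 'a) cell1 set" where
  "law_cells1 Z P Q R = {f. Src f \<in> Z \<and> Tgt f \<in> Z \<and>
    law_mor (Cat (Src f)) (P (Src f)) (Q (Src f)) (Cat (Tgt f)) (P (Tgt f)) (Q (Tgt f))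
      (Fun f) (Lax f) (Colax f) \<and> R f}"

definition law_cells2 :: "('o, 'a, 'm) law0_scheme set \<Rightarrow>
    (('o, 'a, 'm) law0_scheme \<Rightarrow> ('o, 'a, 'o, 'a) fctr) \<Rightarrow>
    (('o, 'a, 'm) law0_scheme \<Rightarrow> ('o, 'a, 'o, 'a) fctr) \<Rightarrow>
    ((('o, 'a, 'm) law0_scheme, 'o, 'a) cell1 \<Rightarrow> bool) \<Rightarrow>
    (('o, 'a, 'm) law0_scheme, 'o, 'a) cell2 set" where
  "law_cells2 Z P Q R = {\<alpha>. Src2 \<alpha> \<in> law_cells1 Z P Q R \<and> Tgt2 \<alpha> \<in> law_cells1 Z P Q R \<and>
    Src (Src2 \<alpha>) = Src (Tgt2 \<alpha>) \<and> Tgt (Src2 \<alpha>) = Tgt (Tgt2 \<alpha>) \<and>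
    (let X = Src (Src2 \<alpha>); Y = Tgt (Src2 \<alpha>); f = Src2 \<alpha>; g = Tgt2 \<alpha> in
      law_cell (Cat X) (P X) (Q X) (Cat Y) (P Y) (Q Y) (Fun f) (Lax f) (Colax f)
        (Fun g) (Lax g) (Colax g) (Trans \<alpha>))}"

definition law_id1 :: "(('o, 'a, 'm) law0_scheme \<Rightarrow> ('o, 'a, 'o, 'a) fctr) \<Rightarrow>
    (('o, 'a, 'm) law0_scheme \<Rightarrow> ('o, 'a, 'o, 'a) fctr) \<Rightarrow>
    ('o, 'a, 'm) law0_scheme \<Rightarrow> (('o, 'a, 'm) law0_scheme, 'o, 'a) cell1" where
  "law_id1 P Q X = \<lparr>Src = X, Tgt = X, Fun = idF (Cat X),
    Lax = idN (Cat X) (Cat X) (P X), Colax = idN (Cat X) (Cat X) (Q X)\<rparr>"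

definition law_two_cat :: "('o, 'a, 'm) law0_scheme set \<Rightarrow>
    (('o, 'a, 'm) law0_scheme \<Rightarrow> ('o, 'a, 'o, 'a) fctr) \<Rightarrow>
    (('o, 'a, 'm) law0_scheme \<Rightarrow> ('o, 'a, 'o, 'a) fctr) \<Rightarrow>
    ((('o, 'a, 'm) law0_scheme, 'o, 'a) cell1 \<Rightarrow> bool) \<Rightarrow>
    (('o, 'a, 'm) law0_scheme, (('o, 'a, 'm) law0_scheme, 'o, 'a) cell1,
      (('o, 'a, 'm) law0_scheme, 'o, 'a) cell2) twocat" where
  "law_two_cat Z P Q R = \<lparr>Cell0 = Z, Cell1 = law_cells1 Z P Q R, Cell2 = law_cells2 Z P Q R,
    src1 = Src, tgt1 = Tgt, src2 = Src2, tgt2 = Tgt2, id1 = law_id1 P Q, id2 = cell_id2,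
    comp1 = cell_comp1, vcomp = cell_vcomp, hcomp = cell_hcomp\<rparr>"

lemma cell_comp1_simps [simp]:
  "Src (cell_comp1 g f) = Src f" "Tgt (cell_comp1 g f) = Tgt g"
  "Fun (cell_comp1 g f) = Fun g \<odot>\<^bsub>Cat (Src f)\<^esub> Fun f"
  "Lax (cell_comp1 g f) = (Fun g \<rhd>\<^bsub>Cat (Src f)\<^esub> Lax f) \<bullet>\<^bsub>Cat (Src f),Cat (Tgt g)\<^esub> (Lax g \<lhd>\<^bsub>Cat (Src f)\<^esub> Fun f)"
  "Colax (cell_comp1 g f) = (Colax g \<lhd>\<^bsub>Cat (Src f)\<^esub> Fun f) \<bullet>\<^bsub>Cat (Src f),Cat (Tgt g)\<^esub> (Fun g \<rhd>\<^bsub>Cat (Src f)\<^esub> Colax f)"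
  by (simp_all add: cell_comp1_def Let_def)

lemma law_id1_simps [simp]:
  "Src (law_id1 P Q X) = X" "Tgt (law_id1 P Q X) = X" "Fun (law_id1 P Q X) = idF (Cat X)"
  "Lax (law_id1 P Q X) = idN (Cat X) (Cat X) (P X)"
  "Colax (law_id1 P Q X) = idN (Cat X) (Cat X) (Q X)"
  by (simp_all add: law_id1_def)

lemma cell_id2_simps [simp]:
  "Src2 (cell_id2 f) = f" "Tgt2 (cell_id2 f) = f"
  "Trans (cell_id2 f) = idN (Cat (Src f)) (Cat (Tgt f)) (Fun f)"
  by (simp_all add: cell_id2_def)

lemma cell_vcomp_simps [simp]:
  "Src2 (cell_vcomp \<beta> \<alpha>) = Src2 \<alpha>" "Tgt2 (cell_vcomp \<beta> \<alpha>) = Tgt2 \<beta>"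
  "Trans (cell_vcomp \<beta> \<alpha>) =
    Trans \<beta> \<bullet>\<^bsub>Cat (Src (Src2 \<alpha>)),Cat (Tgt (Src2 \<alpha>))\<^esub> Trans \<alpha>"
  by (simp_all add: cell_vcomp_def Let_def)

lemma cell_hcomp_simps [simp]:
  "Src2 (cell_hcomp \<beta> \<alpha>) = cell_comp1 (Src2 \<beta>) (Src2 \<alpha>)"
  "Tgt2 (cell_hcomp \<beta> \<alpha>) = cell_comp1 (Tgt2 \<beta>) (Tgt2 \<alpha>)"
  "Trans (cell_hcomp \<beta> \<alpha>) = (Trans \<beta> \<lhd>\<^bsub>Cat (Src (Src2 \<alpha>))\<^esub> Fun (Tgt2 \<alpha>))
    \<bullet>\<^bsub>Cat (Src (Src2 \<alpha>)),Cat (Tgt (Src2 \<beta>))\<^esub> (Fun (Src2 \<beta>) \<rhd>\<^bsub>Cat (Src (Src2 \<alpha>))\<^esub> Trans \<alpha>)"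
  by (simp_all add: cell_hcomp_def Let_def)

text \<open>2-cells between 1-cells satisfying \<open>R\<close> are unrestricted, so closure of
  \<open>R\<close> under identities and composites of 1-cells is all that has to be known about it.
  \<open>R_comp\<close> may use that both factors are full 1-cells.\<close>

locale law_structure =
  fixes Z :: "('o, 'a, 'm) law0_scheme set" and P Q R
  assumes endofunctors: "X \<in> Z \<Longrightarrow> cat_functor (Cat X) (Cat X) (P X)"
      "X \<in> Z \<Longrightarrow> cat_functor (Cat X) (Cat X) (Q X)"
    and R_id: "X \<in> Z \<Longrightarrow> R (law_id1 P Q X)"
    and R_comp: "\<lbrakk>f \<in> law_cells1 Z P Q R; g \<in> law_cells1 Z P Q R; Tgt f = Src g\<rbrakk> \<Longrightarrow>
      R (cell_comp1 g f)"
begin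

abbreviation (input) "cells1 \<equiv> law_cells1 Z P Q R"
abbreviation (input) "cells2 \<equiv> law_cells2 Z P Q R"

lemma cells1_law_mor: "f \<in> cells1 \<Longrightarrow>
    law_mor (Cat (Src f)) (P (Src f)) (Q (Src f)) (Cat (Tgt f)) (P (Tgt f)) (Q (Tgt f))
      (Fun f) (Lax f) (Colax f)"
  by (simp add: law_cells1_def)

lemma cells2_law_cell: "\<alpha> \<in> cells2 \<Longrightarrow>
    law_cell (Cat (Src (Src2 \<alpha>))) (P (Src (Src2 \<alpha>))) (Q (Src (Src2 \<alpha>)))
      (Cat (Tgt (Src2 \<alpha>))) (P (Tgt (Src2 \<alpha>))) (Q (Tgt (Src2 \<alpha>)))
      (Fun (Src2 \<alpha>)) (Lax (Src2 \<alpha>)) (Colax (Src2 \<alpha>))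
      (Fun (Tgt2 \<alpha>)) (Lax (Tgt2 \<alpha>)) (Colax (Tgt2 \<alpha>)) (Trans \<alpha>)"
  unfolding law_cells2_def Let_def by blast

lemma cells2_boundary:
  assumes "\<alpha> \<in> cells2"
  shows "Src2 \<alpha> \<in> cells1" "Tgt2 \<alpha> \<in> cells1" "Src (Tgt2 \<alpha>) = Src (Src2 \<alpha>)" "Tgt (Tgt2 \<alpha>) = Tgt (Src2 \<alpha>)"
  using assms by (simp_all add: law_cells2_def)

lemma id1_in: "X \<in> Z \<Longrightarrow> law_id1 P Q X \<in> cells1"
  by (simp add: law_cells1_def law_mor_id endofunctors R_id)

lemma comp1_in:
  assumes "f \<in> cells1" "g \<in> cells1" "Tgt f = Src g"
  shows "cell_comp1 g f \<in> cells1"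
  using law_mor_comp cells1_law_mor[OF assms(1)] cells1_law_mor[OF assms(2)] R_comp[OF assms] assms
  by (simp add: law_cells1_def)

lemma id2_in: "f \<in> cells1 \<Longrightarrow> cell_id2 f \<in> cells2"
  by (simp add: law_cells2_def law_cell_id cells1_law_mor)

lemma vcomp_in:
  assumes "\<alpha> \<in> cells2" "\<beta> \<in> cells2" "Tgt2 \<alpha> = Src2 \<beta>"
  shows "cell_vcomp \<beta> \<alpha> \<in> cells2"
  using law_cell_vcomp cells2_law_cell[OF assms(1)] cells2_law_cell[OF assms(2)]
    cells2_boundary[OF assms(1)] cells2_boundary[OF assms(2)] assms(3)
  by (simp add: law_cells2_def Let_def)

lemma hcomp_in:
  assumes "\<alpha> \<in> cells2" "\<beta> \<in> cells2" "Tgt (Src2 \<alpha>) = Src (Src2 \<beta>)"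
  shows "cell_hcomp \<beta> \<alpha> \<in> cells2"
  using law_cell_hcomp cells2_law_cell[OF assms(1)] cells2_law_cell[OF assms(2)]
    cells2_boundary[OF assms(1)] cells2_boundary[OF assms(2)] assms(3)
  by (simp add: law_cells2_def Let_def comp1_in)

lemma id1_comp1:
  assumes "f \<in> cells1"
  shows "cell_comp1 (law_id1 P Q (Tgt f)) f = f" "cell_comp1 f (law_id1 P Q (Src f)) = f"
proof -
  interpret law_mor "Cat (Src f)" "P (Src f)" "Q (Src f)" "Cat (Tgt f)" "P (Tgt f)" "Q (Tgt f)"
    "Fun f" "Lax f" "Colax f" using assms by (rule cells1_law_mor)
  note ext = transformation_eq_iff[OF _ lax.comp_ext] transformation_eq_iff[OF _ colax.comp_ext]
  show "cell_comp1 (law_id1 P Q (Tgt f)) f = f"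
    by (rule cell1.equality) (simp_all add: ext)
  show "cell_comp1 f (law_id1 P Q (Src f)) = f"
    by (rule cell1.equality) (simp_all add: ext)
qed

lemma comp1_assoc:
  assumes "f \<in> cells1" "g \<in> cells1" "h \<in> cells1" "Tgt f = Src g" "Tgt g = Src h"
  shows "cell_comp1 h (cell_comp1 g f) = cell_comp1 (cell_comp1 h g) f"
proof -
  interpret f: law_mor "Cat (Src f)" "P (Src f)" "Q (Src f)" "Cat (Src g)" "P (Src g)" "Q (Src g)"
    "Fun f" "Lax f" "Colax f" using cells1_law_mor[OF assms(1)] assms(4) by simp
  interpret g: law_mor "Cat (Src g)" "P (Src g)" "Q (Src g)" "Cat (Src h)" "P (Src h)" "Q (Src h)"
    "Fun g" "Lax g" "Colax g" using cells1_law_mor[OF assms(2)] assms(5) by simp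
  interpret h: law_mor "Cat (Src h)" "P (Src h)" "Q (Src h)" "Cat (Tgt h)" "P (Tgt h)" "Q (Tgt h)"
    "Fun h" "Lax h" "Colax h" using assms(3) by (rule cells1_law_mor)
  show ?thesis
    by (rule cell1.equality)
      (simp_all add: f.S.compF_assoc assms(4,5) transformation_eq_iff[of _ "Cat (Src f)"])
qed

lemma id2_vcomp:
  assumes "\<alpha> \<in> cells2"
  shows "cell_vcomp (cell_id2 (Tgt2 \<alpha>)) \<alpha> = \<alpha>" "cell_vcomp \<alpha> (cell_id2 (Src2 \<alpha>)) = \<alpha>"
proof -
  let ?A = "Cat (Src (Src2 \<alpha>))" and ?D = "Cat (Tgt (Src2 \<alpha>))"
  interpret nat_trans ?A ?D "Fun (Src2 \<alpha>)" "Fun (Tgt2 \<alpha>)" "Trans \<alpha>"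
    using cells2_law_cell[OF assms] by (simp add: law_cell_def)
  show "cell_vcomp (cell_id2 (Tgt2 \<alpha>)) \<alpha> = \<alpha>"
    by (rule cell2.equality) (simp_all add: transformation_eq_iff[OF _ comp_ext] cells2_boundary[OF assms])
  show "cell_vcomp \<alpha> (cell_id2 (Src2 \<alpha>)) = \<alpha>"
    by (rule cell2.equality) (simp_all add: transformation_eq_iff[OF _ comp_ext] cells2_boundary[OF assms])
qed

lemma vcomp_assoc:
  assumes "\<alpha> \<in> cells2" "\<beta> \<in> cells2" "\<delta> \<in> cells2" "Tgt2 \<alpha> = Src2 \<beta>" "Tgt2 \<beta> = Src2 \<delta>"
  shows "cell_vcomp \<delta> (cell_vcomp \<beta> \<alpha>) = cell_vcomp (cell_vcomp \<delta> \<beta>) \<alpha>"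
proof -
  let ?A = "Cat (Src (Src2 \<alpha>))" and ?D = "Cat (Tgt (Src2 \<alpha>))"
  note b = cells2_boundary[OF assms(1)] cells2_boundary[OF assms(2)]
  \<comment> \<open>\<open>cell_vcomp\<close> reads its categories off its right-hand argument, so
    all boundaries are expressed by those of \<open>\<alpha>\<close>.\<close>
  have e: "Src (Src2 \<beta>) = Src (Src2 \<alpha>)" "Tgt (Src2 \<beta>) = Tgt (Src2 \<alpha>)"
      "Src (Src2 \<delta>) = Src (Src2 \<alpha>)" "Tgt (Src2 \<delta>) = Tgt (Src2 \<alpha>)"
    using b assms(4,5) by metis+
  interpret a: nat_trans ?A ?D "Fun (Src2 \<alpha>)" "Fun (Src2 \<beta>)" "Trans \<alpha>"
    using cells2_law_cell[OF assms(1)] assms(4) by (simp add: law_cell_def)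
  interpret b: nat_trans ?A ?D "Fun (Src2 \<beta>)" "Fun (Src2 \<delta>)" "Trans \<beta>"
    using cells2_law_cell[OF assms(2)] assms(5) by (simp add: law_cell_def e)
  interpret d: nat_trans ?A ?D "Fun (Src2 \<delta>)" "Fun (Tgt2 \<delta>)" "Trans \<delta>"
    using cells2_law_cell[OF assms(3)] by (simp add: law_cell_def e)
  show ?thesis
    by (rule cell2.equality) (simp_all add: transformation_eq_iff[of _ ?A] e)
qed

lemma id2_hcomp:
  assumes "\<alpha> \<in> cells2"
  shows "cell_hcomp (cell_id2 (law_id1 P Q (Tgt (Src2 \<alpha>)))) \<alpha> = \<alpha>"
    "cell_hcomp \<alpha> (cell_id2 (law_id1 P Q (Src (Src2 \<alpha>)))) = \<alpha>"
proof -
  let ?A = "Cat (Src (Src2 \<alpha>))" and ?D = "Cat (Tgt (Src2 \<alpha>))"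
  note b = cells2_boundary[OF assms]
  note i = id1_comp1[OF b(1)] id1_comp1[OF b(2), unfolded b(3,4)]
  interpret nat_trans ?A ?D "Fun (Src2 \<alpha>)" "Fun (Tgt2 \<alpha>)" "Trans \<alpha>"
    using cells2_law_cell[OF assms] by (simp add: law_cell_def)
  show "cell_hcomp (cell_id2 (law_id1 P Q (Tgt (Src2 \<alpha>)))) \<alpha> = \<alpha>"
    by (rule cell2.equality) (simp_all add: transformation_eq_iff[OF _ comp_ext] i)
  show "cell_hcomp \<alpha> (cell_id2 (law_id1 P Q (Src (Src2 \<alpha>)))) = \<alpha>"
    by (rule cell2.equality) (simp_all add: transformation_eq_iff[OF _ comp_ext] i)
qed

lemma hcomp_assoc:
  assumes "\<alpha> \<in> cells2" "\<beta> \<in> cells2" "\<delta> \<in> cells2"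
    and "Tgt (Src2 \<alpha>) = Src (Src2 \<beta>)" "Tgt (Src2 \<beta>) = Src (Src2 \<delta>)"
  shows "cell_hcomp \<delta> (cell_hcomp \<beta> \<alpha>) = cell_hcomp (cell_hcomp \<delta> \<beta>) \<alpha>"
proof -
  let ?A = "Cat (Src (Src2 \<alpha>))" and ?B = "Cat (Src (Src2 \<beta>))" and ?C = "Cat (Src (Src2 \<delta>))"
    and ?D = "Cat (Tgt (Src2 \<delta>))"
  note b = cells2_boundary[OF assms(1)] cells2_boundary[OF assms(2)] cells2_boundary[OF assms(3)]
  interpret a: nat_trans ?A ?B "Fun (Src2 \<alpha>)" "Fun (Tgt2 \<alpha>)" "Trans \<alpha>"
    using cells2_law_cell[OF assms(1)] assms(4) by (simp add: law_cell_def)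
  interpret b: nat_trans ?B ?C "Fun (Src2 \<beta>)" "Fun (Tgt2 \<beta>)" "Trans \<beta>"
    using cells2_law_cell[OF assms(2)] assms(5) by (simp add: law_cell_def)
  interpret d: nat_trans ?C ?D "Fun (Src2 \<delta>)" "Fun (Tgt2 \<delta>)" "Trans \<delta>"
    using cells2_law_cell[OF assms(3)] by (simp add: law_cell_def)
  show ?thesis
    by (rule cell2.equality)
      (simp_all add: transformation_eq_iff[of _ ?A] comp1_assoc b assms(4,5))
qed

lemma hcomp_id2:
  assumes "f \<in> cells1" "g \<in> cells1" "Tgt f = Src g"
  shows "cell_hcomp (cell_id2 g) (cell_id2 f) = cell_id2 (cell_comp1 g f)"
proof -
  let ?A = "Cat (Src f)" and ?B = "Cat (Src g)" and ?C = "Cat (Tgt g)"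
  interpret f: cat_functor ?A ?B "Fun f"
    using cells1_law_mor[OF assms(1)] assms(3) by (simp add: law_mor_def)
  interpret g: cat_functor ?B ?C "Fun g"
    using cells1_law_mor[OF assms(2)] by (simp add: law_mor_def)
  show ?thesis
    by (rule cell2.equality) (simp_all add: transformation_eq_iff[of _ ?A] assms(3))
qed

text \<open>The two sides differ in the order of the middle factors, which naturality of
  \<open>\<beta>\<close> at the component of \<open>\<alpha>'\<close> exchanges.\<close>

lemma interchange:
  assumes "\<alpha> \<in> cells2" "\<alpha>' \<in> cells2" "\<beta> \<in> cells2" "\<beta>' \<in> cells2"
    and "Tgt2 \<alpha> = Src2 \<alpha>'" "Tgt2 \<beta> = Src2 \<beta>'" "Tgt (Src2 \<alpha>) = Src (Src2 \<beta>)"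
  shows "cell_hcomp (cell_vcomp \<beta>' \<beta>) (cell_vcomp \<alpha>' \<alpha>) = cell_vcomp (cell_hcomp \<beta>' \<alpha>') (cell_hcomp \<beta> \<alpha>)"
proof -
  let ?A = "Cat (Src (Src2 \<alpha>))" and ?B = "Cat (Src (Src2 \<beta>))" and ?C = "Cat (Tgt (Src2 \<beta>))"
  note b = cells2_boundary[OF assms(1)] cells2_boundary[OF assms(2)]
    cells2_boundary[OF assms(3)] cells2_boundary[OF assms(4)]
  have e: "Src (Src2 \<alpha>') = Src (Src2 \<alpha>)" "Tgt (Src2 \<alpha>') = Src (Src2 \<beta>)"
      "Src (Src2 \<beta>') = Src (Src2 \<beta>)" "Tgt (Src2 \<beta>') = Tgt (Src2 \<beta>)"
    using b assms(5-) by metis+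
  interpret a: nat_trans ?A ?B "Fun (Src2 \<alpha>)" "Fun (Src2 \<alpha>')" "Trans \<alpha>"
    using cells2_law_cell[OF assms(1)] assms(5,7) by (simp add: law_cell_def)
  interpret a': nat_trans ?A ?B "Fun (Src2 \<alpha>')" "Fun (Tgt2 \<alpha>')" "Trans \<alpha>'"
    using cells2_law_cell[OF assms(2)] by (simp add: law_cell_def e)
  interpret b: nat_trans ?B ?C "Fun (Src2 \<beta>)" "Fun (Src2 \<beta>')" "Trans \<beta>"
    using cells2_law_cell[OF assms(3)] assms(6) by (simp add: law_cell_def)
  interpret b': nat_trans ?B ?C "Fun (Src2 \<beta>')" "Fun (Tgt2 \<beta>')" "Trans \<beta>'"
    using cells2_law_cell[OF assms(4)] by (simp add: law_cell_def e)
  show ?thesis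
  proof (rule cell2.equality)
    have "Comp ?C (Trans \<beta> (FObj (Fun (Tgt2 \<alpha>')) X))
        (Comp ?C (FArr (Fun (Src2 \<beta>)) (Trans \<alpha>' X)) (FArr (Fun (Src2 \<beta>)) (Trans \<alpha> X))) =
      Comp ?C (FArr (Fun (Src2 \<beta>')) (Trans \<alpha>' X))
        (Comp ?C (Trans \<beta> (FObj (Fun (Src2 \<alpha>')) X)) (FArr (Fun (Src2 \<beta>)) (Trans \<alpha> X)))"
      if [simp]: "X \<in> Obj ?A" for X
      using b.F.T.Comp_eq_reassoc[OF b.natural[of "Trans \<alpha>' X"], of _ "FArr (Fun (Src2 \<beta>)) (Trans \<alpha> X)"]
      by simp
    then show "Trans (cell_hcomp (cell_vcomp \<beta>' \<beta>) (cell_vcomp \<alpha>' \<alpha>)) =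
        Trans (cell_vcomp (cell_hcomp \<beta>' \<alpha>') (cell_hcomp \<beta> \<alpha>))"
      by (simp add: transformation_eq_iff[of _ ?A] e assms(5-7))
  qed simp_all
qed

theorem two_category_law_two_cat: "two_category (law_two_cat Z P Q R)"
proof (rule two_category.intro)
  show "category (one_cat (law_two_cat Z P Q R))"
  proof (rule categoryI)
    show "Dom (one_cat (law_two_cat Z P Q R)) f \<in> Obj (one_cat (law_two_cat Z P Q R)) \<and>
        Cod (one_cat (law_two_cat Z P Q R)) f \<in> Obj (one_cat (law_two_cat Z P Q R))"
      if "f \<in> Arr (one_cat (law_two_cat Z P Q R))" for f
      using that by (auto simp: one_cat_def law_two_cat_def law_cells1_def)
  qed (auto simp: one_cat_def law_two_cat_def id1_in comp1_in id1_comp1 comp1_assoc)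
  show "category (vert_cat (law_two_cat Z P Q R))"
    by (rule categoryI)
      (auto simp: vert_cat_def law_two_cat_def id2_in vcomp_in id2_vcomp vcomp_assoc cells2_boundary)
  show "category (horiz_cat (law_two_cat Z P Q R))"
  proof (rule categoryI)
    show "Dom (horiz_cat (law_two_cat Z P Q R)) f \<in> Obj (horiz_cat (law_two_cat Z P Q R)) \<and>
        Cod (horiz_cat (law_two_cat Z P Q R)) f \<in> Obj (horiz_cat (law_two_cat Z P Q R))"
      if "f \<in> Arr (horiz_cat (law_two_cat Z P Q R))" for f
      using that by (auto simp: horiz_cat_def law_two_cat_def law_cells2_def law_cells1_def)
  qed (auto simp: horiz_cat_def law_two_cat_def id1_in id2_in hcomp_in id2_hcomp hcomp_assoc)
qed (simp_all add: law_two_cat_def cells2_boundary hcomp_id2 interchange)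

end

section \<open>Mix and Dist are 2-categories\<close>

lemma lax_comonad_mor_iff:
  "lax_comonad_mor A TT D GG \<Sigma> \<sigma> \<longleftrightarrow> nat_trans A D (CF GG \<odot>\<^bsub>A\<^esub> \<Sigma>) (\<Sigma> \<odot>\<^bsub>A\<^esub> CF TT) \<sigma> \<and>
    (\<forall>X\<in>Obj A. Comp D (FArr \<Sigma> (counit TT X)) (\<sigma> X) = counit GG (FObj \<Sigma> X)) \<and>
    (\<forall>X\<in>Obj A. Comp D (FArr \<Sigma> (comult TT X)) (\<sigma> X) =
      Comp D (Comp D (\<sigma> (FObj (CF TT) X)) (FArr (CF GG) (\<sigma> X))) (comult GG (FObj \<Sigma> X)))"
  by (simp add: lax_comonad_mor_def Let_def transformation_eq_iff[of _ A])

lemma colax_comonad_mor_iff: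
  "colax_comonad_mor A SS D CC \<Sigma> \<gamma> \<longleftrightarrow> nat_trans A D (\<Sigma> \<odot>\<^bsub>A\<^esub> CF SS) (CF CC \<odot>\<^bsub>A\<^esub> \<Sigma>) \<gamma> \<and>
    (\<forall>X\<in>Obj A. Comp D (counit CC (FObj \<Sigma> X)) (\<gamma> X) = FArr \<Sigma> (counit SS X)) \<and>
    (\<forall>X\<in>Obj A. Comp D (comult CC (FObj \<Sigma> X)) (\<gamma> X) =
      Comp D (Comp D (FArr (CF CC) (\<gamma> X)) (\<gamma> (FObj (CF SS) X))) (FArr \<Sigma> (comult SS X)))"
  by (simp add: colax_comonad_mor_def Let_def transformation_eq_iff[of _ A])

lemma lax_monad_mor_iff:
  "lax_monad_mor A BB D AA \<Sigma> \<sigma> \<longleftrightarrow> nat_trans A D (MF AA \<odot>\<^bsub>A\<^esub> \<Sigma>) (\<Sigma> \<odot>\<^bsub>A\<^esub> MF BB) \<sigma> \<and>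
    (\<forall>X\<in>Obj A. Comp D (\<sigma> X) (unit AA (FObj \<Sigma> X)) = FArr \<Sigma> (unit BB X)) \<and>
    (\<forall>X\<in>Obj A. Comp D (\<sigma> X) (mult AA (FObj \<Sigma> X)) =
      Comp D (Comp D (FArr \<Sigma> (mult BB X)) (\<sigma> (FObj (MF BB) X))) (FArr (MF AA) (\<sigma> X)))"
  by (simp add: lax_monad_mor_def Let_def transformation_eq_iff[of _ A])

lemma yang_baxter_iff:
  "yang_baxter A P Q \<chi> D P' Q' \<tau> \<Sigma> \<sigma> \<gamma> \<longleftrightarrow> (\<forall>X\<in>Obj A.
    Comp D (Comp D (\<gamma> (FObj P X)) (FArr \<Sigma> (\<chi> X))) (\<sigma> (FObj Q X)) =
    Comp D (Comp D (FArr Q' (\<sigma> X)) (\<tau> (FObj \<Sigma> X))) (FArr P' (\<gamma> X)))"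
  by (simp add: yang_baxter_def transformation_eq_iff[of _ A])

lemma comonad_nat_trans:
  assumes "comonad A W"
  shows "nat_trans A A (CF W) (idF A) (counit W)" "nat_trans A A (CF W) (CF W \<odot>\<^bsub>A\<^esub> CF W) (comult W)"
  using assms by (simp_all add: comonad_def Let_def)

lemma monad_nat_trans:
  assumes "monad A M"
  shows "nat_trans A A (idF A) (MF M) (unit M)" "nat_trans A A (MF M \<odot>\<^bsub>A\<^esub> MF M) (MF M) (mult M)"
  using assms by (simp_all add: monad_def Let_def)

lemma comonad_functor: "comonad A W \<Longrightarrow> cat_functor A A (CF W)"
  using comonad_nat_trans(1) nat_trans.axioms(1) by blast

lemma monad_functor: "monad A M \<Longrightarrow> cat_functor A A (MF M)"
  using monad_nat_trans(1) nat_trans.axioms(2) by blast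

lemma lax_comonad_mor_id:
  assumes "comonad A W"
  shows "lax_comonad_mor A W A W (idF A) (idN A A (CF W))"
proof -
  interpret \<epsilon>: nat_trans A A "CF W" "idF A" "counit W" by (rule comonad_nat_trans) fact
  interpret \<Delta>: nat_trans A A "CF W" "CF W \<odot>\<^bsub>A\<^esub> CF W" "comult W" by (rule comonad_nat_trans) fact
  show ?thesis
    by (simp add: lax_comonad_mor_iff nat_trans_idN \<epsilon>.F.cat_functor_axioms)
qed

lemma colax_comonad_mor_id:
  assumes "comonad A W"
  shows "colax_comonad_mor A W A W (idF A) (idN A A (CF W))"
proof -
  interpret \<epsilon>: nat_trans A A "CF W" "idF A" "counit W" by (rule comonad_nat_trans) fact
  interpret \<Delta>: nat_trans A A "CF W" "CF W \<odot>\<^bsub>A\<^esub> CF W" "comult W" by (rule comonad_nat_trans) fact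
  show ?thesis
    by (simp add: colax_comonad_mor_iff nat_trans_idN \<epsilon>.F.cat_functor_axioms)
qed

lemma lax_monad_mor_id:
  assumes "monad A M"
  shows "lax_monad_mor A M A M (idF A) (idN A A (MF M))"
proof -
  interpret \<eta>: nat_trans A A "idF A" "MF M" "unit M" by (rule monad_nat_trans) fact
  interpret \<mu>: nat_trans A A "MF M \<odot>\<^bsub>A\<^esub> MF M" "MF M" "mult M" by (rule monad_nat_trans) fact
  show ?thesis
    by (simp add: lax_monad_mor_iff nat_trans_idN \<eta>.G.cat_functor_axioms)
qed

lemma yang_baxter_id:
  assumes "nat_trans A A (P \<odot>\<^bsub>A\<^esub> Q) (Q \<odot>\<^bsub>A\<^esub> P) \<chi>" "cat_functor A A P" "cat_functor A A Q"
  shows "yang_baxter A P Q \<chi> A P Q \<chi> (idF A) (idN A A P) (idN A A Q)"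
proof -
  interpret nat_trans A A "P \<odot>\<^bsub>A\<^esub> Q" "Q \<odot>\<^bsub>A\<^esub> P" \<chi> by fact
  interpret P: cat_functor A A P by fact
  interpret Q: cat_functor A A Q by fact
  show ?thesis
    by (simp add: yang_baxter_iff)
qed

text \<open>A composable pair, at which each condition is shown to be stable under composition. The
  colax and Yang-Baxter results serve both 2-categories; the lax one comes in a monad and a comonad
  version.\<close>

locale law_mor_pair =
  f: law_mor A P Q D P' Q' \<Sigma> \<sigma> \<gamma> + g: law_mor D P' Q' E P'' Q'' \<Sigma>' \<sigma>' \<gamma>'
  for A :: "('o, 'a) cat" and P Q and D :: "('p, 'b) cat" and P' Q' \<Sigma> \<sigma> \<gamma>
    and E :: "('q, 'c) cat" and P'' Q'' \<Sigma>' \<sigma>' \<gamma>'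
begin

abbreviation (input) "comp_lax \<equiv> (\<Sigma>' \<rhd>\<^bsub>A\<^esub> \<sigma>) \<bullet>\<^bsub>A,E\<^esub> (\<sigma>' \<lhd>\<^bsub>A\<^esub> \<Sigma>)"
abbreviation (input) "comp_colax \<equiv> (\<gamma>' \<lhd>\<^bsub>A\<^esub> \<Sigma>) \<bullet>\<^bsub>A,E\<^esub> (\<Sigma>' \<rhd>\<^bsub>A\<^esub> \<gamma>)"

lemma nat_trans_comp:
  "nat_trans A E (P'' \<odot>\<^bsub>A\<^esub> (\<Sigma>' \<odot>\<^bsub>A\<^esub> \<Sigma>)) ((\<Sigma>' \<odot>\<^bsub>A\<^esub> \<Sigma>) \<odot>\<^bsub>A\<^esub> P) comp_lax"
  "nat_trans A E ((\<Sigma>' \<odot>\<^bsub>A\<^esub> \<Sigma>) \<odot>\<^bsub>A\<^esub> Q) (Q'' \<odot>\<^bsub>A\<^esub> (\<Sigma>' \<odot>\<^bsub>A\<^esub> \<Sigma>)) comp_colax"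
  using law_mor_comp[OF f.law_mor_axioms g.law_mor_axioms] by (simp_all add: law_mor_def)

text \<open>The image under \<open>\<Sigma>'\<close> of the condition on \<open>\<sigma>\<close> is
  followed by the condition on \<open>\<sigma>'\<close> at \<open>\<Sigma>X\<close>. For the
  comultiplication, naturality of \<open>\<sigma>'\<close> at the component of
  \<open>\<sigma>\<close> then restores the order of factors in the composite lax part.\<close>

lemma lax_comonad_mor_comp:
  assumes "comonad A W" "comonad D W'" "comonad E W''"
    and [simp]: "CF W = P" "CF W' = P'" "CF W'' = P''"
    and f: "lax_comonad_mor A W D W' \<Sigma> \<sigma>" and g: "lax_comonad_mor D W' E W'' \<Sigma>' \<sigma>'"
  shows "lax_comonad_mor A W E W'' (\<Sigma>' \<odot>\<^bsub>A\<^esub> \<Sigma>) comp_lax"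
proof -
  interpret \<epsilon>: nat_trans A A P "idF A" "counit W"
    using comonad_nat_trans[OF assms(1)] by simp
  interpret \<Delta>: nat_trans A A P "P \<odot>\<^bsub>A\<^esub> P" "comult W"
    using comonad_nat_trans[OF assms(1)] by simp
  interpret \<epsilon>': nat_trans D D P' "idF D" "counit W'"
    using comonad_nat_trans[OF assms(2)] by simp
  interpret \<Delta>': nat_trans D D P' "P' \<odot>\<^bsub>D\<^esub> P'" "comult W'"
    using comonad_nat_trans[OF assms(2)] by simp
  interpret \<epsilon>'': nat_trans E E P'' "idF E" "counit W''"
    using comonad_nat_trans[OF assms(3)] by simp
  interpret \<Delta>'': nat_trans E E P'' "P'' \<odot>\<^bsub>E\<^esub> P''" "comult W''"
    using comonad_nat_trans[OF assms(3)] by simp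
  have "Comp E (FArr \<Sigma>' (FArr \<Sigma> (counit W X))) (Comp E (FArr \<Sigma>' (\<sigma> X)) (\<sigma>' (FObj \<Sigma> X))) =
      counit W'' (FObj \<Sigma>' (FObj \<Sigma> X))" if [simp]: "X \<in> Obj A" for X
  proof -
    have "Comp D (FArr \<Sigma> (counit W X)) (\<sigma> X) = counit W' (FObj \<Sigma> X)"
      using f by (simp add: lax_comonad_mor_iff)
    then have "Comp E (FArr \<Sigma>' (FArr \<Sigma> (counit W X))) (FArr \<Sigma>' (\<sigma> X)) = FArr \<Sigma>' (counit W' (FObj \<Sigma> X))"
      by (subst g.S.FArr_Comp_Arr[symmetric]) simp_all
    \<comment> \<open>The last factor is appended by hand: the preceding equation has a single arrow
      on its right side, whereas \<open>Comp_eq_reassoc\<close> relates two composites.\<close>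
    then have "Comp E (Comp E (FArr \<Sigma>' (FArr \<Sigma> (counit W X))) (FArr \<Sigma>' (\<sigma> X))) (\<sigma>' (FObj \<Sigma> X)) =
        Comp E (FArr \<Sigma>' (counit W' (FObj \<Sigma> X))) (\<sigma>' (FObj \<Sigma> X))"
      by (rule arg_cong)
    with g show ?thesis by (simp add: lax_comonad_mor_iff)
  qed
  moreover have "Comp E (FArr \<Sigma>' (FArr \<Sigma> (comult W X))) (Comp E (FArr \<Sigma>' (\<sigma> X)) (\<sigma>' (FObj \<Sigma> X))) =
      Comp E (FArr \<Sigma>' (\<sigma> (FObj P X))) (Comp E (\<sigma>' (FObj \<Sigma> (FObj P X)))
       (Comp E (FArr P'' (FArr \<Sigma>' (\<sigma> X))) (Comp E (FArr P'' (\<sigma>' (FObj \<Sigma> X)))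
         (comult W'' (FObj \<Sigma>' (FObj \<Sigma> X))))))" if [simp]: "X \<in> Obj A" for X
  proof -
    have "Comp D (FArr \<Sigma> (comult W X)) (\<sigma> X) =
        Comp D (\<sigma> (FObj P X)) (Comp D (FArr P' (\<sigma> X)) (comult W' (FObj \<Sigma> X)))"
      using f by (simp add: lax_comonad_mor_iff)
    note e1 = g.S.FArr_eq_reassoc[OF this]
    have e2: "Comp E (FArr \<Sigma>' (comult W' (FObj \<Sigma> X))) (\<sigma>' (FObj \<Sigma> X)) =
        Comp E (\<sigma>' (FObj P' (FObj \<Sigma> X))) (Comp E (FArr P'' (\<sigma>' (FObj \<Sigma> X)))
          (comult W'' (FObj \<Sigma>' (FObj \<Sigma> X))))"
      using g by (simp add: lax_comonad_mor_iff)
    note e3 = g.lax_natural[of "\<sigma> X" "FObj \<Sigma> (FObj P X)", symmetric]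
    note e = e1 e2 e3
    note e' = e[THEN g.S.T.Comp_eq_reassoc]
    show ?thesis by (simp add: e[simplified] e'[simplified])
  qed
  ultimately show ?thesis
    using nat_trans_comp(1) by (simp add: lax_comonad_mor_iff)
qed

lemma lax_monad_mor_comp:
  assumes "monad A M" "monad D M'" "monad E M''"
    and [simp]: "MF M = P" "MF M' = P'" "MF M'' = P''"
    and f: "lax_monad_mor A M D M' \<Sigma> \<sigma>" and g: "lax_monad_mor D M' E M'' \<Sigma>' \<sigma>'"
  shows "lax_monad_mor A M E M'' (\<Sigma>' \<odot>\<^bsub>A\<^esub> \<Sigma>) comp_lax"
proof -
  interpret \<epsilon>: nat_trans A A "idF A" P "unit M"
    using monad_nat_trans[OF assms(1)] by simp
  interpret \<Delta>: nat_trans A A "P \<odot>\<^bsub>A\<^esub> P" P "mult M"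
    using monad_nat_trans[OF assms(1)] by simp
  interpret \<epsilon>': nat_trans D D "idF D" P' "unit M'"
    using monad_nat_trans[OF assms(2)] by simp
  interpret \<Delta>': nat_trans D D "P' \<odot>\<^bsub>D\<^esub> P'" P' "mult M'"
    using monad_nat_trans[OF assms(2)] by simp
  interpret \<epsilon>'': nat_trans E E "idF E" P'' "unit M''"
    using monad_nat_trans[OF assms(3)] by simp
  interpret \<Delta>'': nat_trans E E "P'' \<odot>\<^bsub>E\<^esub> P''" P'' "mult M''"
    using monad_nat_trans[OF assms(3)] by simp
  have "Comp E (FArr \<Sigma>' (\<sigma> X)) (Comp E (\<sigma>' (FObj \<Sigma> X)) (unit M'' (FObj \<Sigma>' (FObj \<Sigma> X)))) =
      FArr \<Sigma>' (FArr \<Sigma> (unit M X))" if [simp]: "X \<in> Obj A" for X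
  proof -
    have "Comp D (\<sigma> X) (unit M' (FObj \<Sigma> X)) = FArr \<Sigma> (unit M X)"
      using f by (simp add: lax_monad_mor_iff)
    then have "Comp E (FArr \<Sigma>' (\<sigma> X)) (FArr \<Sigma>' (unit M' (FObj \<Sigma> X))) = FArr \<Sigma>' (FArr \<Sigma> (unit M X))"
      by (subst g.S.FArr_Comp_Arr[symmetric]) simp_all
    with g show ?thesis by (simp add: lax_monad_mor_iff)
  qed
  moreover have "Comp E (FArr \<Sigma>' (\<sigma> X)) (Comp E (\<sigma>' (FObj \<Sigma> X)) (mult M'' (FObj \<Sigma>' (FObj \<Sigma> X)))) =
      Comp E (FArr \<Sigma>' (FArr \<Sigma> (mult M X))) (Comp E (FArr \<Sigma>' (\<sigma> (FObj P X)))
        (Comp E (\<sigma>' (FObj \<Sigma> (FObj P X))) (Comp E (FArr P'' (FArr \<Sigma>' (\<sigma> X)))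
          (FArr P'' (\<sigma>' (FObj \<Sigma> X))))))" if [simp]: "X \<in> Obj A" for X
  proof -
    have "Comp D (\<sigma> X) (mult M' (FObj \<Sigma> X)) =
        Comp D (FArr \<Sigma> (mult M X)) (Comp D (\<sigma> (FObj P X)) (FArr P' (\<sigma> X)))"
      using f by (simp add: lax_monad_mor_iff)
    note e1 = g.S.FArr_eq_reassoc[OF this]
    have e2: "Comp E (\<sigma>' (FObj \<Sigma> X)) (mult M'' (FObj \<Sigma>' (FObj \<Sigma> X))) =
        Comp E (FArr \<Sigma>' (mult M' (FObj \<Sigma> X))) (Comp E (\<sigma>' (FObj P' (FObj \<Sigma> X)))
          (FArr P'' (\<sigma>' (FObj \<Sigma> X))))"
      using g by (simp add: lax_monad_mor_iff)
    \<comment> \<open>In contrast to the comonad case this square rewrites the right side of the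
      goal, and so it is not reversed.\<close>
    note e3 = g.lax_natural[of "\<sigma> X" "FObj \<Sigma> (FObj P X)"]
    note e = e1 e2 e3
    note e' = e[THEN g.S.T.Comp_eq_reassoc]
    show ?thesis by (simp add: e[simplified] e'[simplified])
  qed
  ultimately show ?thesis
    using nat_trans_comp(1) by (simp add: lax_monad_mor_iff)
qed

lemma colax_comonad_mor_comp:
  assumes "comonad A W" "comonad D W'" "comonad E W''"
    and [simp]: "CF W = Q" "CF W' = Q'" "CF W'' = Q''"
    and f: "colax_comonad_mor A W D W' \<Sigma> \<gamma>" and g: "colax_comonad_mor D W' E W'' \<Sigma>' \<gamma>'"
  shows "colax_comonad_mor A W E W'' (\<Sigma>' \<odot>\<^bsub>A\<^esub> \<Sigma>) comp_colax"
proof -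
  interpret \<epsilon>: nat_trans A A Q "idF A" "counit W"
    using comonad_nat_trans[OF assms(1)] by simp
  interpret \<Delta>: nat_trans A A Q "Q \<odot>\<^bsub>A\<^esub> Q" "comult W"
    using comonad_nat_trans[OF assms(1)] by simp
  interpret \<epsilon>': nat_trans D D Q' "idF D" "counit W'"
    using comonad_nat_trans[OF assms(2)] by simp
  interpret \<Delta>': nat_trans D D Q' "Q' \<odot>\<^bsub>D\<^esub> Q'" "comult W'"
    using comonad_nat_trans[OF assms(2)] by simp
  interpret \<epsilon>'': nat_trans E E Q'' "idF E" "counit W''"
    using comonad_nat_trans[OF assms(3)] by simp
  interpret \<Delta>'': nat_trans E E Q'' "Q'' \<odot>\<^bsub>E\<^esub> Q''" "comult W''"
    using comonad_nat_trans[OF assms(3)] by simp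
  have "Comp E (counit W'' (FObj \<Sigma>' (FObj \<Sigma> X))) (Comp E (\<gamma>' (FObj \<Sigma> X)) (FArr \<Sigma>' (\<gamma> X))) =
      FArr \<Sigma>' (FArr \<Sigma> (counit W X))" if [simp]: "X \<in> Obj A" for X
  proof -
    have "Comp D (counit W' (FObj \<Sigma> X)) (\<gamma> X) = FArr \<Sigma> (counit W X)"
      using f by (simp add: colax_comonad_mor_iff)
    then have "Comp E (FArr \<Sigma>' (counit W' (FObj \<Sigma> X))) (FArr \<Sigma>' (\<gamma> X)) = FArr \<Sigma>' (FArr \<Sigma> (counit W X))"
      by (subst g.S.FArr_Comp_Arr[symmetric]) simp_all
    moreover have "Comp E (counit W'' (FObj \<Sigma>' (FObj \<Sigma> X))) (\<gamma>' (FObj \<Sigma> X)) = FArr \<Sigma>' (counit W' (FObj \<Sigma> X))"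
      using g by (simp add: colax_comonad_mor_iff)
    ultimately have "Comp E (Comp E (counit W'' (FObj \<Sigma>' (FObj \<Sigma> X))) (\<gamma>' (FObj \<Sigma> X))) (FArr \<Sigma>' (\<gamma> X)) =
        FArr \<Sigma>' (FArr \<Sigma> (counit W X))"
      by metis
    then show ?thesis by simp
  qed
  moreover have "Comp E (comult W'' (FObj \<Sigma>' (FObj \<Sigma> X))) (Comp E (\<gamma>' (FObj \<Sigma> X)) (FArr \<Sigma>' (\<gamma> X))) =
      Comp E (FArr Q'' (\<gamma>' (FObj \<Sigma> X))) (Comp E (FArr Q'' (FArr \<Sigma>' (\<gamma> X)))
        (Comp E (\<gamma>' (FObj \<Sigma> (FObj Q X))) (Comp E (FArr \<Sigma>' (\<gamma> (FObj Q X)))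
          (FArr \<Sigma>' (FArr \<Sigma> (comult W X))))))" if [simp]: "X \<in> Obj A" for X
  proof -
    have "Comp D (comult W' (FObj \<Sigma> X)) (\<gamma> X) =
        Comp D (FArr Q' (\<gamma> X)) (Comp D (\<gamma> (FObj Q X)) (FArr \<Sigma> (comult W X)))"
      using f by (simp add: colax_comonad_mor_iff)
    note e1 = g.S.FArr_eq_reassoc[OF this]
    have e2: "Comp E (comult W'' (FObj \<Sigma>' (FObj \<Sigma> X))) (\<gamma>' (FObj \<Sigma> X)) =
        Comp E (FArr Q'' (\<gamma>' (FObj \<Sigma> X))) (Comp E (\<gamma>' (FObj Q' (FObj \<Sigma> X)))
          (FArr \<Sigma>' (comult W' (FObj \<Sigma> X))))"
      using g by (simp add: colax_comonad_mor_iff)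
    note e3 = g.colax_natural[of "\<gamma> X" "FObj Q' (FObj \<Sigma> X)"]
    note e = e1 e2 e3
    note e' = e[THEN g.S.T.Comp_eq_reassoc]
    show ?thesis by (simp add: e[simplified] e'[simplified])
  qed
  ultimately show ?thesis
    using nat_trans_comp(2) by (simp add: colax_comonad_mor_iff)
qed

text \<open>Two hexagons are pasted: the image under \<open>\<Sigma>'\<close> of the first and the
  second one at \<open>\<Sigma>X\<close>. They are joined by naturality of \<open>\<gamma>'\<close>
  at the component of \<open>\<sigma>\<close> and of \<open>\<sigma>'\<close> at that of
  \<open>\<gamma>\<close>.\<close>

lemma yang_baxter_comp:
  assumes "nat_trans A A (P \<odot>\<^bsub>A\<^esub> Q) (Q \<odot>\<^bsub>A\<^esub> P) \<chi>" "nat_trans D D (P' \<odot>\<^bsub>D\<^esub> Q') (Q' \<odot>\<^bsub>D\<^esub> P') \<chi>'"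
    "nat_trans E E (P'' \<odot>\<^bsub>E\<^esub> Q'') (Q'' \<odot>\<^bsub>E\<^esub> P'') \<chi>''"
    and f: "yang_baxter A P Q \<chi> D P' Q' \<chi>' \<Sigma> \<sigma> \<gamma>" and g: "yang_baxter D P' Q' \<chi>' E P'' Q'' \<chi>'' \<Sigma>' \<sigma>' \<gamma>'"
  shows "yang_baxter A P Q \<chi> E P'' Q'' \<chi>'' (\<Sigma>' \<odot>\<^bsub>A\<^esub> \<Sigma>) comp_lax comp_colax"
proof -
  interpret \<chi>: nat_trans A A "P \<odot>\<^bsub>A\<^esub> Q" "Q \<odot>\<^bsub>A\<^esub> P" \<chi> by fact
  interpret \<chi>': nat_trans D D "P' \<odot>\<^bsub>D\<^esub> Q'" "Q' \<odot>\<^bsub>D\<^esub> P'" \<chi>' by fact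
  interpret \<chi>'': nat_trans E E "P'' \<odot>\<^bsub>E\<^esub> Q''" "Q'' \<odot>\<^bsub>E\<^esub> P''" \<chi>'' by fact
  show ?thesis
    unfolding yang_baxter_iff
  proof
    fix X assume [simp]: "X \<in> Obj A"
    have "Comp D (\<gamma> (FObj P X)) (Comp D (FArr \<Sigma> (\<chi> X)) (\<sigma> (FObj Q X))) =
        Comp D (FArr Q' (\<sigma> X)) (Comp D (\<chi>' (FObj \<Sigma> X)) (FArr P' (\<gamma> X)))"
      using f by (simp add: yang_baxter_iff)
    note e1 = g.S.FArr_eq_reassoc[OF this]
    have e2: "Comp E (\<gamma>' (FObj P' (FObj \<Sigma> X))) (Comp E (FArr \<Sigma>' (\<chi>' (FObj \<Sigma> X))) (\<sigma>' (FObj Q' (FObj \<Sigma> X)))) =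
        Comp E (FArr Q'' (\<sigma>' (FObj \<Sigma> X))) (Comp E (\<chi>'' (FObj \<Sigma>' (FObj \<Sigma> X))) (FArr P'' (\<gamma>' (FObj \<Sigma> X))))"
      using g by (simp add: yang_baxter_iff)
    note e3 = g.colax_natural[of "\<sigma> X" "FObj \<Sigma> (FObj P X)"]
      g.lax_natural[of "\<gamma> X" "FObj Q' (FObj \<Sigma> X)", symmetric]
    note e' = e3[THEN g.S.T.Comp_eq_reassoc]
    \<comment> \<open>Each hexagon is extended by the factor that follows it in the pasted
      diagram.\<close>
    note t = e1[THEN g.S.T.Comp_eq_reassoc, of "\<sigma>' (FObj \<Sigma> (FObj Q X))"]
      e2[THEN g.S.T.Comp_eq_reassoc, of "FArr P'' (FArr \<Sigma>' (\<gamma> X))"]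
    show "Comp E (Comp E (comp_colax (FObj P X)) (FArr (\<Sigma>' \<odot>\<^bsub>A\<^esub> \<Sigma>) (\<chi> X))) (comp_lax (FObj Q X)) =
        Comp E (Comp E (FArr Q'' (comp_lax X)) (\<chi>'' (FObj (\<Sigma>' \<odot>\<^bsub>A\<^esub> \<Sigma>) X))) (FArr P'' (comp_colax X))"
      by (simp add: t[simplified] e3[simplified] e'[simplified])
  qed
qed

end

section \<open>Mix and Dist as instances of the common 2-category\<close>

definition mix_mor :: "('o, 'a) mix1 \<Rightarrow> bool" where
  "mix_mor f \<longleftrightarrow> (let X = Src f; Y = Tgt f; A = Cat X; D = Cat Y in
    lax_monad_mor A (MonB X) D (MonB Y) (Fun f) (Lax f) \<and>
    colax_comonad_mor A (ComC X) D (ComC Y) (Fun f) (Colax f) \<and>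
    yang_baxter A (MF (MonB X)) (CF (ComC X)) (Law X) D (MF (MonB Y)) (CF (ComC Y)) (Law Y)
      (Fun f) (Lax f) (Colax f))"

definition dist_mor :: "('o, 'a) dist1 \<Rightarrow> bool" where
  "dist_mor f \<longleftrightarrow> (let X = Src f; Y = Tgt f; B = Cat X; D = Cat Y in
    lax_comonad_mor B (ComT X) D (ComT Y) (Fun f) (Lax f) \<and>
    colax_comonad_mor B (ComS X) D (ComS Y) (Fun f) (Colax f) \<and>
    yang_baxter B (CF (ComT X)) (CF (ComS X)) (Law X) D (CF (ComT Y)) (CF (ComS Y)) (Law Y)
      (Fun f) (Lax f) (Colax f))"

abbreviation "mix_P X \<equiv> MF (MonB X)"
abbreviation "mix_Q X \<equiv> CF (ComC X)"
abbreviation "dist_P X \<equiv> CF (ComT X)"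
abbreviation "dist_Q X \<equiv> CF (ComS X)"

lemma mix_cells0_D:
  assumes "X \<in> mix_cells0"
  shows "monad (Cat X) (MonB X)" "comonad (Cat X) (ComC X)"
    "nat_trans (Cat X) (Cat X) (mix_P X \<odot>\<^bsub>Cat X\<^esub> mix_Q X) (mix_Q X \<odot>\<^bsub>Cat X\<^esub> mix_P X) (Law X)"
    "cat_functor (Cat X) (Cat X) (mix_P X)" "cat_functor (Cat X) (Cat X) (mix_Q X)"
  using assms by (auto simp: mix_cells0_def mixed_dist_law_def Let_def monad_functor comonad_functor)

lemma dist_cells0_D:
  assumes "X \<in> dist_cells0"
  shows "comonad (Cat X) (ComT X)" "comonad (Cat X) (ComS X)"
    "nat_trans (Cat X) (Cat X) (dist_P X \<odot>\<^bsub>Cat X\<^esub> dist_Q X) (dist_Q X \<odot>\<^bsub>Cat X\<^esub> dist_P X) (Law X)"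
    "cat_functor (Cat X) (Cat X) (dist_P X)" "cat_functor (Cat X) (Cat X) (dist_Q X)"
  using assms by (auto simp: dist_cells0_def comonad_dist_law_def Let_def comonad_functor)

text \<open>The endofunctors in \<open>law_mor\<close> come from the 0-cells, and naturality of the
  two transformations is part of being a lax or colax morphism.\<close>

lemma mix_cells1_eq: "mix_cells1 = law_cells1 mix_cells0 mix_P mix_Q mix_mor"
  by (auto simp: mix_cells1_def law_cells1_def mix_mor_def Let_def law_mor_def mix_cells0_D
      lax_monad_mor_iff colax_comonad_mor_iff)

lemma dist_cells1_eq: "dist_cells1 = law_cells1 dist_cells0 dist_P dist_Q dist_mor"
  by (auto simp: dist_cells1_def law_cells1_def dist_mor_def Let_def law_mor_def dist_cells0_D
      lax_comonad_mor_iff colax_comonad_mor_iff)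

lemma law_cell_iff:
  assumes "law_mor A P Q D P' Q' \<Sigma> \<sigma> \<gamma>" "law_mor A P Q D P' Q' \<Sigma>' \<sigma>' \<gamma>'"
  shows "law_cell A P Q D P' Q' \<Sigma> \<sigma> \<gamma> \<Sigma>' \<sigma>' \<gamma>' \<alpha> \<longleftrightarrow> nat_trans A D \<Sigma> \<Sigma>' \<alpha> \<and>
    \<sigma>' \<bullet>\<^bsub>A,D\<^esub> (P' \<rhd>\<^bsub>A\<^esub> \<alpha>) = (\<alpha> \<lhd>\<^bsub>A\<^esub> P) \<bullet>\<^bsub>A,D\<^esub> \<sigma> \<and>
    \<gamma>' \<bullet>\<^bsub>A,D\<^esub> (\<alpha> \<lhd>\<^bsub>A\<^esub> Q) = (Q' \<rhd>\<^bsub>A\<^esub> \<alpha>) \<bullet>\<^bsub>A,D\<^esub> \<gamma>"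
  using assms by (simp add: law_cell_def law_cell_axioms_def transformation_eq_iff[of _ A] Ball_def)

lemma mix_cells2_eq: "(mix_cells2 :: ('o, 'a) mix2 set) = law_cells2 mix_cells0 mix_P mix_Q mix_mor"
proof -
  have "\<alpha> \<in> mix_cells2 \<longleftrightarrow> \<alpha> \<in> law_cells2 mix_cells0 mix_P mix_Q mix_mor" for \<alpha> :: "('o, 'a) mix2"
    unfolding mix_cells2_def law_cells2_def mix_cells1_eq Let_def mem_Collect_eq
    \<comment> \<open>\<open>conj_cong\<close> makes the memberships of both 1-cells available where
      \<open>law_cell_iff\<close> asks for \<open>law_mor\<close>.\<close>
    by (intro conj_cong refl law_cell_iff[symmetric]) (simp_all add: law_cells1_def)
  then show ?thesis by blast
qed

lemma dist_cells2_eq: "(dist_cells2 :: ('o, 'a) dist2 set) = law_cells2 dist_cells0 dist_P dist_Q dist_mor"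
proof -
  have "\<alpha> \<in> dist_cells2 \<longleftrightarrow> \<alpha> \<in> law_cells2 dist_cells0 dist_P dist_Q dist_mor" for \<alpha> :: "('o, 'a) dist2"
    unfolding dist_cells2_def law_cells2_def dist_cells1_eq Let_def mem_Collect_eq
    by (intro conj_cong refl law_cell_iff[symmetric]) (simp_all add: law_cells1_def)
  then show ?thesis by blast
qed

lemma Mix_eq: "Mix = law_two_cat mix_cells0 mix_P mix_Q mix_mor"
proof -
  have "mix_id1 = law_id1 mix_P mix_Q"
    by (simp add: fun_eq_iff mix_id1_def law_id1_def)
  then show ?thesis
    by (simp add: Mix_def law_two_cat_def mix_cells1_eq mix_cells2_eq)
qed

lemma Dist_eq: "Dist = law_two_cat dist_cells0 dist_P dist_Q dist_mor"
proof -
  have "dist_id1 = law_id1 dist_P dist_Q"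
    by (simp add: fun_eq_iff dist_id1_def law_id1_def)
  then show ?thesis
    by (simp add: Dist_def law_two_cat_def dist_cells1_eq dist_cells2_eq)
qed

lemma law_structure_mix:
  "law_structure (mix_cells0 :: ('o, 'a) mix0 set) mix_P mix_Q mix_mor"
proof (rule law_structure.intro)
  fix X :: "('o, 'a) mix0" assume "X \<in> mix_cells0"
  then show "mix_mor (law_id1 mix_P mix_Q X)"
    by (simp add: mix_mor_def mix_cells0_D lax_monad_mor_id colax_comonad_mor_id yang_baxter_id)
next
  fix f g :: "('o, 'a) mix1"
  assume f: "f \<in> law_cells1 mix_cells0 mix_P mix_Q mix_mor"
    and g: "g \<in> law_cells1 mix_cells0 mix_P mix_Q mix_mor" and t: "Tgt f = Src g"
  interpret law_mor_pair "Cat (Src f)" "mix_P (Src f)" "mix_Q (Src f)"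
      "Cat (Src g)" "mix_P (Src g)" "mix_Q (Src g)" "Fun f" "Lax f" "Colax f"
      "Cat (Tgt g)" "mix_P (Tgt g)" "mix_Q (Tgt g)" "Fun g" "Lax g" "Colax g"
    using f g t by (simp add: law_cells1_def law_mor_pair_def)
  have Z: "Src f \<in> mix_cells0" "Src g \<in> mix_cells0" "Tgt g \<in> mix_cells0"
    using f g by (simp_all add: law_cells1_def)
  \<comment> \<open>In groups of three, one fact for each 0-cell: the monads, the comonads, the
    laws.\<close>
  note D = Z[THEN mix_cells0_D(1)] Z[THEN mix_cells0_D(2)] Z[THEN mix_cells0_D(3)]
  show "mix_mor (cell_comp1 g f)"
    using f g t lax_monad_mor_comp[OF D(1-3) refl refl refl]
      colax_comonad_mor_comp[OF D(4-6) refl refl refl] yang_baxter_comp[OF D(7-9)]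
    by (simp add: law_cells1_def mix_mor_def Let_def)
qed (simp_all add: mix_cells0_D)

interpretation mix: law_structure mix_cells0 mix_P mix_Q mix_mor
  by (rule law_structure_mix)

lemma law_structure_dist:
  "law_structure (dist_cells0 :: ('o, 'a) dist0 set) dist_P dist_Q dist_mor"
proof (rule law_structure.intro)
  fix X :: "('o, 'a) dist0" assume "X \<in> dist_cells0"
  then show "dist_mor (law_id1 dist_P dist_Q X)"
    by (simp add: dist_mor_def dist_cells0_D lax_comonad_mor_id colax_comonad_mor_id yang_baxter_id)
next
  fix f g :: "('o, 'a) dist1"
  assume f: "f \<in> law_cells1 dist_cells0 dist_P dist_Q dist_mor"
    and g: "g \<in> law_cells1 dist_cells0 dist_P dist_Q dist_mor" and t: "Tgt f = Src g"
  interpret law_mor_pair "Cat (Src f)" "dist_P (Src f)" "dist_Q (Src f)"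
      "Cat (Src g)" "dist_P (Src g)" "dist_Q (Src g)" "Fun f" "Lax f" "Colax f"
      "Cat (Tgt g)" "dist_P (Tgt g)" "dist_Q (Tgt g)" "Fun g" "Lax g" "Colax g"
    using f g t by (simp add: law_cells1_def law_mor_pair_def)
  have Z: "Src f \<in> dist_cells0" "Src g \<in> dist_cells0" "Tgt g \<in> dist_cells0"
    using f g by (simp_all add: law_cells1_def)
  note D = Z[THEN dist_cells0_D(1)] Z[THEN dist_cells0_D(2)] Z[THEN dist_cells0_D(3)]
  show "dist_mor (cell_comp1 g f)"
    using f g t lax_comonad_mor_comp[OF D(1-3) refl refl refl]
      colax_comonad_mor_comp[OF D(4-6) refl refl refl] yang_baxter_comp[OF D(7-9)]
    by (simp add: law_cells1_def dist_mor_def Let_def)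
qed (simp_all add: dist_cells0_D)

interpretation dist: law_structure dist_cells0 dist_P dist_Q dist_mor
  by (rule law_structure_dist)

lemma two_category_Mix: "two_category Mix"
  unfolding Mix_eq by (rule mix.two_category_law_two_cat)

lemma two_category_Dist: "two_category Dist"
  unfolding Dist_eq by (rule dist.two_category_law_two_cat)

section \<open>Lifting to Eilenberg-Moore categories\<close>

locale em =
  \<eta>: nat_trans A A "idF A" "MF M" "unit M" + \<mu>: nat_trans A A "MF M \<odot>\<^bsub>A\<^esub> MF M" "MF M" "mult M"
  for A :: "('o, 'a) cat" and M :: "('o, 'a) mnd" +
  assumes mult_assoc: "X \<in> Obj A \<Longrightarrow>
      Comp A (mult M X) (FArr (MF M) (mult M X)) = Comp A (mult M X) (mult M (FObj (MF M) X))"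
    and mult_unit_right: "X \<in> Obj A \<Longrightarrow>
      Comp A (mult M X) (FArr (MF M) (unit M X)) = Id A (FObj (MF M) X)"
    and mult_unit_left: "X \<in> Obj A \<Longrightarrow>
      Comp A (mult M X) (unit M (FObj (MF M) X)) = Id A (FObj (MF M) X)"

lemma monad_em: "monad A M \<Longrightarrow> em A M"
  by (simp add: monad_def em_def em_axioms_def Let_def transformation_eq_iff[of _ A])

lemma algebras_eq: "algebras A M = Obj (EM A M)"
  by (simp add: EM_def)

lemma EM_simps [simp]:
  "Dom (EM A M) (P, f, Q) = P" "Cod (EM A M) (P, f, Q) = Q"
  "Id (EM A M) P = (P, Id A (fst P), P)"
  "Comp (EM A M) (Q', g, R) (P, f, Q) = (P, Comp A g f, R)"
  by (simp_all add: EM_def)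

text \<open>Phrased with projections, because algebras mostly occur as variables or as values of
  functors and not as literal pairs.\<close>

lemma EM_Obj_iff: "P \<in> Obj (EM A M) \<longleftrightarrow> fst P \<in> Obj A \<and> snd P \<in> Arr A \<and>
    Dom A (snd P) = FObj (MF M) (fst P) \<and> Cod A (snd P) = fst P \<and>
    Comp A (snd P) (unit M (fst P)) = Id A (fst P) \<and>
    Comp A (snd P) (mult M (fst P)) = Comp A (snd P) (FArr (MF M) (snd P))"
  by (cases P) (simp add: EM_def algebras_def)

lemma EM_Arr_iff: "(P, f, Q) \<in> Arr (EM A M) \<longleftrightarrow> P \<in> Obj (EM A M) \<and> Q \<in> Obj (EM A M) \<and>
    f \<in> Arr A \<and> Dom A f = fst P \<and> Cod A f = fst Q \<and> Comp A f (snd P) = Comp A (snd Q) (FArr (MF M) f)"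
  by (cases P; cases Q) (auto simp: EM_def)

lemma EM_Arr_cases:
  assumes "x \<in> Arr (EM A M)"
  obtains P f Q where "x = (P, f, Q)" "P \<in> Obj (EM A M)" "Q \<in> Obj (EM A M)"
    "f \<in> Arr A" "Dom A f = fst P" "Cod A f = fst Q" "Comp A f (snd P) = Comp A (snd Q) (FArr (MF M) f)"
  using assms by (cases x) (auto simp: EM_Arr_iff)

context em
begin

lemma algebra_boundary [simp]:
  assumes "P \<in> Obj (EM A M)"
  shows "fst P \<in> Obj A" "snd P \<in> Arr A" "Dom A (snd P) = FObj (MF M) (fst P)" "Cod A (snd P) = fst P"
  using assms EM_Obj_iff by blast+

lemma algebra_unit: "P \<in> Obj (EM A M) \<Longrightarrow> Comp A (snd P) (unit M (fst P)) = Id A (fst P)"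
  using EM_Obj_iff by blast

lemma algebra_mult: "P \<in> Obj (EM A M) \<Longrightarrow>
    Comp A (snd P) (mult M (fst P)) = Comp A (snd P) (FArr (MF M) (snd P))"
  using EM_Obj_iff by blast

lemma category_EM: "category (EM A M)"
proof (rule categoryI)
  fix x y assume "x \<in> Arr (EM A M)" "y \<in> Arr (EM A M)" and e: "Cod (EM A M) x = Dom (EM A M) y"
  then obtain P f Q g R where x: "x = (P, f, Q)" "P \<in> Obj (EM A M)" "Q \<in> Obj (EM A M)"
      "f \<in> Arr A" "Dom A f = fst P" "Cod A f = fst Q" "Comp A f (snd P) = Comp A (snd Q) (FArr (MF M) f)"
    and y: "y = (Q, g, R)" "R \<in> Obj (EM A M)"
      "g \<in> Arr A" "Dom A g = fst Q" "Cod A g = fst R" "Comp A g (snd Q) = Comp A (snd R) (FArr (MF M) g)"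
    by (elim EM_Arr_cases) simp
  have "Comp A g (Comp A (snd Q) (FArr (MF M) f)) = Comp A (snd R) (Comp A (FArr (MF M) g) (FArr (MF M) f))"
    by (rule \<eta>.F.S.Comp_eq_reassoc) (use x y in simp_all)
  with x y show "Comp (EM A M) y x \<in> Arr (EM A M) \<and> Dom (EM A M) (Comp (EM A M) y x) = Dom (EM A M) x \<and>
      Cod (EM A M) (Comp (EM A M) y x) = Cod (EM A M) y"
    by (simp add: EM_Arr_iff)
next
  fix x y z assume "x \<in> Arr (EM A M)" "y \<in> Arr (EM A M)" "z \<in> Arr (EM A M)"
    and "Cod (EM A M) x = Dom (EM A M) y" "Cod (EM A M) y = Dom (EM A M) z"
  then obtain P f Q g R h K where "x = (P, f, Q)" "y = (Q, g, R)" "z = (R, h, K)"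
      "f \<in> Arr A" "g \<in> Arr A" "h \<in> Arr A" "Cod A f = Dom A g" "Cod A g = Dom A h"
    by (elim EM_Arr_cases) simp
  then show "Comp (EM A M) z (Comp (EM A M) y x) = Comp (EM A M) (Comp (EM A M) z y) x"
    by simp
next
  fix x assume x: "x \<in> Arr (EM A M)"
  show "Dom (EM A M) x \<in> Obj (EM A M) \<and> Cod (EM A M) x \<in> Obj (EM A M)"
    "Comp (EM A M) x (Id (EM A M) (Dom (EM A M) x)) = x"
    "Comp (EM A M) (Id (EM A M) (Cod (EM A M) x)) x = x"
    by (rule EM_Arr_cases[OF x]; simp)+
qed (simp add: EM_Arr_iff)

lemma free_algebra: "X \<in> Obj A \<Longrightarrow> (FObj (MF M) X, mult M X) \<in> Obj (EM A M)"
  by (subst EM_Obj_iff) (simp add: mult_unit_left mult_assoc)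

end

text \<open>\<open>\<Phi>\<close> lies over \<open>\<Sigma>\<close>: it satisfies \<open>U\<Phi> = \<Sigma>U\<close> for the forgetful functors.\<close>

locale em_over =
  S: em A M + T: em D M' + \<Phi>: cat_functor "EM A M" "EM D M'" \<Phi> + \<Sigma>: cat_functor A D \<Sigma>
  for A :: "('o, 'a) cat" and M and D :: "('p, 'b) cat" and M' \<Phi> \<Sigma> +
  assumes over_Obj [simp]: "P \<in> Obj (EM A M) \<Longrightarrow> fst (FObj \<Phi> P) = FObj \<Sigma> (fst P)"
    and over_Arr [simp]: "(P, f, Q) \<in> Arr (EM A M) \<Longrightarrow> FArr \<Phi> (P, f, Q) = (FObj \<Phi> P, FArr \<Sigma> f, FObj \<Phi> Q)"

text \<open>Functoriality is inherited from \<open>\<Sigma>\<close>, since an arrow of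
  \<open>EM D M'\<close> is determined by its boundary and its underlying arrow. What remains is
  that objects go to algebras and that each \<open>\<Sigma>f\<close> is a morphism between
  them.\<close>

lemma em_overI:
  assumes "em A M" "em D M'" "cat_functor A D \<Sigma>"
    and "FObj \<Phi> \<in> extensional (Obj (EM A M))" "FArr \<Phi> \<in> extensional (Arr (EM A M))"
    and Obj: "\<And>P. P \<in> Obj (EM A M) \<Longrightarrow> FObj \<Phi> P \<in> Obj (EM D M') \<and> fst (FObj \<Phi> P) = FObj \<Sigma> (fst P)"
    and Arr: "\<And>P f Q. (P, f, Q) \<in> Arr (EM A M) \<Longrightarrow> FArr \<Phi> (P, f, Q) = (FObj \<Phi> P, FArr \<Sigma> f, FObj \<Phi> Q) \<and>
      Comp D (FArr \<Sigma> f) (snd (FObj \<Phi> P)) = Comp D (snd (FObj \<Phi> Q)) (FArr (MF M') (FArr \<Sigma> f))"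
  shows "em_over A M D M' \<Phi> \<Sigma>"
proof -
  interpret S: em A M by fact
  interpret T: em D M' by fact
  interpret \<Sigma>: cat_functor A D \<Sigma> by fact
  interpret E: category "EM A M" by (rule S.category_EM)
  have "cat_functor (EM A M) (EM D M') \<Phi>"
  proof (rule cat_functorI)
    fix x y assume x: "x \<in> Arr (EM A M)" and y: "y \<in> Arr (EM A M)" and e: "Cod (EM A M) x = Dom (EM A M) y"
    obtain P f Q g R where p: "x = (P, f, Q)" "y = (Q, g, R)" "f \<in> Arr A" "g \<in> Arr A" "Cod A f = Dom A g"
      by (rule EM_Arr_cases[OF x], rule EM_Arr_cases[OF y]) (use e in auto)
    with E.Comp_simps(1)[OF x y e] x y have "(P, Comp A g f, R) \<in> Arr (EM A M)" by simp
    with p x y show "FArr \<Phi> (Comp (EM A M) y x) = Comp (EM D M') (FArr \<Phi> y) (FArr \<Phi> x)"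
      by (simp add: Arr)
  next
    fix P assume P: "P \<in> Obj (EM A M)"
    then have "(P, Id A (fst P), P) \<in> Arr (EM A M)" using E.Id_simps(1) by simp
    with P show "FArr \<Phi> (Id (EM A M) P) = Id (EM D M') (FObj \<Phi> P)"
      by (simp add: Arr Obj)
  next
    fix x assume x: "x \<in> Arr (EM A M)"
    show "FArr \<Phi> x \<in> Arr (EM D M') \<and> Dom (EM D M') (FArr \<Phi> x) = FObj \<Phi> (Dom (EM A M) x) \<and>
        Cod (EM D M') (FArr \<Phi> x) = FObj \<Phi> (Cod (EM A M) x)"
      by (rule EM_Arr_cases[OF x]) (use Arr x in \<open>simp add: EM_Arr_iff Obj\<close>)
  qed (use assms S.category_EM T.category_EM in auto)
  then interpret \<Phi>: cat_functor "EM A M" "EM D M'" \<Phi> .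
  show ?thesis by unfold_locales (simp_all add: Obj Arr)
qed

lemma em_over_idF:
  assumes "em A M"
  shows "em_over A M A M (idF (EM A M)) (idF A)"
proof -
  interpret em A M by fact
  show ?thesis
    by (rule em_overI) (auto simp: em_axioms EM_Arr_iff cat_functor_idF \<eta>.F.S.category_axioms)
qed

lemma em_over_compF:
  assumes "em_over A M B N \<Phi> \<Sigma>" "em_over B N D K \<Psi> \<Sigma>'"
  shows "em_over A M D K (\<Psi> \<odot>\<^bsub>EM A M\<^esub> \<Phi>) (\<Sigma>' \<odot>\<^bsub>A\<^esub> \<Sigma>)"
proof -
  interpret f: em_over A M B N \<Phi> \<Sigma> by fact
  interpret g: em_over B N D K \<Psi> \<Sigma>' by fact
  interpret h: cat_functor "EM A M" "EM D K" "\<Psi> \<odot>\<^bsub>EM A M\<^esub> \<Phi>"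
    by (rule cat_functor_compF) (rule f.\<Phi>.cat_functor_axioms g.\<Phi>.cat_functor_axioms)+
  interpret k: cat_functor A D "\<Sigma>' \<odot>\<^bsub>A\<^esub> \<Sigma>"
    by (rule cat_functor_compF) (rule f.\<Sigma>.cat_functor_axioms g.\<Sigma>.cat_functor_axioms)+
  show ?thesis
  proof unfold_locales
    fix P u Q assume a: "(P, u, Q) \<in> Arr (EM A M)"
    \<comment> \<open>\<open>over_Arr\<close> evaluates \<open>\<Psi>\<close> only on triples known
      to be arrows of \<open>EM B N\<close>.\<close>
    then have "(FObj \<Phi> P, FArr \<Sigma> u, FObj \<Phi> Q) \<in> Arr (EM B N)"
      using f.\<Phi>.FArr_simps(1)[OF a] by simp
    with a show "FArr (\<Psi> \<odot>\<^bsub>EM A M\<^esub> \<Phi>) (P, u, Q) =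
        (FObj (\<Psi> \<odot>\<^bsub>EM A M\<^esub> \<Phi>) P, FArr (\<Sigma>' \<odot>\<^bsub>A\<^esub> \<Sigma>) u, FObj (\<Psi> \<odot>\<^bsub>EM A M\<^esub> \<Phi>) Q)"
      by (auto simp: EM_Arr_iff[of P])
  qed simp
qed

section \<open>Calculus of lifted transformations\<close>

lemma lift_nat_apply [simp]:
  "P \<in> Obj (EM A M) \<Longrightarrow> lift_nat A M F G \<tau> P = (FObj F P, \<tau> (fst P), FObj G P)"
  by (simp add: lift_nat_def)

lemma lift_nat_ext [simp]: "lift_nat A M F G \<tau> \<in> extensional (Obj (EM A M))"
  by (simp add: lift_nat_def)

text \<open>On underlying arrows naturality is that of \<open>\<tau>\<close>; the new content is
  \<open>alg\<close>, that the components are morphisms of algebras.\<close>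

lemma nat_trans_lift_nat:
  assumes "em_over A M D M' \<Phi> \<Sigma>" "em_over A M D M' \<Psi> \<Sigma>'" "nat_trans A D \<Sigma> \<Sigma>' \<tau>"
    and alg: "\<And>P. P \<in> Obj (EM A M) \<Longrightarrow>
      Comp D (\<tau> (fst P)) (snd (FObj \<Phi> P)) = Comp D (snd (FObj \<Psi> P)) (FArr (MF M') (\<tau> (fst P)))"
  shows "nat_trans (EM A M) (EM D M') \<Phi> \<Psi> (lift_nat A M \<Phi> \<Psi> \<tau>)"
proof -
  interpret f: em_over A M D M' \<Phi> \<Sigma> by fact
  interpret g: em_over A M D M' \<Psi> \<Sigma>' by fact
  interpret nat_trans A D \<Sigma> \<Sigma>' \<tau> by fact
  show ?thesis
  proof (rule nat_transI)
    fix x assume x: "x \<in> Arr (EM A M)"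
    show "Comp (EM D M') (lift_nat A M \<Phi> \<Psi> \<tau> (Cod (EM A M) x)) (FArr \<Phi> x) =
        Comp (EM D M') (FArr \<Psi> x) (lift_nat A M \<Phi> \<Psi> \<tau> (Dom (EM A M) x))"
      by (rule EM_Arr_cases[OF x]) (use x in \<open>simp add: natural\<close>)
  qed (simp_all add: f.\<Phi>.cat_functor_axioms g.\<Phi>.cat_functor_axioms EM_Arr_iff alg)
qed

lemma idN_eq_lift_nat:
  assumes "em_over A M D M' \<Phi> \<Sigma>"
  shows "idN (EM A M) (EM D M') \<Phi> = lift_nat A M \<Phi> \<Phi> (idN A D \<Sigma>)"
proof -
  interpret em_over A M D M' \<Phi> \<Sigma> by fact
  show ?thesis by (simp add: transformation_eq_iff[of _ "EM A M"])
qed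

lemma compN_lift_nat:
  assumes "em A M"
  shows "lift_nat A M G H \<tau> \<bullet>\<^bsub>EM A M,EM D M'\<^esub> lift_nat A M F G \<sigma> = lift_nat A M F H (\<tau> \<bullet>\<^bsub>A,D\<^esub> \<sigma>)"
proof -
  interpret em A M by fact
  show ?thesis by (simp add: transformation_eq_iff[of _ "EM A M"])
qed

text \<open>The first premise supplies that the components are arrows of \<open>EM B N\<close>, the
  arguments at which \<open>over_Arr\<close> determines \<open>\<Phi>\<close>.\<close>

lemma whiskL_lift_nat:
  assumes "nat_trans (EM A M) (EM B N) F G (lift_nat A M F G \<tau>)" "em_over B N D K \<Phi> \<Sigma>" "em A M"
  shows "\<Phi> \<rhd>\<^bsub>EM A M\<^esub> lift_nat A M F G \<tau> =
    lift_nat A M (\<Phi> \<odot>\<^bsub>EM A M\<^esub> F) (\<Phi> \<odot>\<^bsub>EM A M\<^esub> G) (\<Sigma> \<rhd>\<^bsub>A\<^esub> \<tau>)"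
proof -
  interpret t: nat_trans "EM A M" "EM B N" F G "lift_nat A M F G \<tau>" by fact
  interpret em_over B N D K \<Phi> \<Sigma> by fact
  interpret em A M by fact
  have "(FObj F P, \<tau> (fst P), FObj G P) \<in> Arr (EM B N)" if "P \<in> Obj (EM A M)" for P
    using t.comp_simps(1)[OF that] that by simp
  then show ?thesis by (simp add: transformation_eq_iff[of _ "EM A M"])
qed

lemma whiskR_lift_nat:
  assumes "em_over A M B N \<Phi> \<Sigma>"
  shows "lift_nat B N F G \<tau> \<lhd>\<^bsub>EM A M\<^esub> \<Phi> =
    lift_nat A M (F \<odot>\<^bsub>EM A M\<^esub> \<Phi>) (G \<odot>\<^bsub>EM A M\<^esub> \<Phi>) (\<tau> \<lhd>\<^bsub>A\<^esub> \<Sigma>)"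
proof -
  interpret em_over A M B N \<Phi> \<Sigma> by fact
  show ?thesis by (simp add: transformation_eq_iff[of _ "EM A M"])
qed

lemma lift_fun_simps [simp]:
  "P \<in> Obj (EM A M) \<Longrightarrow>
    FObj (lift_fun A M D \<Sigma> \<sigma>) P = (FObj \<Sigma> (fst P), Comp D (FArr \<Sigma> (snd P)) (\<sigma> (fst P)))"
  "(P, f, Q) \<in> Arr (EM A M) \<Longrightarrow> FArr (lift_fun A M D \<Sigma> \<sigma>) (P, f, Q) =
    (FObj (lift_fun A M D \<Sigma> \<sigma>) P, FArr \<Sigma> f, FObj (lift_fun A M D \<Sigma> \<sigma>) Q)"
  by (auto simp: lift_fun_def Let_def EM_Arr_iff split: prod.splits)

lemma lift_fun_ext [simp]:
  "FObj (lift_fun A M D \<Sigma> \<sigma>) \<in> extensional (Obj (EM A M))"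
  "FArr (lift_fun A M D \<Sigma> \<sigma>) \<in> extensional (Arr (EM A M))"
  by (simp_all add: lift_fun_def Let_def)

text \<open>The unit condition on \<open>\<sigma>\<close> gives the unit law of the lifted algebra.
  The multiplication condition gives its associativity law, together with that of the given algebra
  and naturality of \<open>\<sigma>\<close> at the structure map. Naturality at \<open>f\<close>
  makes \<open>\<Sigma>f\<close> a morphism.\<close>

lemma em_over_lift_fun:
  assumes "em A M" "em D M'" "cat_functor A D \<Sigma>" "lax_monad_mor A M D M' \<Sigma> \<sigma>"
  shows "em_over A M D M' (lift_fun A M D \<Sigma> \<sigma>) \<Sigma>"
proof -
  interpret S: em A M by fact
  interpret T: em D M' by fact
  interpret \<Sigma>: cat_functor A D \<Sigma> by fact
  interpret \<sigma>: nat_trans A D "MF M' \<odot>\<^bsub>A\<^esub> \<Sigma>" "\<Sigma> \<odot>\<^bsub>A\<^esub> MF M" \<sigma>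
    using assms(4) by (simp add: lax_monad_mor_iff)
  have nat: "Comp D (\<sigma> Y) (FArr (MF M') (FArr \<Sigma> f)) = Comp D (FArr \<Sigma> (FArr (MF M) f)) (\<sigma> (Dom A f))"
    if "f \<in> Arr A" "Cod A f = Y" for f Y
    using \<sigma>.natural[of f Y] that by simp
  show ?thesis
  proof (rule em_overI)
    fix P assume P [simp]: "P \<in> Obj (EM A M)"
    let ?X = "fst P" and ?\<alpha> = "snd P"
    have "Comp D (\<sigma> ?X) (unit M' (FObj \<Sigma> ?X)) = FArr \<Sigma> (unit M ?X)"
      using assms(4) by (simp add: lax_monad_mor_iff)
    moreover have "Comp D (FArr \<Sigma> ?\<alpha>) (FArr \<Sigma> (unit M ?X)) = Id D (FObj \<Sigma> ?X)"
      using \<Sigma>.FArr_Comp_Arr[of "unit M ?X" ?\<alpha>] S.algebra_unit[of P] by simp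
    moreover
    have "Comp D (\<sigma> ?X) (mult M' (FObj \<Sigma> ?X)) =
        Comp D (FArr \<Sigma> (mult M ?X)) (Comp D (\<sigma> (FObj (MF M) ?X)) (FArr (MF M') (\<sigma> ?X)))"
      using assms(4) by (simp add: lax_monad_mor_iff)
    moreover note e = \<Sigma>.FArr_eq_reassoc[OF S.algebra_mult[OF P]] nat[of ?\<alpha> ?X]
    note e' = e[THEN T.\<eta>.F.S.Comp_eq_reassoc]
    ultimately have "Comp D (Comp D (FArr \<Sigma> ?\<alpha>) (\<sigma> ?X)) (unit M' (FObj \<Sigma> ?X)) = Id D (FObj \<Sigma> ?X) \<and>
      Comp D (Comp D (FArr \<Sigma> ?\<alpha>) (\<sigma> ?X)) (mult M' (FObj \<Sigma> ?X)) =
        Comp D (Comp D (FArr \<Sigma> ?\<alpha>) (\<sigma> ?X)) (FArr (MF M') (Comp D (FArr \<Sigma> ?\<alpha>) (\<sigma> ?X)))"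
      by (simp add: e[simplified] e'[simplified])
    then show "FObj (lift_fun A M D \<Sigma> \<sigma>) P \<in> Obj (EM D M') \<and> fst (FObj (lift_fun A M D \<Sigma> \<sigma>) P) = FObj \<Sigma> ?X"
      by (subst EM_Obj_iff) simp
  next
    fix P f Q assume x: "(P, f, Q) \<in> Arr (EM A M)"
    then have [simp]: "P \<in> Obj (EM A M)" "Q \<in> Obj (EM A M)" "f \<in> Arr A" "Dom A f = fst P" "Cod A f = fst Q"
      and e: "Comp A f (snd P) = Comp A (snd Q) (FArr (MF M) f)"
      by (simp_all add: EM_Arr_iff)
    note e1 = \<Sigma>.FArr_eq_reassoc[OF e] nat[of f "fst Q"]
    note e' = e1[THEN T.\<eta>.F.S.Comp_eq_reassoc]
    show "FArr (lift_fun A M D \<Sigma> \<sigma>) (P, f, Q) =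
        (FObj (lift_fun A M D \<Sigma> \<sigma>) P, FArr \<Sigma> f, FObj (lift_fun A M D \<Sigma> \<sigma>) Q) \<and>
      Comp D (FArr \<Sigma> f) (snd (FObj (lift_fun A M D \<Sigma> \<sigma>) P)) =
        Comp D (snd (FObj (lift_fun A M D \<Sigma> \<sigma>) Q)) (FArr (MF M') (FArr \<Sigma> f))"
      using x by (simp add: e1[simplified] e'[simplified])
  qed (simp_all add: assms)
qed

section \<open>The comonad \<open>FU\<close> of the free-forgetful adjunction\<close>

abbreviation "free_forget A M \<equiv> CF (em_comonad A M)"

context em
begin

lemma em_forget_simps:
  "P \<in> Obj (EM A M) \<Longrightarrow> FObj (em_forget A M) P = fst P"
  "(P, f, Q) \<in> Arr (EM A M) \<Longrightarrow> FArr (em_forget A M) (P, f, Q) = f"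
  by (simp_all add: em_forget_def algebras_eq)

lemma free_forget_simps [simp]:
  "P \<in> Obj (EM A M) \<Longrightarrow> FObj (free_forget A M) P = (FObj (MF M) (fst P), mult M (fst P))"
  "(P, f, Q) \<in> Arr (EM A M) \<Longrightarrow> FArr (free_forget A M) (P, f, Q) =
    (FObj (free_forget A M) P, FArr (MF M) f, FObj (free_forget A M) Q)"
  "FObj (free_forget A M) \<in> extensional (Obj (EM A M))"
  "FArr (free_forget A M) \<in> extensional (Arr (EM A M))"
  by (auto simp: em_comonad_def Let_def em_free_def em_forget_simps EM_Arr_iff)

lemma em_counit_simps [simp]:
  "P \<in> Obj (EM A M) \<Longrightarrow> counit (em_comonad A M) P = (FObj (free_forget A M) P, snd P, P)"
  "counit (em_comonad A M) \<in> extensional (Obj (EM A M))"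
  by (auto simp: em_comonad_def Let_def em_free_def em_forget_simps split: prod.splits)

text \<open>\<open>FU\<close> is not presented as a \<open>lift_fun\<close>, as its structure maps
  are those of free algebras. It still lies over the functor of the monad, and naturality of
  \<open>\<mu>\<close> makes the image of \<open>f\<close> a morphism of free algebras.\<close>

lemma em_over_free_forget: "em_over A M A M (free_forget A M) (MF M)"
proof (rule em_overI)
  fix P f Q assume x: "(P, f, Q) \<in> Arr (EM A M)"
  then have [simp]: "P \<in> Obj (EM A M)" "Q \<in> Obj (EM A M)" "f \<in> Arr A" "Dom A f = fst P" "Cod A f = fst Q"
    by (simp_all add: EM_Arr_iff)
  have "Comp A (FArr (MF M) f) (mult M (fst P)) = Comp A (mult M (fst Q)) (FArr (MF M) (FArr (MF M) f))"
    using \<mu>.natural[of f "fst Q"] by simp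
  then show "FArr (free_forget A M) (P, f, Q) =
      (FObj (free_forget A M) P, FArr (MF M) f, FObj (free_forget A M) Q) \<and>
    Comp A (FArr (MF M) f) (snd (FObj (free_forget A M) P)) =
      Comp A (snd (FObj (free_forget A M) Q)) (FArr (MF M) (FArr (MF M) f))"
    using x by simp
qed (simp_all add: em_axioms \<eta>.G.cat_functor_axioms free_algebra)

interpretation ff: em_over A M A M "free_forget A M" "MF M"
  by (rule em_over_free_forget)

text \<open>In contrast to the counit, the component of \<open>F\<eta>U\<close> depends only on the
  underlying object, so the lifting calculus applies to it.\<close>

lemma em_comult_eq: "comult (em_comonad A M) =
    lift_nat A M (free_forget A M) (free_forget A M \<odot>\<^bsub>EM A M\<^esub> free_forget A M) (MF M \<rhd>\<^bsub>A\<^esub> unit M)"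
proof -
  have "comult (em_comonad A M) P = (FObj (free_forget A M) P, FArr (MF M) (unit M (fst P)),
      FObj (free_forget A M) (FObj (free_forget A M) P))" if "P \<in> Obj (EM A M)" for P
    \<comment> \<open>The values of \<open>free_forget\<close> are computed first: it abbreviates a
      field of \<open>em_comonad A M\<close>, so unfolding \<open>em_comonad_def\<close> at once
      would dissolve it too.\<close>
    using that by (simp add: free_algebra) (simp add: em_comonad_def Let_def em_free_def em_forget_simps)
  moreover have "comult (em_comonad A M) \<in> extensional (Obj (EM A M))"
    by (simp add: em_comonad_def Let_def)
  ultimately show ?thesis
    by (simp add: transformation_eq_iff[of _ "EM A M"])
qed

text \<open>That \<open>B\<eta>\<close> is a morphism of free algebras is naturality of
  \<open>\<mu>\<close> at the component of \<open>\<eta>\<close>.\<close>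

lemma nat_trans_em_comult: "nat_trans (EM A M) (EM A M) (free_forget A M)
    (free_forget A M \<odot>\<^bsub>EM A M\<^esub> free_forget A M) (comult (em_comonad A M))"
  unfolding em_comult_eq
proof (rule nat_trans_lift_nat[of _ _ _ _ _ "MF M" _ "MF M \<odot>\<^bsub>A\<^esub> MF M"])
  have "MF M \<odot>\<^bsub>A\<^esub> idF A = MF M" by simp
  with nat_trans_whiskL[OF \<eta>.nat_trans_axioms \<eta>.G.cat_functor_axioms]
  show "nat_trans A A (MF M) (MF M \<odot>\<^bsub>A\<^esub> MF M) (MF M \<rhd>\<^bsub>A\<^esub> unit M)" by simp
  show "Comp A ((MF M \<rhd>\<^bsub>A\<^esub> unit M) (fst P)) (snd (FObj (free_forget A M) P)) =
      Comp A (snd (FObj (free_forget A M \<odot>\<^bsub>EM A M\<^esub> free_forget A M) P))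
        (FArr (MF M) ((MF M \<rhd>\<^bsub>A\<^esub> unit M) (fst P)))" if "P \<in> Obj (EM A M)" for P
    using that \<mu>.natural[of "unit M (fst P)" "FObj (MF M) (fst P)"] by (simp add: free_algebra)
qed (simp_all add: em_over_compF[OF em_over_free_forget em_over_free_forget] em_over_free_forget)

text \<open>The associativity law of an algebra makes its structure map a morphism from the free
  algebra, and naturality is the equation that defines morphisms of algebras.\<close>

lemma nat_trans_em_counit:
  "nat_trans (EM A M) (EM A M) (free_forget A M) (idF (EM A M)) (counit (em_comonad A M))"
proof (rule nat_transI)
  fix x assume x: "x \<in> Arr (EM A M)"
  show "Comp (EM A M) (counit (em_comonad A M) (Cod (EM A M) x)) (FArr (free_forget A M) x) =
      Comp (EM A M) (FArr (idF (EM A M)) x) (counit (em_comonad A M) (Dom (EM A M) x))"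
    by (rule EM_Arr_cases[OF x]) (use x in simp)
qed (simp_all add: ff.\<Phi>.cat_functor_axioms cat_functor_idF category_EM EM_Arr_iff free_algebra
      algebra_mult)

text \<open>Coassociativity is an equation of lifts. The counit laws are checked at an algebra: one
  is the image under \<open>B\<close> of its unit law, the other a unit law of the monad.\<close>

lemma comonad_em_comonad: "comonad (EM A M) (em_comonad A M)"
proof -
  let ?T = "free_forget A M" and ?E = "EM A M"
  have "(?T \<rhd>\<^bsub>?E\<^esub> comult (em_comonad A M)) \<bullet>\<^bsub>?E,?E\<^esub> comult (em_comonad A M) =
      (comult (em_comonad A M) \<lhd>\<^bsub>?E\<^esub> ?T) \<bullet>\<^bsub>?E,?E\<^esub> comult (em_comonad A M)"
  proof -
    \<comment> \<open>Below, both sides are the image under \<open>B\<close> of an equation that is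
      naturality of \<open>\<eta>\<close> at its own component.\<close>
    have "(MF M \<rhd>\<^bsub>A\<^esub> (MF M \<rhd>\<^bsub>A\<^esub> unit M)) \<bullet>\<^bsub>A,A\<^esub> (MF M \<rhd>\<^bsub>A\<^esub> unit M) =
        ((MF M \<rhd>\<^bsub>A\<^esub> unit M) \<lhd>\<^bsub>A\<^esub> MF M) \<bullet>\<^bsub>A,A\<^esub> (MF M \<rhd>\<^bsub>A\<^esub> unit M)"
    proof -
      have "Comp A (FArr (MF M) (FArr (MF M) (unit M X))) (FArr (MF M) (unit M X)) =
          Comp A (FArr (MF M) (unit M (FObj (MF M) X))) (FArr (MF M) (unit M X))" if "X \<in> Obj A" for X
        by (rule \<eta>.G.FArr_eq_reassoc) (use that \<eta>.natural[of "unit M X"] in simp_all)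
      then show ?thesis by (simp add: transformation_eq_iff[of _ A])
    qed
    then show ?thesis
      using whiskL_lift_nat[OF nat_trans_em_comult[unfolded em_comult_eq] em_over_free_forget em_axioms]
      by (simp add: em_comult_eq whiskR_lift_nat[OF em_over_free_forget] compN_lift_nat[OF em_axioms]
        ff.\<Phi>.compF_assoc)
  qed
  moreover have "(?T \<rhd>\<^bsub>?E\<^esub> counit (em_comonad A M)) \<bullet>\<^bsub>?E,?E\<^esub> comult (em_comonad A M) = idN ?E ?E ?T"
  proof -
    \<comment> \<open>A functor can be evaluated on a component of the counit only once that triple
      is known to be an arrow, which is the content of \<open>algebra_mult\<close>.\<close>
    have "FArr ?T (FObj ?T P, snd P, P) = (FObj ?T (FObj ?T P), FArr (MF M) (snd P), FObj ?T P)"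
      if "P \<in> Obj ?E" for P
      using that by (intro free_forget_simps) (simp add: EM_Arr_iff free_algebra algebra_mult)
    moreover have "Comp A (FArr (MF M) (snd P)) (FArr (MF M) (unit M (fst P))) = Id A (FObj (MF M) (fst P))"
      if "P \<in> Obj ?E" for P
      using \<eta>.G.FArr_Comp_Arr[of "unit M (fst P)" "snd P"] that by (simp add: algebra_unit)
    ultimately show ?thesis
      by (simp add: em_comult_eq transformation_eq_iff[of _ ?E] free_algebra)
  qed
  moreover have "(counit (em_comonad A M) \<lhd>\<^bsub>?E\<^esub> ?T) \<bullet>\<^bsub>?E,?E\<^esub> comult (em_comonad A M) = idN ?E ?E ?T"
    by (simp add: em_comult_eq transformation_eq_iff[of _ ?E] free_algebra mult_unit_right)
  ultimately show ?thesis
    by (simp add: comonad_def Let_def nat_trans_em_comult nat_trans_em_counit)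
qed

end

section \<open>The 2-functor\<close>

locale mixed = em A M + C: cat_functor A A "CF W" +
  \<epsilon>: nat_trans A A "CF W" "idF A" "counit W" +
  \<Delta>: nat_trans A A "CF W" "CF W \<odot>\<^bsub>A\<^esub> CF W" "comult W" +
  \<theta>: nat_trans A A "MF M \<odot>\<^bsub>A\<^esub> CF W" "CF W \<odot>\<^bsub>A\<^esub> MF M" \<theta>
  for A :: "('o, 'a) cat" and M and W :: "('o, 'a) cmnd" and \<theta> +
  assumes mixed_law: "mixed_dist_law A M W \<theta>"
begin

abbreviation "T \<equiv> free_forget A M"
abbreviation "S \<equiv> lift_fun A M A (CF W) \<theta>"

lemma comonad_W: "comonad A W"
  using mixed_law by (simp add: mixed_dist_law_def)

text \<open>The axioms relating \<open>\<theta>\<close> to the monad say that \<open>(C, \<theta>)\<close> is itself a lax morphism of monads, so that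
  the lift of \<open>C\<close> is a special case of the lift of a 1-cell.\<close>

lemma law_lax_monad_mor: "lax_monad_mor A M A M (CF W) \<theta>"
  using mixed_law by (simp add: mixed_dist_law_def lax_monad_mor_def Let_def)

lemma em_over_S: "em_over A M A M S (CF W)"
  by (rule em_over_lift_fun) (rule em_axioms C.cat_functor_axioms law_lax_monad_mor)+

sublocale T: em_over A M A M T "MF M"
  by (rule em_over_free_forget)

sublocale S: em_over A M A M S "CF W"
  by (rule em_over_S)

lemma law_unit: "X \<in> Obj A \<Longrightarrow>
    Comp A (\<theta> X) (unit M (FObj (CF W) X)) = FArr (CF W) (unit M X)"
  using mixed_law by (simp add: mixed_dist_law_def Let_def transformation_eq_iff[of _ A])

lemma law_mult: "X \<in> Obj A \<Longrightarrow> Comp A (\<theta> X) (mult M (FObj (CF W) X)) =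
    Comp A (FArr (CF W) (mult M X)) (Comp A (\<theta> (FObj (MF M) X)) (FArr (MF M) (\<theta> X)))"
  using mixed_law by (simp add: mixed_dist_law_def Let_def transformation_eq_iff[of _ A])

lemma law_counit: "X \<in> Obj A \<Longrightarrow>
    Comp A (counit W (FObj (MF M) X)) (\<theta> X) = FArr (MF M) (counit W X)"
  using mixed_law by (simp add: mixed_dist_law_def Let_def transformation_eq_iff[of _ A])

lemma law_comult: "X \<in> Obj A \<Longrightarrow> Comp A (comult W (FObj (MF M) X)) (\<theta> X) =
    Comp A (FArr (CF W) (\<theta> X)) (Comp A (\<theta> (FObj (CF W) X)) (FArr (MF M) (comult W X)))"
  using mixed_law by (simp add: mixed_dist_law_def Let_def transformation_eq_iff[of _ A])

lemma law_natural: "f \<in> Arr A \<Longrightarrow> Cod A f = Y \<Longrightarrow>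
    Comp A (\<theta> Y) (FArr (MF M) (FArr (CF W) f)) = Comp A (FArr (CF W) (FArr (MF M) f)) (\<theta> (Dom A f))"
  using \<theta>.natural[of f Y] by simp

abbreviation "lift_counit \<equiv> lift_nat A M S (idF (EM A M)) (counit W)"
abbreviation "lift_comult \<equiv> lift_nat A M S (S \<odot>\<^bsub>EM A M\<^esub> S) (comult W)"
abbreviation "lift_law \<equiv> lift_nat A M (T \<odot>\<^bsub>EM A M\<^esub> S) (S \<odot>\<^bsub>EM A M\<^esub> T) \<theta>"

text \<open>Naturality of \<open>\<epsilon>\<close> takes it past the image of the structure map,
  after which \<open>law_counit\<close> absorbs \<open>\<theta>\<close>. The comultiplication is
  treated in the same way with \<open>law_comult\<close>.\<close>

lemma nat_trans_lift_counit: "nat_trans (EM A M) (EM A M) S (idF (EM A M)) lift_counit"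
proof (rule nat_trans_lift_nat[OF em_over_S em_over_idF[OF em_axioms] \<epsilon>.nat_trans_axioms])
  fix P assume [simp]: "P \<in> Obj (EM A M)"
  show "Comp A (counit W (fst P)) (snd (FObj S P)) =
      Comp A (snd (FObj (idF (EM A M)) P)) (FArr (MF M) (counit W (fst P)))"
    using \<epsilon>.natural[of "snd P" "fst P", THEN \<eta>.F.S.Comp_eq_reassoc, of "\<theta> (fst P)"]
    by (simp add: law_counit)
qed

lemma nat_trans_lift_comult: "nat_trans (EM A M) (EM A M) S (S \<odot>\<^bsub>EM A M\<^esub> S) lift_comult"
proof (rule nat_trans_lift_nat[OF em_over_S em_over_compF[OF em_over_S em_over_S] \<Delta>.nat_trans_axioms])
  fix P assume [simp]: "P \<in> Obj (EM A M)"
  note e = \<Delta>.natural[of "snd P" "fst P"] law_comult[of "fst P"]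
  note e' = e[THEN \<eta>.F.S.Comp_eq_reassoc]
  show "Comp A (comult W (fst P)) (snd (FObj S P)) =
      Comp A (snd (FObj (S \<odot>\<^bsub>EM A M\<^esub> S) P)) (FArr (MF M) (comult W (fst P)))"
    \<comment> \<open>The inner value must be recognised as an algebra before simp can evaluate the
      outer functor on it.\<close>
    using S.\<Phi>.FObj_Obj[of P] by (simp add: e[simplified] e'[simplified])
qed

text \<open>The structure maps at \<open>(X, \<alpha>)\<close> are \<open>\<mu>\<close> at
  \<open>CX\<close> and \<open>C\<mu> \<circ> \<theta>\<close> at \<open>BX\<close>, so the morphism
  condition is the compatibility of \<open>\<theta>\<close> with \<open>\<mu>\<close>.\<close>

lemma nat_trans_lift_law:
  "nat_trans (EM A M) (EM A M) (T \<odot>\<^bsub>EM A M\<^esub> S) (S \<odot>\<^bsub>EM A M\<^esub> T) lift_law"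
proof (rule nat_trans_lift_nat[OF em_over_compF[OF em_over_S em_over_free_forget]
      em_over_compF[OF em_over_free_forget em_over_S] \<theta>.nat_trans_axioms])
  fix P assume [simp]: "P \<in> Obj (EM A M)"
  show "Comp A (\<theta> (fst P)) (snd (FObj (T \<odot>\<^bsub>EM A M\<^esub> S) P)) =
      Comp A (snd (FObj (S \<odot>\<^bsub>EM A M\<^esub> T) P)) (FArr (MF M) (\<theta> (fst P)))"
    using T.\<Phi>.FObj_Obj[of P] S.\<Phi>.FObj_Obj[of P] by (simp add: law_mult)
qed

lemma lift_comonad_simps:
  "CF (lift_comonad A M W \<theta>) = S" "counit (lift_comonad A M W \<theta>) = lift_counit"
  "comult (lift_comonad A M W \<theta>) = lift_comult"
  by (simp_all add: lift_comonad_def Let_def)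

text \<open>Instances of the whiskering rule for the four transformations on \<open>EM A M\<close>;
  the open premise is the functor that is applied to them.\<close>

lemmas lift_whiskL =
  whiskL_lift_nat[OF nat_trans_lift_counit _ em_axioms] whiskL_lift_nat[OF nat_trans_lift_comult _ em_axioms]
  whiskL_lift_nat[OF nat_trans_lift_law _ em_axioms]
  whiskL_lift_nat[OF nat_trans_em_comult[unfolded em_comult_eq] _ em_axioms]

lemmas lift_calculus = compN_lift_nat[OF em_axioms]
  whiskR_lift_nat[OF em_over_S] whiskR_lift_nat[OF em_over_free_forget]

text \<open>Each law is the lift of the same law of \<open>W\<close>;
  \<open>S.\<Phi>.compF_assoc\<close> identifies the boundary functors of the two sides.\<close>

lemma comonad_lift_comonad: "comonad (EM A M) (lift_comonad A M W \<theta>)"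
  unfolding comonad_def Let_def lift_comonad_simps
  using comonad_W by (simp add: comonad_def Let_def nat_trans_lift_counit nat_trans_lift_comult
    lift_whiskL[OF em_over_S] lift_calculus idN_eq_lift_nat[OF em_over_S] S.\<Phi>.compF_assoc)

text \<open>The condition on the comultiplication of \<open>FU\<close>, seen on underlying arrows.
  It follows from the image under \<open>B\<close> of the unit axiom of \<open>\<theta>\<close> and
  naturality of \<open>\<theta>\<close> at the component of \<open>\<eta>\<close>.\<close>

lemma unit_law: "(CF W \<rhd>\<^bsub>A\<^esub> (MF M \<rhd>\<^bsub>A\<^esub> unit M)) \<bullet>\<^bsub>A,A\<^esub> \<theta> =
    (\<theta> \<lhd>\<^bsub>A\<^esub> MF M) \<bullet>\<^bsub>A,A\<^esub> (MF M \<rhd>\<^bsub>A\<^esub> \<theta>) \<bullet>\<^bsub>A,A\<^esub> ((MF M \<rhd>\<^bsub>A\<^esub> unit M) \<lhd>\<^bsub>A\<^esub> CF W)"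
proof -
  have "Comp A (FArr (CF W) (FArr (MF M) (unit M X))) (\<theta> X) =
      Comp A (\<theta> (FObj (MF M) X)) (Comp A (FArr (MF M) (\<theta> X)) (FArr (MF M) (unit M (FObj (CF W) X))))"
    if [simp]: "X \<in> Obj A" for X
  proof -
    have "Comp A (FArr (MF M) (\<theta> X)) (FArr (MF M) (unit M (FObj (CF W) X))) =
        FArr (MF M) (FArr (CF W) (unit M X))"
      by (subst \<eta>.G.FArr_Comp_Arr[symmetric]) (simp_all add: law_unit)
    then show ?thesis using law_natural[of "unit M X"] by simp
  qed
  then show ?thesis by (simp add: transformation_eq_iff[of _ A])
qed

text \<open>At \<open>(X, \<alpha>)\<close> the condition on the counit of \<open>FU\<close> says
  that \<open>C\<alpha> \<circ> \<theta>\<close> is the structure map of the lifted algebra, which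
  is how \<open>S\<close> is defined. The condition on the comultiplication of \<open>FU\<close> is
  \<open>unit_law\<close>, and the two on the lifted comonad are lifts of axioms of
  \<open>\<theta>\<close>.\<close>

lemma comonad_dist_law_lift_law:
  "comonad_dist_law (EM A M) (em_comonad A M) (lift_comonad A M W \<theta>) lift_law"
proof -
  have "(S \<rhd>\<^bsub>EM A M\<^esub> counit (em_comonad A M)) \<bullet>\<^bsub>EM A M,EM A M\<^esub> lift_law =
      counit (em_comonad A M) \<lhd>\<^bsub>EM A M\<^esub> S"
  proof -
    have "FArr S (FObj T P, snd P, P) = (FObj S (FObj T P), FArr (CF W) (snd P), FObj S P)"
      if "P \<in> Obj (EM A M)" for P
      using that by (intro lift_fun_simps) (simp add: EM_Arr_iff free_algebra algebra_mult)
    then show ?thesis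
      using S.\<Phi>.FObj_Obj by (simp add: transformation_eq_iff[of _ "EM A M"])
  qed
  then show ?thesis
    using mixed_law unfolding comonad_dist_law_def mixed_dist_law_def Let_def lift_comonad_simps
    by (simp add: comonad_lift_comonad comonad_em_comonad nat_trans_lift_law em_comult_eq unit_law
      lift_whiskL[OF em_over_S] lift_whiskL[OF em_over_free_forget] lift_calculus
      S.\<Phi>.compF_assoc T.\<Phi>.compF_assoc)
qed

end

lemma mix_cells0_mixed:
  assumes "X \<in> mix_cells0"
  shows "mixed (Cat X) (MonB X) (ComC X) (Law X)"
  using assms mix_cells0_D[OF assms] comonad_nat_trans[of "Cat X" "ComC X"] monad_em[of "Cat X" "MonB X"]
  by (simp add: mixed_def mixed_axioms_def mix_cells0_def)

lemma i_cell0_simps [simp]: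
  "Cat (i_cell0 X) = EM (Cat X) (MonB X)"
  "ComT (i_cell0 X) = em_comonad (Cat X) (MonB X)"
  "ComS (i_cell0 X) = lift_comonad (Cat X) (MonB X) (ComC X) (Law X)"
  "Law (i_cell0 X) = lift_nat (Cat X) (MonB X)
    (CF (em_comonad (Cat X) (MonB X)) \<odot>\<^bsub>EM (Cat X) (MonB X)\<^esub> CF (lift_comonad (Cat X) (MonB X) (ComC X) (Law X)))
    (CF (lift_comonad (Cat X) (MonB X) (ComC X) (Law X)) \<odot>\<^bsub>EM (Cat X) (MonB X)\<^esub> CF (em_comonad (Cat X) (MonB X)))
    (Law X)"
  by (simp_all add: i_cell0_def Let_def)

lemma i_cell0_in:
  assumes "X \<in> mix_cells0"
  shows "i_cell0 X \<in> dist_cells0"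
proof -
  interpret mixed "Cat X" "MonB X" "ComC X" "Law X" by (rule mix_cells0_mixed) fact
  show ?thesis
    using comonad_dist_law_lift_law by (simp add: dist_cells0_def lift_comonad_simps)
qed

section \<open>Lifting a 1-cell\<close>

locale mixed_mor = X: mixed A M W \<theta> + Y: mixed D M' W' \<psi> +
  law_mor A "MF M" "CF W" D "MF M'" "CF W'" \<Sigma> \<sigma> \<gamma>
  for A :: "('o, 'a) cat" and M W \<theta> and D :: "('p, 'b) cat" and M' W' \<psi> \<Sigma> \<sigma> \<gamma> +
  assumes lax_monad_mor: "lax_monad_mor A M D M' \<Sigma> \<sigma>"
    and colax_comonad_mor: "colax_comonad_mor A W D W' \<Sigma> \<gamma>"
    and yang_baxter: "yang_baxter A (MF M) (CF W) \<theta> D (MF M') (CF W') \<psi> \<Sigma> \<sigma> \<gamma>"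
begin

abbreviation "L \<equiv> lift_fun A M D \<Sigma> \<sigma>"
abbreviation "lift_lax \<equiv> lift_nat A M (Y.T \<odot>\<^bsub>EM A M\<^esub> L) (L \<odot>\<^bsub>EM A M\<^esub> X.T) \<sigma>"
abbreviation "lift_colax \<equiv> lift_nat A M (L \<odot>\<^bsub>EM A M\<^esub> X.S) (Y.S \<odot>\<^bsub>EM A M\<^esub> L) \<gamma>"

lemma em_over_L: "em_over A M D M' L \<Sigma>"
  by (rule em_over_lift_fun) (rule X.em_axioms Y.em_axioms S.cat_functor_axioms lax_monad_mor)+

sublocale L: em_over A M D M' L \<Sigma>
  by (rule em_over_L)

text \<open>The morphism condition is the multiplication condition on \<open>\<sigma>\<close>, both
  algebras having structure maps built from multiplications.\<close>

lemma nat_trans_lift_lax: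
  "nat_trans (EM A M) (EM D M') (Y.T \<odot>\<^bsub>EM A M\<^esub> L) (L \<odot>\<^bsub>EM A M\<^esub> X.T) lift_lax"
proof (rule nat_trans_lift_nat[OF em_over_compF[OF em_over_L Y.em_over_free_forget]
      em_over_compF[OF X.em_over_free_forget em_over_L] lax.nat_trans_axioms])
  fix P assume [simp]: "P \<in> Obj (EM A M)"
  show "Comp D (\<sigma> (fst P)) (snd (FObj (Y.T \<odot>\<^bsub>EM A M\<^esub> L) P)) =
      Comp D (snd (FObj (L \<odot>\<^bsub>EM A M\<^esub> X.T) P)) (FArr (MF M') (\<sigma> (fst P)))"
    using X.T.\<Phi>.FObj_Obj[of P] L.\<Phi>.FObj_Obj[of P] lax_monad_mor by (simp add: lax_monad_mor_iff)
qed

text \<open>Naturality of \<open>\<gamma>\<close> moves it past the structure map; what remains to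
  be shown is the Yang-Baxter equation.\<close>

lemma nat_trans_lift_colax:
  "nat_trans (EM A M) (EM D M') (L \<odot>\<^bsub>EM A M\<^esub> X.S) (Y.S \<odot>\<^bsub>EM A M\<^esub> L) lift_colax"
proof (rule nat_trans_lift_nat[OF em_over_compF[OF X.em_over_S em_over_L]
      em_over_compF[OF em_over_L Y.em_over_S] colax.nat_trans_axioms])
  fix P assume [simp]: "P \<in> Obj (EM A M)"
  let ?X = "fst P" and ?\<alpha> = "snd P"
  have "Comp D (\<gamma> ?X) (Comp D (FArr \<Sigma> (FArr (CF W) ?\<alpha>)) (Comp D (FArr \<Sigma> (\<theta> ?X)) (\<sigma> (FObj (CF W) ?X)))) =
      Comp D (FArr (CF W') (FArr \<Sigma> ?\<alpha>)) (Comp D (\<gamma> (FObj (MF M) ?X)) (Comp D (FArr \<Sigma> (\<theta> ?X)) (\<sigma> (FObj (CF W) ?X))))"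
    using colax_natural[of ?\<alpha> ?X, THEN Y.\<eta>.F.S.Comp_eq_reassoc,
      of "Comp D (FArr \<Sigma> (\<theta> ?X)) (\<sigma> (FObj (CF W) ?X))"] by simp
  also have "Comp D (\<gamma> (FObj (MF M) ?X)) (Comp D (FArr \<Sigma> (\<theta> ?X)) (\<sigma> (FObj (CF W) ?X))) =
      Comp D (FArr (CF W') (\<sigma> ?X)) (Comp D (\<psi> (FObj \<Sigma> ?X)) (FArr (MF M') (\<gamma> ?X)))"
    using yang_baxter by (simp add: yang_baxter_iff)
  finally show "Comp D (\<gamma> ?X) (snd (FObj (L \<odot>\<^bsub>EM A M\<^esub> X.S) P)) =
      Comp D (snd (FObj (Y.S \<odot>\<^bsub>EM A M\<^esub> L) P)) (FArr (MF M') (\<gamma> ?X))"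
    using X.S.\<Phi>.FObj_Obj[of P] L.\<Phi>.FObj_Obj[of P] by simp
qed

lemmas lift_mor_whiskL =
  whiskL_lift_nat[OF nat_trans_lift_lax _ X.em_axioms] whiskL_lift_nat[OF nat_trans_lift_colax _ X.em_axioms]

text \<open>The counterpart of \<open>unit_law\<close> with \<open>(\<Sigma>, \<sigma>)\<close> in
  place of \<open>(C, \<theta>)\<close>: the unit condition under the functor of \<open>M'\<close>,
  then naturality of \<open>\<sigma>\<close> at the component of \<open>\<eta>\<close>.\<close>

lemma unit_lax: "(\<Sigma> \<rhd>\<^bsub>A\<^esub> (MF M \<rhd>\<^bsub>A\<^esub> unit M)) \<bullet>\<^bsub>A,D\<^esub> \<sigma> =
    (\<sigma> \<lhd>\<^bsub>A\<^esub> MF M) \<bullet>\<^bsub>A,D\<^esub> (MF M' \<rhd>\<^bsub>A\<^esub> \<sigma>) \<bullet>\<^bsub>A,D\<^esub> ((MF M' \<rhd>\<^bsub>D\<^esub> unit M') \<lhd>\<^bsub>A\<^esub> \<Sigma>)"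
proof -
  have "Comp D (FArr \<Sigma> (FArr (MF M) (unit M X))) (\<sigma> X) =
      Comp D (\<sigma> (FObj (MF M) X)) (Comp D (FArr (MF M') (\<sigma> X)) (FArr (MF M') (unit M' (FObj \<Sigma> X))))"
    if [simp]: "X \<in> Obj A" for X
  proof -
    have "Comp D (\<sigma> X) (unit M' (FObj \<Sigma> X)) = FArr \<Sigma> (unit M X)"
      using lax_monad_mor by (simp add: lax_monad_mor_iff)
    then have "Comp D (FArr (MF M') (\<sigma> X)) (FArr (MF M') (unit M' (FObj \<Sigma> X))) =
        FArr (MF M') (FArr \<Sigma> (unit M X))"
      by (subst Y.\<eta>.G.FArr_Comp_Arr[symmetric]) simp_all
    then show ?thesis using lax_natural[of "unit M X"] by simp
  qed
  then show ?thesis by (simp add: transformation_eq_iff[of _ A])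
qed

text \<open>For the counit both sides have the underlying arrow
  \<open>\<Sigma>\<alpha> \<circ> \<sigma>\<close>, the structure map that \<open>L\<close> assigns;
  for the comultiplication the equation is the lift of \<open>unit_lax\<close>.\<close>

lemma lax_comonad_mor_lift:
  "lax_comonad_mor (EM A M) (em_comonad A M) (EM D M') (em_comonad D M') L lift_lax"
proof -
  have "(L \<rhd>\<^bsub>EM A M\<^esub> counit (em_comonad A M)) \<bullet>\<^bsub>EM A M,EM D M'\<^esub> lift_lax =
      counit (em_comonad D M') \<lhd>\<^bsub>EM A M\<^esub> L"
  proof -
    have "FArr L (FObj X.T P, snd P, P) = (FObj L (FObj X.T P), FArr \<Sigma> (snd P), FObj L P)"
      if "P \<in> Obj (EM A M)" for P
      using that by (intro lift_fun_simps) (simp add: EM_Arr_iff X.free_algebra X.algebra_mult)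
    then show ?thesis
      using L.\<Phi>.FObj_Obj by (simp add: transformation_eq_iff[of _ "EM A M"])
  qed
  then show ?thesis
    unfolding lax_comonad_mor_def Let_def
    by (simp add: nat_trans_lift_lax X.em_comult_eq Y.em_comult_eq X.lift_whiskL[OF em_over_L]
      lift_mor_whiskL[OF Y.em_over_free_forget] whiskR_lift_nat[OF em_over_L] X.lift_calculus
      X.T.\<Phi>.compF_assoc L.\<Phi>.compF_assoc unit_lax)
qed

lemma colax_comonad_mor_lift:
  "colax_comonad_mor (EM A M) (lift_comonad A M W \<theta>) (EM D M') (lift_comonad D M' W' \<psi>) L lift_colax"
  unfolding colax_comonad_mor_def Let_def X.lift_comonad_simps Y.lift_comonad_simps
  using colax_comonad_mor
  by (simp add: colax_comonad_mor_def Let_def nat_trans_lift_colax X.lift_whiskL[OF em_over_L]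
      lift_mor_whiskL[OF Y.em_over_S] whiskR_lift_nat[OF em_over_L] X.lift_calculus
      X.S.\<Phi>.compF_assoc L.\<Phi>.compF_assoc)

text \<open>A second use of the Yang-Baxter equation: it made \<open>lift_colax\<close> consist of
  algebra morphisms, and its lift is the equation required in Dist.\<close>

lemma yang_baxter_lift:
  "yang_baxter (EM A M) X.T X.S X.lift_law (EM D M') Y.T Y.S Y.lift_law L lift_lax lift_colax"
  using yang_baxter
  by (simp add: yang_baxter_def X.lift_whiskL[OF em_over_L]
      lift_mor_whiskL[OF Y.em_over_S] lift_mor_whiskL[OF Y.em_over_free_forget]
      whiskR_lift_nat[OF em_over_L] X.lift_calculus
      X.S.\<Phi>.compF_assoc X.T.\<Phi>.compF_assoc L.\<Phi>.compF_assoc)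

end

lemma mix_cells1_mixed_mor:
  assumes "f \<in> mix_cells1"
  shows "mixed_mor (Cat (Src f)) (MonB (Src f)) (ComC (Src f)) (Law (Src f))
    (Cat (Tgt f)) (MonB (Tgt f)) (ComC (Tgt f)) (Law (Tgt f)) (Fun f) (Lax f) (Colax f)"
  using assms by (simp add: mix_cells1_eq law_cells1_def mixed_mor_def mixed_mor_axioms_def mix_mor_def
    mix_cells0_mixed Let_def)

lemma i_cell1_simps [simp]:
  "Src (i_cell1 f) = i_cell0 (Src f)" "Tgt (i_cell1 f) = i_cell0 (Tgt f)"
  "Fun (i_cell1 f) = lift_fun (Cat (Src f)) (MonB (Src f)) (Cat (Tgt f)) (Fun f) (Lax f)"
  "Lax (i_cell1 f) = lift_nat (Cat (Src f)) (MonB (Src f))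
    (CF (ComT (i_cell0 (Tgt f))) \<odot>\<^bsub>EM (Cat (Src f)) (MonB (Src f))\<^esub> Fun (i_cell1 f))
    (Fun (i_cell1 f) \<odot>\<^bsub>EM (Cat (Src f)) (MonB (Src f))\<^esub> CF (ComT (i_cell0 (Src f)))) (Lax f)"
  "Colax (i_cell1 f) = lift_nat (Cat (Src f)) (MonB (Src f))
    (Fun (i_cell1 f) \<odot>\<^bsub>EM (Cat (Src f)) (MonB (Src f))\<^esub> CF (ComS (i_cell0 (Src f))))
    (CF (ComS (i_cell0 (Tgt f))) \<odot>\<^bsub>EM (Cat (Src f)) (MonB (Src f))\<^esub> Fun (i_cell1 f)) (Colax f)"
  by (simp_all add: i_cell1_def Let_def)

lemma i_cell2_simps [simp]:
  "Src2 (i_cell2 \<alpha>) = i_cell1 (Src2 \<alpha>)" "Tgt2 (i_cell2 \<alpha>) = i_cell1 (Tgt2 \<alpha>)"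
  "Trans (i_cell2 \<alpha>) = lift_nat (Cat (Src (Src2 \<alpha>))) (MonB (Src (Src2 \<alpha>)))
    (Fun (i_cell1 (Src2 \<alpha>))) (Fun (i_cell1 (Tgt2 \<alpha>))) (Trans \<alpha>)"
  by (simp_all add: i_cell2_def Let_def)

lemma i_cell1_in:
  assumes "f \<in> mix_cells1"
  shows "i_cell1 f \<in> dist_cells1"
proof -
  interpret mixed_mor "Cat (Src f)" "MonB (Src f)" "ComC (Src f)" "Law (Src f)"
    "Cat (Tgt f)" "MonB (Tgt f)" "ComC (Tgt f)" "Law (Tgt f)" "Fun f" "Lax f" "Colax f"
    using assms by (rule mix_cells1_mixed_mor)
  have "Src f \<in> mix_cells0" "Tgt f \<in> mix_cells0" using assms by (simp_all add: mix_cells1_def)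
  then show ?thesis
    using L.\<Phi>.cat_functor_axioms lax_comonad_mor_lift colax_comonad_mor_lift yang_baxter_lift
    by (simp add: dist_cells1_def i_cell0_in X.lift_comonad_simps Y.lift_comonad_simps)
qed

section \<open>Lifting a 2-cell\<close>

locale mixed_cell = f: mixed_mor A M W \<theta> D M' W' \<psi> \<Sigma> \<sigma> \<gamma> + g: mixed_mor A M W \<theta> D M' W' \<psi> \<Sigma>' \<sigma>' \<gamma>' +
  law_cell A "MF M" "CF W" D "MF M'" "CF W'" \<Sigma> \<sigma> \<gamma> \<Sigma>' \<sigma>' \<gamma>' \<alpha>
  for A :: "('o, 'a) cat" and M W \<theta> and D :: "('p, 'b) cat" and M' W' \<psi> \<Sigma> \<sigma> \<gamma> \<Sigma>' \<sigma>' \<gamma>' \<alpha>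
begin

abbreviation "lift_cell \<equiv> lift_nat A M f.L g.L \<alpha>"

text \<open>Naturality of \<open>\<alpha>\<close> at the structure map, then its compatibility with
  the lax parts, give the morphism condition.\<close>

lemma nat_trans_lift_cell: "nat_trans (EM A M) (EM D M') f.L g.L lift_cell"
proof (rule nat_trans_lift_nat[OF f.em_over_L g.em_over_L nat_trans_axioms])
  fix P assume [simp]: "P \<in> Obj (EM A M)"
  note e = natural[of "snd P" "fst P"] lax_compat[of "fst P"]
  note e' = e[THEN f.Y.\<eta>.F.S.Comp_eq_reassoc]
  show "Comp D (\<alpha> (fst P)) (snd (FObj f.L P)) = Comp D (snd (FObj g.L P)) (FArr (MF M') (\<alpha> (fst P)))"
    by (simp add: e[simplified] e'[simplified])
qed

lemma lift_cell_compat: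
  "g.lift_lax \<bullet>\<^bsub>EM A M,EM D M'\<^esub> (f.Y.T \<rhd>\<^bsub>EM A M\<^esub> lift_cell) =
    (lift_cell \<lhd>\<^bsub>EM A M\<^esub> f.X.T) \<bullet>\<^bsub>EM A M,EM D M'\<^esub> f.lift_lax"
  "g.lift_colax \<bullet>\<^bsub>EM A M,EM D M'\<^esub> (lift_cell \<lhd>\<^bsub>EM A M\<^esub> f.X.S) =
    (f.Y.S \<rhd>\<^bsub>EM A M\<^esub> lift_cell) \<bullet>\<^bsub>EM A M,EM D M'\<^esub> f.lift_colax"
proof -
  note w = whiskL_lift_nat[OF nat_trans_lift_cell _ f.X.em_axioms]
  have "\<sigma>' \<bullet>\<^bsub>A,D\<^esub> (MF M' \<rhd>\<^bsub>A\<^esub> \<alpha>) = (\<alpha> \<lhd>\<^bsub>A\<^esub> MF M) \<bullet>\<^bsub>A,D\<^esub> \<sigma>"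
      "\<gamma>' \<bullet>\<^bsub>A,D\<^esub> (\<alpha> \<lhd>\<^bsub>A\<^esub> CF W) = (CF W' \<rhd>\<^bsub>A\<^esub> \<alpha>) \<bullet>\<^bsub>A,D\<^esub> \<gamma>"
    by (simp_all add: transformation_eq_iff[of _ A] lax_compat colax_compat)
  then show
    "g.lift_lax \<bullet>\<^bsub>EM A M,EM D M'\<^esub> (f.Y.T \<rhd>\<^bsub>EM A M\<^esub> lift_cell) =
      (lift_cell \<lhd>\<^bsub>EM A M\<^esub> f.X.T) \<bullet>\<^bsub>EM A M,EM D M'\<^esub> f.lift_lax"
    "g.lift_colax \<bullet>\<^bsub>EM A M,EM D M'\<^esub> (lift_cell \<lhd>\<^bsub>EM A M\<^esub> f.X.S) =
      (f.Y.S \<rhd>\<^bsub>EM A M\<^esub> lift_cell) \<bullet>\<^bsub>EM A M,EM D M'\<^esub> f.lift_colax"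
    by (simp_all add: w[OF f.Y.em_over_free_forget] w[OF f.Y.em_over_S] f.X.lift_calculus)
qed

end

lemma mix_cells2_mixed_cell:
  assumes "\<alpha> \<in> mix_cells2"
  shows "mixed_cell (Cat (Src (Src2 \<alpha>))) (MonB (Src (Src2 \<alpha>))) (ComC (Src (Src2 \<alpha>))) (Law (Src (Src2 \<alpha>)))
    (Cat (Tgt (Src2 \<alpha>))) (MonB (Tgt (Src2 \<alpha>))) (ComC (Tgt (Src2 \<alpha>))) (Law (Tgt (Src2 \<alpha>)))
    (Fun (Src2 \<alpha>)) (Lax (Src2 \<alpha>)) (Colax (Src2 \<alpha>)) (Fun (Tgt2 \<alpha>)) (Lax (Tgt2 \<alpha>)) (Colax (Tgt2 \<alpha>)) (Trans \<alpha>)"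
proof -
  note b = mix.cells2_boundary[OF assms[unfolded mix_cells2_eq]]
  show ?thesis
    using mix_cells1_mixed_mor[of "Src2 \<alpha>"] mix_cells1_mixed_mor[of "Tgt2 \<alpha>"] b
      mix.cells2_law_cell[OF assms[unfolded mix_cells2_eq]]
    by (simp add: mixed_cell_def mix_cells1_eq)
qed

lemma i_cell2_in:
  assumes "\<alpha> \<in> mix_cells2"
  shows "i_cell2 \<alpha> \<in> dist_cells2"
proof -
  interpret mixed_cell "Cat (Src (Src2 \<alpha>))" "MonB (Src (Src2 \<alpha>))" "ComC (Src (Src2 \<alpha>))" "Law (Src (Src2 \<alpha>))"
    "Cat (Tgt (Src2 \<alpha>))" "MonB (Tgt (Src2 \<alpha>))" "ComC (Tgt (Src2 \<alpha>))" "Law (Tgt (Src2 \<alpha>))"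
    "Fun (Src2 \<alpha>)" "Lax (Src2 \<alpha>)" "Colax (Src2 \<alpha>)" "Fun (Tgt2 \<alpha>)" "Lax (Tgt2 \<alpha>)" "Colax (Tgt2 \<alpha>)" "Trans \<alpha>"
    using assms by (rule mix_cells2_mixed_cell)
  note b = mix.cells2_boundary[OF assms[unfolded mix_cells2_eq], folded mix_cells1_eq]
  show ?thesis
    using nat_trans_lift_cell lift_cell_compat
    by (simp add: dist_cells2_def i_cell1_in b f.X.lift_comonad_simps f.Y.lift_comonad_simps)
qed

section \<open>Strict preservation of identities and composites\<close>

lemma i_cell1_id1:
  assumes "X \<in> mix_cells0"
  shows "i_cell1 (law_id1 mix_P mix_Q X) = law_id1 dist_P dist_Q (i_cell0 X)"
proof -
  interpret mixed "Cat X" "MonB X" "ComC X" "Law X" by (rule mix_cells0_mixed) fact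
  let ?A = "Cat X" and ?M = "MonB X"
  \<comment> \<open>The lifted structure map is the given one preceded by the identity of its
    domain.\<close>
  have L: "lift_fun ?A ?M ?A (idF ?A) (idN ?A ?A (MF ?M)) = idF (EM ?A ?M)"
  proof (rule fctr_eqI)
    fix x assume x: "x \<in> Arr (EM ?A ?M)"
    show "FArr (lift_fun ?A ?M ?A (idF ?A) (idN ?A ?A (MF ?M))) x = FArr (idF (EM ?A ?M)) x"
      by (rule EM_Arr_cases[OF x]) (use x in simp)
  qed simp_all
  show ?thesis
    by (rule cell1.equality) (simp_all add: L lift_comonad_simps
      idN_eq_lift_nat[OF em_over_S] idN_eq_lift_nat[OF em_over_free_forget])
qed

text \<open>The structure maps agree once \<open>Fun g\<close> is distributed over
  \<open>\<Sigma>\<alpha> \<circ> \<sigma>\<close>: the result is built with exactly the composite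
  lax part. With the functors identified, the lax and colax parts follow from the lifting
  calculus.\<close>

lemma i_cell1_comp1:
  assumes "f \<in> mix_cells1" "g \<in> mix_cells1" "Tgt f = Src g"
  shows "i_cell1 (cell_comp1 g f) = cell_comp1 (i_cell1 g) (i_cell1 f)"
proof -
  let ?A = "Cat (Src f)" and ?M = "MonB (Src f)" and ?D = "Cat (Src g)" and ?N = "MonB (Src g)"
    and ?E = "Cat (Tgt g)"
  interpret f: mixed_mor ?A ?M "ComC (Src f)" "Law (Src f)"
    ?D ?N "ComC (Src g)" "Law (Src g)" "Fun f" "Lax f" "Colax f"
    using mix_cells1_mixed_mor[OF assms(1)] assms(3) by simp
  interpret g: mixed_mor ?D ?N "ComC (Src g)" "Law (Src g)"
    ?E "MonB (Tgt g)" "ComC (Tgt g)" "Law (Tgt g)" "Fun g" "Lax g" "Colax g"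
    using assms(2) by (rule mix_cells1_mixed_mor)
  have L: "lift_fun ?A ?M ?E (Fun g \<odot>\<^bsub>?A\<^esub> Fun f)
      ((Fun g \<rhd>\<^bsub>?A\<^esub> Lax f) \<bullet>\<^bsub>?A,?E\<^esub> (Lax g \<lhd>\<^bsub>?A\<^esub> Fun f)) = g.L \<odot>\<^bsub>EM ?A ?M\<^esub> f.L"
    (is "?L = _")
  proof (rule fctr_eqI)
    show o: "FObj ?L P = FObj (g.L \<odot>\<^bsub>EM ?A ?M\<^esub> f.L) P" if "P \<in> Obj (EM ?A ?M)" for P
      using that f.L.\<Phi>.FObj_Obj[OF that] by simp
    fix x assume x: "x \<in> Arr (EM ?A ?M)"
    then obtain P u Q where p: "x = (P, u, Q)" "P \<in> Obj (EM ?A ?M)" "Q \<in> Obj (EM ?A ?M)" "u \<in> Arr ?A"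
      by (elim EM_Arr_cases) simp
    \<comment> \<open>Recorded as an arrow so that the outer lift can be evaluated on it.\<close>
    have "(FObj f.L P, FArr (Fun f) u, FObj f.L Q) \<in> Arr (EM ?D ?N)"
      using f.L.\<Phi>.FArr_simps(1)[OF x] x p(1) by simp
    with x show "FArr ?L x = FArr (g.L \<odot>\<^bsub>EM ?A ?M\<^esub> f.L) x"
      unfolding p(1) using o p by simp
  qed simp_all
  note w = f.lift_mor_whiskL[OF g.em_over_L] whiskR_lift_nat[OF f.em_over_L]
    compN_lift_nat[OF f.X.em_axioms] f.L.\<Phi>.compF_assoc f.X.T.\<Phi>.compF_assoc f.X.S.\<Phi>.compF_assoc
  show ?thesis
    by (rule cell1.equality) (simp_all add: L assms(3) w f.X.lift_comonad_simps
      f.Y.lift_comonad_simps g.Y.lift_comonad_simps)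
qed

lemma i_cell2_id2:
  assumes "f \<in> mix_cells1"
  shows "i_cell2 (cell_id2 f) = cell_id2 (i_cell1 f)"
proof -
  interpret f: mixed_mor "Cat (Src f)" "MonB (Src f)" "ComC (Src f)" "Law (Src f)"
    "Cat (Tgt f)" "MonB (Tgt f)" "ComC (Tgt f)" "Law (Tgt f)" "Fun f" "Lax f" "Colax f"
    using assms by (rule mix_cells1_mixed_mor)
  show ?thesis
    by (rule cell2.equality) (simp_all add: idN_eq_lift_nat[OF f.em_over_L])
qed

lemma i_cell2_vcomp:
  assumes "\<alpha> \<in> mix_cells2" "\<beta> \<in> mix_cells2" "Tgt2 \<alpha> = Src2 \<beta>"
  shows "i_cell2 (cell_vcomp \<beta> \<alpha>) = cell_vcomp (i_cell2 \<beta>) (i_cell2 \<alpha>)"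
proof -
  note b = mix.cells2_boundary[OF assms(1)[unfolded mix_cells2_eq]]
  have e: "Src (Src2 \<beta>) = Src (Src2 \<alpha>)" "Tgt (Src2 \<beta>) = Tgt (Src2 \<alpha>)"
    using b assms(3) by metis+
  interpret mixed "Cat (Src (Src2 \<alpha>))" "MonB (Src (Src2 \<alpha>))" "ComC (Src (Src2 \<alpha>))" "Law (Src (Src2 \<alpha>))"
    by (rule mix_cells0_mixed) (use b(1) in \<open>simp add: law_cells1_def\<close>)
  show ?thesis
    by (rule cell2.equality) (simp_all add: e assms(3) compN_lift_nat[OF em_axioms])
qed

lemma i_cell2_hcomp:
  assumes "\<alpha> \<in> mix_cells2" "\<beta> \<in> mix_cells2" "Tgt (Src2 \<alpha>) = Src (Src2 \<beta>)"
  shows "i_cell2 (cell_hcomp \<beta> \<alpha>) = cell_hcomp (i_cell2 \<beta>) (i_cell2 \<alpha>)"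
proof -
  note a = mix.cells2_boundary[OF assms(1)[unfolded mix_cells2_eq], folded mix_cells1_eq]
  note b = mix.cells2_boundary[OF assms(2)[unfolded mix_cells2_eq], folded mix_cells1_eq]
  have c: "i_cell1 (cell_comp1 (Src2 \<beta>) (Src2 \<alpha>)) = cell_comp1 (i_cell1 (Src2 \<beta>)) (i_cell1 (Src2 \<alpha>))"
    "i_cell1 (cell_comp1 (Tgt2 \<beta>) (Tgt2 \<alpha>)) = cell_comp1 (i_cell1 (Tgt2 \<beta>)) (i_cell1 (Tgt2 \<alpha>))"
    using i_cell1_comp1[OF a(1) b(1)] i_cell1_comp1[OF a(2) b(2)] by (simp_all add: a b assms(3))
  interpret a: mixed_cell "Cat (Src (Src2 \<alpha>))" "MonB (Src (Src2 \<alpha>))" "ComC (Src (Src2 \<alpha>))" "Law (Src (Src2 \<alpha>))"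
    "Cat (Src (Src2 \<beta>))" "MonB (Src (Src2 \<beta>))" "ComC (Src (Src2 \<beta>))" "Law (Src (Src2 \<beta>))"
    "Fun (Src2 \<alpha>)" "Lax (Src2 \<alpha>)" "Colax (Src2 \<alpha>)" "Fun (Tgt2 \<alpha>)" "Lax (Tgt2 \<alpha>)" "Colax (Tgt2 \<alpha>)" "Trans \<alpha>"
    using mix_cells2_mixed_cell[OF assms(1)] assms(3) by simp
  interpret b: mixed_cell "Cat (Src (Src2 \<beta>))" "MonB (Src (Src2 \<beta>))" "ComC (Src (Src2 \<beta>))" "Law (Src (Src2 \<beta>))"
    "Cat (Tgt (Src2 \<beta>))" "MonB (Tgt (Src2 \<beta>))" "ComC (Tgt (Src2 \<beta>))" "Law (Tgt (Src2 \<beta>))"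
    "Fun (Src2 \<beta>)" "Lax (Src2 \<beta>)" "Colax (Src2 \<beta>)" "Fun (Tgt2 \<beta>)" "Lax (Tgt2 \<beta>)" "Colax (Tgt2 \<beta>)" "Trans \<beta>"
    using assms(2) by (rule mix_cells2_mixed_cell)
  note w = whiskL_lift_nat[OF a.nat_trans_lift_cell b.f.em_over_L a.f.X.em_axioms]
    whiskR_lift_nat[OF a.g.em_over_L] compN_lift_nat[OF a.f.X.em_axioms]
  show ?thesis
  proof (rule cell2.equality)
    \<comment> \<open>The boundary functors become composites of lifts before
      \<open>i_cell1_simps\<close> can expand them to lifts of composites.\<close>
    have "Fun (i_cell1 (cell_comp1 (Src2 \<beta>) (Src2 \<alpha>))) = b.f.L \<odot>\<^bsub>EM (Cat (Src (Src2 \<alpha>))) (MonB (Src (Src2 \<alpha>)))\<^esub> a.f.L"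
      "Fun (i_cell1 (cell_comp1 (Tgt2 \<beta>) (Tgt2 \<alpha>))) = b.g.L \<odot>\<^bsub>EM (Cat (Src (Src2 \<alpha>))) (MonB (Src (Src2 \<alpha>)))\<^esub> a.g.L"
      unfolding c by (simp_all add: a b assms(3))
    then show "Trans (i_cell2 (cell_hcomp \<beta> \<alpha>)) = Trans (cell_hcomp (i_cell2 \<beta>) (i_cell2 \<alpha>))"
      unfolding i_cell2_simps cell_hcomp_simps by (simp add: w a b assms(3))
  qed (simp_all add: c)
qed

lemma Mix_simps [simp]:
  "Cell0 Mix = mix_cells0" "Cell1 Mix = mix_cells1" "Cell2 Mix = mix_cells2"
  "src1 Mix = Src" "tgt1 Mix = Tgt" "src2 Mix = Src2" "tgt2 Mix = Tgt2" "id2 Mix = cell_id2"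
  "comp1 Mix = cell_comp1" "vcomp Mix = cell_vcomp" "hcomp Mix = cell_hcomp"
  by (simp_all add: Mix_def)

lemma Dist_simps [simp]:
  "Cell0 Dist = dist_cells0" "Cell1 Dist = dist_cells1" "Cell2 Dist = dist_cells2"
  "src1 Dist = Src" "tgt1 Dist = Tgt" "src2 Dist = Src2" "tgt2 Dist = Tgt2" "id2 Dist = cell_id2"
  "comp1 Dist = cell_comp1" "vcomp Dist = cell_vcomp" "hcomp Dist = cell_hcomp"
  by (simp_all add: Dist_def)

text \<open>The common form of identities is the one in which the closure results and
  \<open>i_cell1_id1\<close> are stated.\<close>

lemma id1_simps [simp]: "id1 Mix = law_id1 mix_P mix_Q" "id1 Dist = law_id1 dist_P dist_Q"
  by (simp_all add: Mix_eq Dist_eq law_two_cat_def)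

theorem proposition2p8:
  shows "two_functor
    (Mix :: (('o, 'a) mix0, ('o, 'a) mix1, ('o, 'a) mix2) twocat)
    (Dist :: (('o \<times> 'a, ('o \<times> 'a) \<times> 'a \<times> ('o \<times> 'a)) dist0,
              ('o \<times> 'a, ('o \<times> 'a) \<times> 'a \<times> ('o \<times> 'a)) dist1,
              ('o \<times> 'a, ('o \<times> 'a) \<times> 'a \<times> ('o \<times> 'a)) dist2) twocat)
    (\<lambda>X\<in>Cell0 Mix. i_cell0 X) (\<lambda>f\<in>Cell1 Mix. i_cell1 f) (\<lambda>\<alpha>\<in>Cell2 Mix. i_cell2 \<alpha>)"
proof (intro two_functor.intro two_functor_axioms.intro two_category_Mix two_category_Dist)
  let ?Mix = "Mix :: (('o, 'a) mix0, ('o, 'a) mix1, ('o, 'a) mix2) twocat"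
  let ?Dist = "Dist :: (('o \<times> 'a, ('o \<times> 'a) \<times> 'a \<times> ('o \<times> 'a)) dist0,
      ('o \<times> 'a, ('o \<times> 'a) \<times> 'a \<times> ('o \<times> 'a)) dist1, ('o \<times> 'a, ('o \<times> 'a) \<times> 'a \<times> ('o \<times> 'a)) dist2) twocat"
  interpret M: two_category ?Mix
    by (rule two_category_Mix)
  interpret D: two_category ?Dist
    by (rule two_category_Dist)
  note closed = mix.id1_in[folded mix_cells1_eq] mix.comp1_in[folded mix_cells1_eq]
    mix.id2_in[folded mix_cells1_eq mix_cells2_eq] mix.vcomp_in[folded mix_cells2_eq]
    mix.hcomp_in[folded mix_cells2_eq]
  have b1: "Src f \<in> mix_cells0" "Tgt f \<in> mix_cells0" if "f \<in> mix_cells1" for f :: "('o, 'a) mix1"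
    using that by (simp_all add: mix_cells1_def)
  have b2: "Src2 \<alpha> \<in> mix_cells1" "Tgt2 \<alpha> \<in> mix_cells1" if "\<alpha> \<in> mix_cells2" for \<alpha> :: "('o, 'a) mix2"
    using that by (simp_all add: mix_cells2_def)
  \<comment> \<open>The three maps are restricted to cells, so each evaluation on a boundary,
    identity or composite needs its membership.\<close>
  note cells = closed b1 b2 i_cell0_in i_cell1_in i_cell2_in
  show "cat_functor (one_cat ?Mix) (one_cat ?Dist) \<lparr>FObj = \<lambda>X\<in>Cell0 ?Mix. i_cell0 X, FArr = \<lambda>f\<in>Cell1 ?Mix. i_cell1 f\<rparr>"
    by (rule cat_functorI[OF M.one_category D.one_category])
      (simp_all add: one_cat_def cells i_cell1_id1 i_cell1_comp1)
  show "cat_functor (vert_cat ?Mix) (vert_cat ?Dist) \<lparr>FObj = \<lambda>f\<in>Cell1 ?Mix. i_cell1 f, FArr = \<lambda>\<alpha>\<in>Cell2 ?Mix. i_cell2 \<alpha>\<rparr>"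
    by (rule cat_functorI[OF M.vert_category D.vert_category])
      (simp_all add: vert_cat_def cells i_cell2_id2 i_cell2_vcomp)
  show "cat_functor (horiz_cat ?Mix) (horiz_cat ?Dist) \<lparr>FObj = \<lambda>X\<in>Cell0 ?Mix. i_cell0 X, FArr = \<lambda>\<alpha>\<in>Cell2 ?Mix. i_cell2 \<alpha>\<rparr>"
    by (rule cat_functorI[OF M.horiz_category D.horiz_category])
      (simp_all add: horiz_cat_def cells i_cell2_id2 i_cell1_id1 i_cell2_hcomp)
qed

end
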